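(* Let $R$ be a $\mathbb{Z}$-graded graded-commutative ring, and let $\mathsf{S}$, $\mathsf{T}$ be graded $R$-linear triangulated categories. Suppose that $\mathsf{T}$ is Ext-finite and that every cohomological graded $R$-linear functor $\mathsf{S}^{op} \to \operatorname{grMod}(R)$ that is locally finite is graded representable. Then every graded $R$-linear functor $\mathsf{f} \colon \mathsf{S} \to \mathsf{T}$ has a right adjoint.
   Context: Graded modules. A $\mathbb{Z}$-graded ring $R=\coprod_{d} R_d$ is graded-commutative if $rs=(-1)^{de}sr$ for $r\in R_d$, $s\in R_e$. $\operatorname{grMod}(R)$ is the category of graded $R$-modules with degree-preserving $R$-linear maps. The shift is $(M[n])_d=M_{n+d}$, where a homogeneous $r\in R$ acts on $M[n]$ by $(-1)^{n|r|}$ times its action on $M$ (Koszul sign convention). Graded linear categories. Let $\mathsf{T}$ be a triangulated category with suspension $\Sigma$. Write $\operatorname{Ext}^*_{\mathsf{T}}(X,Y)=\coprod_{d\in\mathbb{Z}}\operatorname{Hom}_{\mathsf{T}}(X,\Sigma^d Y)$. The graded center is $\operatorname{Z}(\mathsf{T})=\coprod_{d}\{\eta\colon \operatorname{id}_{\mathsf{T}}\to\Sigma^d \mid \eta\Sigma=(-1)^d\Sigma\eta\}$. $\mathsf{T}$ is graded $R$-linear if it is equipped with a homomorphism of graded rings $\varphi\colon R\to \operatorname{Z}(\mathsf{T})$; then $\operatorname{Ext}^*_{\mathsf{T}}(X,Y)$ is a graded $R$-module via $r\cdot h=\varphi(r)_{\Sigma^eY}\circ h=(\Sigma^{|r|}h)\circ\varphi(r)_X$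 for $h\in\operatorname{Hom}_{\mathsf{T}}(X,\Sigma^eY)$ and homogeneous $r$. $\mathsf{T}$ is Ext-finite if $\operatorname{Ext}^*_{\mathsf{T}}(X,Y)$ is a finitely generated graded $R$-module for all $X,Y\in\mathsf{T}$. Graded linear functors to modules. A functor $\mathsf{h}\colon\mathsf{S}^{op}\to\operatorname{grMod}(R)$ is graded $R$-linear if (i) $\mathsf{h}(\Sigma^nX)=\mathsf{h}(X)[-n]$ naturally in $X$, for all $n$; and (ii) the induced map from $\operatorname{Ext}^*_{\mathsf{S}}(X,Y)$ to the graded module $\coprod_d\operatorname{Hom}_{\operatorname{grMod}(R)}(\mathsf{h}(Y),\mathsf{h}(X)[d])$, sending $u\colon X\to\Sigma^dY$ to $\mathsf{h}(u)\colon \mathsf{h}(Y)[-d]\to \mathsf{h}(X)$ viewed as a degree $d$ map $\mathsf{h}(Y)\to\mathsf{h}(X)$, is a map of graded $R$-modules, where $(r\alpha)(m)=r\,\alpha(m)$. It is cohomological if it sends exact triangles to long exact sequences of graded $R$-modules, and locally finite if $\mathsf{h}(X)$ is a finitely generated graded $R$-module for every $X$. Natural transformations between graded $R$-linear functors are required to respect this structure (components are degree-preserving and $R$-linear, and compatible with the identifications in (i)). For $X\in\mathsf{S}$ the functor $\operatorname{Ext}^*_{\mathsf{S}}(-,X)\colon\mathsf{S}^{op}\to\operatorname{grMod}(R)$ has the natural identification $\operatorname{Ext}^*_{\mathsf{S}}(\Sigma^nY,X)\cong\operatorname{Ext}^*_{\mathsf{S}}(Y,X)[-n]$ induced by $\Sigma^{-n}$.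 A functor is graded representable if it is naturally isomorphic to $\operatorname{Ext}^*_{\mathsf{S}}(-,X)$ for some $X\in\mathsf{S}$. Graded linear functors between triangulated categories. A functor $\mathsf{f}\colon\mathsf{S}\to\mathsf{T}$ between graded $R$-linear triangulated categories is graded $R$-linear if it is exact and the induced map $\operatorname{Ext}^*_{\mathsf{S}}(X,Y)\to\operatorname{Ext}^*_{\mathsf{T}}(\mathsf{f}(X),\mathsf{f}(Y))$ is a map of graded $R$-modules for all $X,Y\in\mathsf{S}$. *)

theory Defs
  imports "HOL-Algebra.Coset"
begin

text \<open>
  Conventions.  Additive groups (the Hom-groups of an additive category, the homogeneous parts of
  graded rings and modules) are commutative groups in the sense of \<^locale>\<open>comm_group\<close>; the library
  writes these multiplicatively, so \<open>\<otimes>\<close>, \<open>\<one>\<close> and \<open>inv\<close> stand for sum, zero and negative.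
  A graded object \<open>\<Coprod>\<^sub>d M\<^sub>d\<close> is given by the family of its homogeneous parts.
\<close>

section \<open>Categories\<close>

record ('o, 'm) category =
  Obj :: "'o set"
  Arr :: "'m set"
  Dom :: "'m \<Rightarrow> 'o"
  Cod :: "'m \<Rightarrow> 'o"
  Ident :: "'o \<Rightarrow> 'm"
  Comp :: "'m \<Rightarrow> 'm \<Rightarrow> 'm"  (infixl "\<cdot>\<index>" 70)

definition Hom :: "('o, 'm, 'x) category_scheme \<Rightarrow> 'o \<Rightarrow> 'o \<Rightarrow> 'm set" where
  "Hom C X Y = {f \<in> Arr C. Dom C f = X \<and> Cod C f = Y}"

locale category =
  fixes C :: "('o, 'm, 'x) category_scheme" (structure)
  assumes Dom_Obj: "f \<in> Arr C \<Longrightarrow> Dom C f \<in> Obj C"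
    and Cod_Obj: "f \<in> Arr C \<Longrightarrow> Cod C f \<in> Obj C"
    and Ident_Hom: "X \<in> Obj C \<Longrightarrow> Ident C X \<in> Hom C X X"
    and Comp_Hom: "\<lbrakk>f \<in> Hom C X Y; g \<in> Hom C Y Z\<rbrakk> \<Longrightarrow> g \<cdot> f \<in> Hom C X Z"
    and Ident_left: "f \<in> Hom C X Y \<Longrightarrow> Ident C Y \<cdot> f = f"
    and Ident_right: "f \<in> Hom C X Y \<Longrightarrow> f \<cdot> Ident C X = f"
    and Comp_assoc: "\<lbrakk>f \<in> Hom C W X; g \<in> Hom C X Y; k \<in> Hom C Y Z\<rbrakk> \<Longrightarrow> (k \<cdot> g) \<cdot> f = k \<cdot> (g \<cdot> f)"

definition opposite :: "('o, 'm, 'x) category_scheme \<Rightarrow> ('o, 'm) category" where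
  "opposite C = \<lparr>Obj = Obj C, Arr = Arr C, Dom = Cod C, Cod = Dom C, Ident = Ident C,
     Comp = (\<lambda>g f. f \<cdot>\<^bsub>C\<^esub> g)\<rparr>"

definition inverse_arrows :: "('o, 'm, 'x) category_scheme \<Rightarrow> 'm \<Rightarrow> 'm \<Rightarrow> bool" where
  "inverse_arrows C f g \<longleftrightarrow> f \<in> Arr C \<and> g \<in> Hom C (Cod C f) (Dom C f) \<and>
     g \<cdot>\<^bsub>C\<^esub> f = Ident C (Dom C f) \<and> f \<cdot>\<^bsub>C\<^esub> g = Ident C (Cod C f)"

definition isomorphism :: "('o, 'm, 'x) category_scheme \<Rightarrow> 'm \<Rightarrow> bool" where
  "isomorphism C f \<longleftrightarrow> (\<exists>g. inverse_arrows C f g)"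

definition inv_arr :: "('o, 'm, 'x) category_scheme \<Rightarrow> 'm \<Rightarrow> 'm" where
  "inv_arr C f = (THE g. inverse_arrows C f g)"

record ('a, 'm, 'b, 'n) cfunctor =
  on_obj :: "'a \<Rightarrow> 'b"
  on_arr :: "'m \<Rightarrow> 'n"

locale cfunctor = source: category C + target: category D
  for C :: "('a, 'm, 'x) category_scheme" and D :: "('b, 'n, 'y) category_scheme" +
  fixes F :: "('a, 'm, 'b, 'n) cfunctor"
  assumes on_obj: "X \<in> Obj C \<Longrightarrow> on_obj F X \<in> Obj D"
    and on_arr: "f \<in> Hom C X Y \<Longrightarrow> on_arr F f \<in> Hom D (on_obj F X) (on_obj F Y)"
    and on_Ident: "X \<in> Obj C \<Longrightarrow> on_arr F (Ident C X) = Ident D (on_obj F X)"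
    and on_Comp: "\<lbrakk>f \<in> Hom C X Y; g \<in> Hom C Y Z\<rbrakk> \<Longrightarrow>
      on_arr F (g \<cdot>\<^bsub>C\<^esub> f) = on_arr F g \<cdot>\<^bsub>D\<^esub> on_arr F f"

definition id_functor :: "('a, 'm, 'a, 'm) cfunctor" where
  "id_functor = \<lparr>on_obj = id, on_arr = id\<rparr>"

definition comp_functor ::
    "('b, 'n, 'c, 'p) cfunctor \<Rightarrow> ('a, 'm, 'b, 'n) cfunctor \<Rightarrow> ('a, 'm, 'c, 'p) cfunctor"
    (infixl "\<circ>\<^sub>F" 55) where
  "G \<circ>\<^sub>F F = \<lparr>on_obj = on_obj G \<circ> on_obj F, on_arr = on_arr G \<circ> on_arr F\<rparr>"

definition natural_transformation ::
    "('a, 'm, 'x) category_scheme \<Rightarrow> ('b, 'n, 'y) category_scheme \<Rightarrow>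
     ('a, 'm, 'b, 'n) cfunctor \<Rightarrow> ('a, 'm, 'b, 'n) cfunctor \<Rightarrow> ('a \<Rightarrow> 'n) \<Rightarrow> bool" where
  "natural_transformation C D F G \<eta> \<longleftrightarrow>
     (\<forall>X\<in>Obj C. \<eta> X \<in> Hom D (on_obj F X) (on_obj G X)) \<and>
     (\<forall>X\<in>Obj C. \<forall>Y\<in>Obj C. \<forall>f\<in>Hom C X Y. \<eta> Y \<cdot>\<^bsub>D\<^esub> on_arr F f = on_arr G f \<cdot>\<^bsub>D\<^esub> \<eta> X)"

definition natural_isomorphism ::
    "('a, 'm, 'x) category_scheme \<Rightarrow> ('b, 'n, 'y) category_scheme \<Rightarrow>
     ('a, 'm, 'b, 'n) cfunctor \<Rightarrow> ('a, 'm, 'b, 'n) cfunctor \<Rightarrow> ('a \<Rightarrow> 'n) \<Rightarrow> bool" where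
  "natural_isomorphism C D F G \<eta> \<longleftrightarrow>
     natural_transformation C D F G \<eta> \<and> (\<forall>X\<in>Obj C. isomorphism D (\<eta> X))"

definition adjunction ::
    "('a, 'm, 'x) category_scheme \<Rightarrow> ('b, 'n, 'y) category_scheme \<Rightarrow>
     ('a, 'm, 'b, 'n) cfunctor \<Rightarrow> ('b, 'n, 'a, 'm) cfunctor \<Rightarrow> ('a \<Rightarrow> 'b \<Rightarrow> 'n \<Rightarrow> 'm) \<Rightarrow> bool" where
  "adjunction C D F G \<Phi> \<longleftrightarrow> cfunctor C D F \<and> cfunctor D C G \<and>
     (\<forall>X\<in>Obj C. \<forall>Y\<in>Obj D. bij_betw (\<Phi> X Y) (Hom D (on_obj F X) Y) (Hom C X (on_obj G Y))) \<and>
     (\<forall>X\<in>Obj C. \<forall>X'\<in>Obj C. \<forall>Y\<in>Obj D. \<forall>Y'\<in>Obj D.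
        \<forall>a\<in>Hom C X' X. \<forall>k\<in>Hom D (on_obj F X) Y. \<forall>b\<in>Hom D Y Y'.
          \<Phi> X' Y' (b \<cdot>\<^bsub>D\<^esub> k \<cdot>\<^bsub>D\<^esub> on_arr F a) = on_arr G b \<cdot>\<^bsub>C\<^esub> \<Phi> X Y k \<cdot>\<^bsub>C\<^esub> a)"

definition has_right_adjoint ::
    "('a, 'm, 'x) category_scheme \<Rightarrow> ('b, 'n, 'y) category_scheme \<Rightarrow>
     ('a, 'm, 'b, 'n) cfunctor \<Rightarrow> bool" where
  "has_right_adjoint C D F \<longleftrightarrow> (\<exists>G \<Phi>. adjunction C D F G \<Phi>)"

section \<open>Triangulated categories\<close>

record ('o, 'm) preadditive = "('o, 'm) category" +
  Plus :: "'m \<Rightarrow> 'm \<Rightarrow> 'm"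
  Zero :: "'o \<Rightarrow> 'o \<Rightarrow> 'm"

definition Hom_group :: "('o, 'm, 'x) preadditive_scheme \<Rightarrow> 'o \<Rightarrow> 'o \<Rightarrow> 'm monoid" where
  "Hom_group A X Y = \<lparr>carrier = Hom A X Y, mult = Plus A, one = Zero A X Y\<rparr>"

definition neg :: "('o, 'm, 'x) preadditive_scheme \<Rightarrow> 'm \<Rightarrow> 'm" where
  "neg A f = inv\<^bsub>Hom_group A (Dom A f) (Cod A f)\<^esub> f"

locale preadditive = category A
  for A :: "('o, 'm, 'x) preadditive_scheme" (structure) +
  assumes Hom_comm_group: "\<lbrakk>X \<in> Obj A; Y \<in> Obj A\<rbrakk> \<Longrightarrow> comm_group (Hom_group A X Y)"
    and Comp_Plus_left: "\<lbrakk>f \<in> Hom A X Y; g \<in> Hom A Y Z; g' \<in> Hom A Y Z\<rbrakk> \<Longrightarrow>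
      Plus A g g' \<cdot> f = Plus A (g \<cdot> f) (g' \<cdot> f)"
    and Comp_Plus_right: "\<lbrakk>f \<in> Hom A X Y; f' \<in> Hom A X Y; g \<in> Hom A Y Z\<rbrakk> \<Longrightarrow>
      g \<cdot> Plus A f f' = Plus A (g \<cdot> f) (g \<cdot> f')"

definition zero_object :: "('o, 'm, 'x) category_scheme \<Rightarrow> 'o \<Rightarrow> bool" where
  "zero_object A Z \<longleftrightarrow> Z \<in> Obj A \<and>
     (\<forall>X\<in>Obj A. (\<exists>!f. f \<in> Hom A X Z) \<and> (\<exists>!f. f \<in> Hom A Z X))"

locale additive = preadditive A
  for A :: "('o, 'm, 'x) preadditive_scheme" (structure) +
  assumes ex_zero_object: "\<exists>Z. zero_object A Z"
    and ex_biproduct: "\<lbrakk>X \<in> Obj A; Y \<in> Obj A\<rbrakk> \<Longrightarrow>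
      \<exists>B\<in>Obj A. \<exists>i\<in>Hom A X B. \<exists>j\<in>Hom A Y B. \<exists>p\<in>Hom A B X. \<exists>q\<in>Hom A B Y.
        p \<cdot> i = Ident A X \<and> q \<cdot> j = Ident A Y \<and> p \<cdot> j = Zero A Y X \<and> q \<cdot> i = Zero A X Y \<and>
        Plus A (i \<cdot> p) (j \<cdot> q) = Ident A B"

definition additive_functor ::
    "('a, 'm, 'x) preadditive_scheme \<Rightarrow> ('b, 'n, 'y) preadditive_scheme \<Rightarrow>
     ('a, 'm, 'b, 'n) cfunctor \<Rightarrow> bool" where
  "additive_functor A B F \<longleftrightarrow> cfunctor A B F \<and>
     (\<forall>X\<in>Obj A. \<forall>Y\<in>Obj A. \<forall>f\<in>Hom A X Y. \<forall>g\<in>Hom A X Y.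
        on_arr F (Plus A f g) = Plus B (on_arr F f) (on_arr F g))"

text \<open>\<open>Tri\<close> is the set of exact triangles \<open>X \<rightarrow> Y \<rightarrow> Z \<rightarrow> \<Sigma>X\<close>, recorded as triples of arrows.\<close>

record ('o, 'm) triangulated = "('o, 'm) preadditive" +
  Susp :: "('o, 'm, 'o, 'm) cfunctor"
  Tri :: "('m \<times> 'm \<times> 'm) set"

definition candidate_triangle ::
    "('o, 'm, 'x) triangulated_scheme \<Rightarrow> 'm \<times> 'm \<times> 'm \<Rightarrow> bool" where
  "candidate_triangle T = (\<lambda>(u, v, w). u \<in> Arr T \<and> v \<in> Arr T \<and> w \<in> Arr T \<and>
     Dom T v = Cod T u \<and> Dom T w = Cod T v \<and> Cod T w = on_obj (Susp T) (Dom T u))"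

definition triangle_morphism ::
    "('o, 'm, 'x) triangulated_scheme \<Rightarrow> 'm \<times> 'm \<times> 'm \<Rightarrow> 'm \<times> 'm \<times> 'm \<Rightarrow> 'm \<times> 'm \<times> 'm \<Rightarrow> bool"
  where
  "triangle_morphism T = (\<lambda>(u, v, w) (u', v', w') (a, b, c).
     a \<in> Hom T (Dom T u) (Dom T u') \<and> b \<in> Hom T (Cod T u) (Cod T u') \<and>
     c \<in> Hom T (Cod T v) (Cod T v') \<and>
     b \<cdot>\<^bsub>T\<^esub> u = u' \<cdot>\<^bsub>T\<^esub> a \<and> c \<cdot>\<^bsub>T\<^esub> v = v' \<cdot>\<^bsub>T\<^esub> b \<and> on_arr (Susp T) a \<cdot>\<^bsub>T\<^esub> w = w' \<cdot>\<^bsub>T\<^esub> c)"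

text \<open>The suspension is an automorphism (not merely a self-equivalence), as is implicit in
  forming \<open>\<Sigma>\<^sup>d\<close> for negative \<open>d\<close> and in conditions such as \<open>\<eta>\<Sigma> = (-1)\<^sup>d\<Sigma>\<eta>\<close>.\<close>

locale triangulated = additive T
  for T :: "('o, 'm, 'x) triangulated_scheme" (structure) +
  assumes Susp_additive: "additive_functor T T (Susp T)"
    and Susp_bij_Obj: "bij_betw (on_obj (Susp T)) (Obj T) (Obj T)"
    and Susp_bij_Arr: "bij_betw (on_arr (Susp T)) (Arr T) (Arr T)"
    and Tri_candidate: "t \<in> Tri T \<Longrightarrow> candidate_triangle T t"
    and Tri_iso: "\<lbrakk>t \<in> Tri T; candidate_triangle T t'; triangle_morphism T t t' (a, b, c);
      isomorphism T a; isomorphism T b; isomorphism T c\<rbrakk> \<Longrightarrow> t' \<in> Tri T"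
    and Tri_Ident: "\<lbrakk>X \<in> Obj T; zero_object T Z\<rbrakk> \<Longrightarrow>
      (Ident T X, Zero T X Z, Zero T Z (on_obj (Susp T) X)) \<in> Tri T"
    and Tri_cone: "u \<in> Arr T \<Longrightarrow> \<exists>v w. (u, v, w) \<in> Tri T"
    and Tri_rotate: "candidate_triangle T (u, v, w) \<Longrightarrow>
      (u, v, w) \<in> Tri T \<longleftrightarrow> (v, w, neg T (on_arr (Susp T) u)) \<in> Tri T"
    and Tri_complete: "\<lbrakk>(u, v, w) \<in> Tri T; (u', v', w') \<in> Tri T;
      a \<in> Hom T (Dom T u) (Dom T u'); b \<in> Hom T (Cod T u) (Cod T u'); b \<cdot> u = u' \<cdot> a\<rbrakk> \<Longrightarrow>
      \<exists>c. triangle_morphism T (u, v, w) (u', v', w') (a, b, c)"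
    and Tri_octahedron: "\<lbrakk>u \<in> Hom T X Y; v \<in> Hom T Y Z;
      (u, a, a') \<in> Tri T; (v, b, b') \<in> Tri T; (v \<cdot> u, c, c') \<in> Tri T\<rbrakk> \<Longrightarrow>
      \<exists>s\<in>Hom T (Cod T a) (Cod T c). \<exists>t\<in>Hom T (Cod T c) (Cod T b).
        (s, t, on_arr (Susp T) a \<cdot> b') \<in> Tri T \<and>
        s \<cdot> a = c \<cdot> v \<and> c' \<cdot> s = a' \<and> t \<cdot> c = b \<and> b' \<cdot> t = on_arr (Susp T) u \<cdot> c'"

definition Susp_pow :: "('o, 'm, 'x) triangulated_scheme \<Rightarrow> int \<Rightarrow> ('o, 'm, 'o, 'm) cfunctor" where
  "Susp_pow T n = (if 0 \<le> n
     then \<lparr>on_obj = on_obj (Susp T) ^^ nat n, on_arr = on_arr (Susp T) ^^ nat n\<rparr>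
     else \<lparr>on_obj = inv_into (Obj T) (on_obj (Susp T)) ^^ nat (- n),
           on_arr = inv_into (Arr T) (on_arr (Susp T)) ^^ nat (- n)\<rparr>)"

text \<open>An exact functor carries a natural isomorphism \<open>\<theta> : F\<Sigma> \<cong> \<Sigma>F\<close> as part of its data.\<close>

definition exact_functor ::
    "('a, 'm, 'x) triangulated_scheme \<Rightarrow> ('b, 'n, 'y) triangulated_scheme \<Rightarrow>
     ('a, 'm, 'b, 'n) cfunctor \<Rightarrow> ('a \<Rightarrow> 'n) \<Rightarrow> bool" where
  "exact_functor S T F \<theta> \<longleftrightarrow> additive_functor S T F \<and>
     natural_isomorphism S T (F \<circ>\<^sub>F Susp S) (Susp T \<circ>\<^sub>F F) \<theta> \<and>
     (\<forall>u v w. (u, v, w) \<in> Tri S \<longrightarrow>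
        (on_arr F u, on_arr F v, \<theta> (Dom S u) \<cdot>\<^bsub>T\<^esub> on_arr F w) \<in> Tri T)"

text \<open>The isomorphisms \<open>F\<Sigma>\<^sup>d Y \<cong> \<Sigma>\<^sup>d F Y\<close> obtained by iterating \<open>\<theta>\<close>.\<close>

primrec iter_pos ::
    "('a, 'm, 'x) triangulated_scheme \<Rightarrow> ('b, 'n, 'y) triangulated_scheme \<Rightarrow>
     ('a, 'm, 'b, 'n) cfunctor \<Rightarrow> ('a \<Rightarrow> 'n) \<Rightarrow> nat \<Rightarrow> 'a \<Rightarrow> 'n" where
  "iter_pos S T F \<theta> 0 Y = Ident T (on_obj F Y)"
| "iter_pos S T F \<theta> (Suc n) Y =
     on_arr (Susp T) (iter_pos S T F \<theta> n Y) \<cdot>\<^bsub>T\<^esub> \<theta> (on_obj (Susp_pow S (int n)) Y)"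

primrec iter_neg ::
    "('a, 'm, 'x) triangulated_scheme \<Rightarrow> ('b, 'n, 'y) triangulated_scheme \<Rightarrow>
     ('a, 'm, 'b, 'n) cfunctor \<Rightarrow> ('a \<Rightarrow> 'n) \<Rightarrow> nat \<Rightarrow> 'a \<Rightarrow> 'n" where
  "iter_neg S T F \<theta> 0 Y = Ident T (on_obj F Y)"
| "iter_neg S T F \<theta> (Suc n) Y =
     on_arr (Susp_pow T (- 1))
       (iter_neg S T F \<theta> n Y \<cdot>\<^bsub>T\<^esub> inv_arr T (\<theta> (on_obj (Susp_pow S (- int (Suc n))) Y)))"

definition iter_susp_iso ::
    "('a, 'm, 'x) triangulated_scheme \<Rightarrow> ('b, 'n, 'y) triangulated_scheme \<Rightarrow>
     ('a, 'm, 'b, 'n) cfunctor \<Rightarrow> ('a \<Rightarrow> 'n) \<Rightarrow> int \<Rightarrow> 'a \<Rightarrow> 'n" where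
  "iter_susp_iso S T F \<theta> d =
     (if 0 \<le> d then iter_pos S T F \<theta> (nat d) else iter_neg S T F \<theta> (nat (- d)))"

section \<open>Graded rings and graded modules\<close>

text \<open>The element \<open>(-1)\<^sup>n x\<close>.\<close>

definition signed :: "'v monoid \<Rightarrow> int \<Rightarrow> 'v \<Rightarrow> 'v" where
  "signed G n x = (if even n then x else inv\<^bsub>G\<^esub> x)"

text \<open>\<open>Rmult R d e\<close> is the multiplication \<open>R\<^sub>d \<times> R\<^sub>e \<rightarrow> R\<^sub>d\<^sub>+\<^sub>e\<close>, and \<open>Mact M d e\<close> below is the action
  \<open>R\<^sub>d \<times> M\<^sub>e \<rightarrow> M\<^sub>d\<^sub>+\<^sub>e\<close>.\<close>

record 'r gring =
  Rdeg :: "int \<Rightarrow> 'r monoid"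
  Rmult :: "int \<Rightarrow> int \<Rightarrow> 'r \<Rightarrow> 'r \<Rightarrow> 'r"
  Rone :: 'r

locale graded_ring =
  fixes R :: "'r gring"
  assumes Rdeg_comm_group: "comm_group (Rdeg R d)"
    and Rmult_closed: "\<lbrakk>r \<in> carrier (Rdeg R d); s \<in> carrier (Rdeg R e)\<rbrakk> \<Longrightarrow>
      Rmult R d e r s \<in> carrier (Rdeg R (d + e))"
    and Rone_closed: "Rone R \<in> carrier (Rdeg R 0)"
    and Rmult_add_left:
      "\<lbrakk>r \<in> carrier (Rdeg R d); r' \<in> carrier (Rdeg R d); s \<in> carrier (Rdeg R e)\<rbrakk> \<Longrightarrow>
      Rmult R d e (r \<otimes>\<^bsub>Rdeg R d\<^esub> r') s = Rmult R d e r s \<otimes>\<^bsub>Rdeg R (d + e)\<^esub> Rmult R d e r' s"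
    and Rmult_add_right:
      "\<lbrakk>r \<in> carrier (Rdeg R d); s \<in> carrier (Rdeg R e); s' \<in> carrier (Rdeg R e)\<rbrakk> \<Longrightarrow>
      Rmult R d e r (s \<otimes>\<^bsub>Rdeg R e\<^esub> s') = Rmult R d e r s \<otimes>\<^bsub>Rdeg R (d + e)\<^esub> Rmult R d e r s'"
    and Rmult_assoc:
      "\<lbrakk>r \<in> carrier (Rdeg R d); s \<in> carrier (Rdeg R e); t \<in> carrier (Rdeg R k)\<rbrakk> \<Longrightarrow>
      Rmult R (d + e) k (Rmult R d e r s) t = Rmult R d (e + k) r (Rmult R e k s t)"
    and Rone_left: "r \<in> carrier (Rdeg R d) \<Longrightarrow> Rmult R 0 d (Rone R) r = r"
    and Rone_right: "r \<in> carrier (Rdeg R d) \<Longrightarrow> Rmult R d 0 r (Rone R) = r"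

locale graded_commutative_ring = graded_ring R for R :: "'r gring" +
  assumes graded_commutative: "\<lbrakk>r \<in> carrier (Rdeg R d); s \<in> carrier (Rdeg R e)\<rbrakk> \<Longrightarrow>
      Rmult R d e r s = signed (Rdeg R (d + e)) (d * e) (Rmult R e d s r)"

definition graded_ring_hom :: "'r gring \<Rightarrow> 's gring \<Rightarrow> (int \<Rightarrow> 'r \<Rightarrow> 's) \<Rightarrow> bool" where
  "graded_ring_hom R S \<phi> \<longleftrightarrow> (\<forall>d. \<phi> d \<in> hom (Rdeg R d) (Rdeg S d)) \<and> \<phi> 0 (Rone R) = Rone S \<and>
     (\<forall>d e. \<forall>r\<in>carrier (Rdeg R d). \<forall>s\<in>carrier (Rdeg R e).
        \<phi> (d + e) (Rmult R d e r s) = Rmult S d e (\<phi> d r) (\<phi> e s))"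

record ('r, 'v) gmodule =
  Mdeg :: "int \<Rightarrow> 'v monoid"
  Mact :: "int \<Rightarrow> int \<Rightarrow> 'r \<Rightarrow> 'v \<Rightarrow> 'v"

locale graded_module = graded_ring R for R :: "'r gring" +
  fixes M :: "('r, 'v) gmodule"
  assumes Mdeg_comm_group: "comm_group (Mdeg M d)"
    and Mact_closed: "\<lbrakk>r \<in> carrier (Rdeg R d); m \<in> carrier (Mdeg M e)\<rbrakk> \<Longrightarrow>
      Mact M d e r m \<in> carrier (Mdeg M (d + e))"
    and Mact_add_left:
      "\<lbrakk>r \<in> carrier (Rdeg R d); r' \<in> carrier (Rdeg R d); m \<in> carrier (Mdeg M e)\<rbrakk> \<Longrightarrow>
      Mact M d e (r \<otimes>\<^bsub>Rdeg R d\<^esub> r') m = Mact M d e r m \<otimes>\<^bsub>Mdeg M (d + e)\<^esub> Mact M d e r' m"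
    and Mact_add_right:
      "\<lbrakk>r \<in> carrier (Rdeg R d); m \<in> carrier (Mdeg M e); m' \<in> carrier (Mdeg M e)\<rbrakk> \<Longrightarrow>
      Mact M d e r (m \<otimes>\<^bsub>Mdeg M e\<^esub> m') = Mact M d e r m \<otimes>\<^bsub>Mdeg M (d + e)\<^esub> Mact M d e r m'"
    and Mact_assoc:
      "\<lbrakk>r \<in> carrier (Rdeg R d); s \<in> carrier (Rdeg R e); m \<in> carrier (Mdeg M k)\<rbrakk> \<Longrightarrow>
      Mact M (d + e) k (Rmult R d e r s) m = Mact M d (e + k) r (Mact M e k s m)"
    and Mact_one: "m \<in> carrier (Mdeg M d) \<Longrightarrow> Mact M 0 d (Rone R) m = m"

definition graded_module_hom ::
    "'r gring \<Rightarrow> ('r, 'v) gmodule \<Rightarrow> ('r, 'w) gmodule \<Rightarrow> (int \<Rightarrow> 'v \<Rightarrow> 'w) \<Rightarrow> bool" where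
  "graded_module_hom R M N \<alpha> \<longleftrightarrow> (\<forall>d. \<alpha> d \<in> hom (Mdeg M d) (Mdeg N d)) \<and>
     (\<forall>d e. \<forall>r\<in>carrier (Rdeg R d). \<forall>m\<in>carrier (Mdeg M e).
        \<alpha> (d + e) (Mact M d e r m) = Mact N d e r (\<alpha> e m))"

definition graded_submodule ::
    "'r gring \<Rightarrow> ('r, 'v) gmodule \<Rightarrow> (int \<Rightarrow> 'v set) \<Rightarrow> bool" where
  "graded_submodule R M N \<longleftrightarrow> (\<forall>d. subgroup (N d) (Mdeg M d)) \<and>
     (\<forall>d e. \<forall>r\<in>carrier (Rdeg R d). \<forall>m\<in>N e. Mact M d e r m \<in> N (d + e))"

text \<open>Some finite set of homogeneous elements is contained in no proper graded submodule.\<close>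

definition finitely_generated :: "'r gring \<Rightarrow> ('r, 'v) gmodule \<Rightarrow> bool" where
  "finitely_generated R M \<longleftrightarrow>
     (\<exists>A. finite A \<and> A \<subseteq> (SIGMA d:UNIV. carrier (Mdeg M d)) \<and>
        (\<forall>N. graded_submodule R M N \<and> (\<forall>(d, m)\<in>A. m \<in> N d) \<longrightarrow>
          (\<forall>d. N d = carrier (Mdeg M d))))"

text \<open>\<open>M[n]\<close>, with the Koszul sign in the action.\<close>

definition shift :: "int \<Rightarrow> ('r, 'v) gmodule \<Rightarrow> ('r, 'v) gmodule" where
  "shift n M = \<lparr>Mdeg = (\<lambda>d. Mdeg M (n + d)),
     Mact = (\<lambda>d e r m. signed (Mdeg M (n + (d + e))) (n * d) (Mact M d (n + e) r m))\<rparr>"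

text \<open>An arrow of \<open>grMod(R)\<close> is a triple (source, family of maps, target); the maps are taken
  extensional so that equality of arrows is equality of maps.  The type \<open>'v\<close> is the universe in
  which the elements of the modules live; it is identified with the type of arrows of the categories
  under consideration, so that their graded Ext-modules are objects of \<open>grMod(R)\<close>.\<close>

type_synonym ('r, 'v) garrow = "('r, 'v) gmodule \<times> (int \<Rightarrow> 'v \<Rightarrow> 'v) \<times> ('r, 'v) gmodule"

definition maps :: "('r, 'v) garrow \<Rightarrow> int \<Rightarrow> 'v \<Rightarrow> 'v" where
  "maps f = fst (snd f)"

definition grMod :: "'r gring \<Rightarrow> (('r, 'v) gmodule, ('r, 'v) garrow) category" where
  "grMod R = \<lparr>
     Obj = {M. graded_module R M},
     Arr = {(M, \<alpha>, N). graded_module R M \<and> graded_module R N \<and> graded_module_hom R M N \<alpha> \<and>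
              (\<forall>d. \<alpha> d \<in> extensional (carrier (Mdeg M d)))},
     Dom = fst,
     Cod = snd \<circ> snd,
     Ident = (\<lambda>M. (M, \<lambda>d. \<lambda>m\<in>carrier (Mdeg M d). m, M)),
     Comp = (\<lambda>(M', \<beta>, N) (L, \<alpha>, M). (L, \<lambda>d. compose (carrier (Mdeg L d)) (\<beta> d) (\<alpha> d), N))\<rparr>"

definition shift_functor ::
    "int \<Rightarrow> (('r, 'v) gmodule, ('r, 'v) garrow, ('r, 'v) gmodule, ('r, 'v) garrow) cfunctor" where
  "shift_functor n =
     \<lparr>on_obj = shift n, on_arr = (\<lambda>(M, \<alpha>, N). (shift n M, \<lambda>d. \<alpha> (n + d), shift n N))\<rparr>"

text \<open>The graded module \<open>\<Coprod>\<^sub>d Hom(M, N[d])\<close> with \<open>(r\<alpha>)(m) = r \<alpha>(m)\<close>.  The action used on the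
  right is the one of \<open>N\<close>, not of \<open>N[d]\<close>: elements are regarded as maps \<open>M \<rightarrow> N\<close> of degree \<open>d\<close>.\<close>

definition graded_Hom ::
    "'r gring \<Rightarrow> ('r, 'v) gmodule \<Rightarrow> ('r, 'v) gmodule \<Rightarrow> ('r, int \<Rightarrow> 'v \<Rightarrow> 'v) gmodule" where
  "graded_Hom R M N = \<lparr>
     Mdeg = (\<lambda>d. \<lparr>carrier = {\<alpha>. (M, \<alpha>, shift d N) \<in> Arr (grMod R)},
        mult = (\<lambda>\<alpha> \<beta> k. \<lambda>m\<in>carrier (Mdeg M k). \<alpha> k m \<otimes>\<^bsub>Mdeg N (d + k)\<^esub> \<beta> k m),
        one = (\<lambda>k. \<lambda>m\<in>carrier (Mdeg M k). \<one>\<^bsub>Mdeg N (d + k)\<^esub>)\<rparr>),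
     Mact = (\<lambda>e d r \<alpha> k. \<lambda>m\<in>carrier (Mdeg M k). Mact N e (d + k) r (\<alpha> k m))\<rparr>"

definition exact_at :: "('r, 'v) garrow \<Rightarrow> ('r, 'v) garrow \<Rightarrow> bool" where
  "exact_at f g \<longleftrightarrow> (case (f, g) of ((L, \<alpha>, M), (M', \<beta>, N)) \<Rightarrow> M = M' \<and>
     (\<forall>d. \<alpha> d ` carrier (Mdeg L d) = kernel (Mdeg M d) (Mdeg N d) (\<beta> d)))"

section \<open>Graded linear triangulated categories\<close>

text \<open>The graded center, with product \<open>\<eta>\<zeta> = \<eta>\<Sigma>\<^sup>e \<circ> \<zeta>\<close> for \<open>\<zeta>\<close> of degree \<open>e\<close>.\<close>

definition graded_center :: "('o, 'm, 'x) triangulated_scheme \<Rightarrow> ('o \<Rightarrow> 'm) gring" where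
  "graded_center T = \<lparr>
     Rdeg = (\<lambda>d. \<lparr>
       carrier = {\<eta> \<in> extensional (Obj T).
         natural_transformation T T id_functor (Susp_pow T d) \<eta> \<and>
         (\<forall>X\<in>Obj T. \<eta> (on_obj (Susp T) X) =
            signed (Hom_group T (on_obj (Susp T) X) (on_obj (Susp_pow T d) (on_obj (Susp T) X))) d
              (on_arr (Susp T) (\<eta> X)))},
       mult = (\<lambda>\<eta> \<zeta>. \<lambda>X\<in>Obj T. Plus T (\<eta> X) (\<zeta> X)),
       one = (\<lambda>X\<in>Obj T. Zero T X (on_obj (Susp_pow T d) X))\<rparr>),
     Rmult = (\<lambda>d e \<eta> \<zeta>. \<lambda>X\<in>Obj T. \<eta> (on_obj (Susp_pow T e) X) \<cdot>\<^bsub>T\<^esub> \<zeta> X),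
     Rone = (\<lambda>X\<in>Obj T. Ident T X)\<rparr>"

locale graded_linear_category = graded_commutative_ring R + triangulated T
  for R :: "'r gring" and T :: "('o, 'm, 'x) triangulated_scheme" +
  fixes \<phi> :: "int \<Rightarrow> 'r \<Rightarrow> 'o \<Rightarrow> 'm"
  assumes structure_hom: "graded_ring_hom R (graded_center T) \<phi>"

definition Ext ::
    "('o, 'm, 'x) triangulated_scheme \<Rightarrow> (int \<Rightarrow> 'r \<Rightarrow> 'o \<Rightarrow> 'm) \<Rightarrow> 'o \<Rightarrow> 'o \<Rightarrow> ('r, 'm) gmodule" where
  "Ext T \<phi> X Y = \<lparr>Mdeg = (\<lambda>d. Hom_group T X (on_obj (Susp_pow T d) Y)),
     Mact = (\<lambda>d e r f. \<phi> d r (on_obj (Susp_pow T e) Y) \<cdot>\<^bsub>T\<^esub> f)\<rparr>"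

definition Ext_finite ::
    "'r gring \<Rightarrow> ('o, 'm, 'x) triangulated_scheme \<Rightarrow> (int \<Rightarrow> 'r \<Rightarrow> 'o \<Rightarrow> 'm) \<Rightarrow> bool" where
  "Ext_finite R T \<phi> \<longleftrightarrow> (\<forall>X\<in>Obj T. \<forall>Y\<in>Obj T. finitely_generated R (Ext T \<phi> X Y))"

section \<open>Graded linear functors to graded modules\<close>

type_synonym ('o, 'm, 'r, 'v) mod_functor = "('o, 'm, ('r, 'v) gmodule, ('r, 'v) garrow) cfunctor"

text \<open>A graded linear functor is a functor \<open>h\<close> together with the identifications
  \<open>\<iota> n X : h(\<Sigma>\<^sup>nX) \<cong> h(X)[-n]\<close>.  Since these play the role of equalities, the ones for
  \<open>h(\<Sigma>\<^sup>a\<Sigma>\<^sup>bX) = h(\<Sigma>\<^sup>bX)[-a] = h(X)[-a-b]\<close> have to agree.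
  The last clause regards \<open>h(u) : h(Y)[-d] \<cong> h(\<Sigma>\<^sup>dY) \<rightarrow> h(X)\<close> as a map \<open>h(Y) \<rightarrow> h(X)\<close> of degree \<open>d\<close>,
  with component \<open>h(Y)\<^sub>k = (h(Y)[-d])\<^sub>d\<^sub>+\<^sub>k \<rightarrow> h(X)\<^sub>d\<^sub>+\<^sub>k\<close> in degree \<open>k\<close>.\<close>

definition graded_linear_mod_functor ::
    "'r gring \<Rightarrow> ('o, 'm, 'x) triangulated_scheme \<Rightarrow> (int \<Rightarrow> 'r \<Rightarrow> 'o \<Rightarrow> 'm) \<Rightarrow>
     ('o, 'm, 'r, 'v) mod_functor \<Rightarrow> (int \<Rightarrow> 'o \<Rightarrow> ('r, 'v) garrow) \<Rightarrow> bool" where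
  "graded_linear_mod_functor R S \<phi> h \<iota> \<longleftrightarrow>
     cfunctor (opposite S) (grMod R) h \<and>
     (\<forall>n. natural_isomorphism (opposite S) (grMod R)
        (h \<circ>\<^sub>F Susp_pow S n) (shift_functor (- n) \<circ>\<^sub>F h) (\<iota> n)) \<and>
     (\<forall>a b. \<forall>X\<in>Obj S. \<forall>d. \<forall>m\<in>carrier (Mdeg (on_obj h (on_obj (Susp_pow S (a + b)) X)) d).
        maps (\<iota> (a + b) X) d m =
        maps (\<iota> b X) (- a + d) (maps (\<iota> a (on_obj (Susp_pow S b) X)) d m)) \<and>
     (\<forall>X\<in>Obj S. \<forall>Y\<in>Obj S.
        graded_module_hom R (Ext S \<phi> X Y) (graded_Hom R (on_obj h Y) (on_obj h X))
          (\<lambda>d u k. maps (on_arr h u \<cdot>\<^bsub>grMod R\<^esub> inv_arr (grMod R) (\<iota> d Y)) (d + k)))"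

text \<open>An exact triangle \<open>X \<rightarrow> Y \<rightarrow> Z \<rightarrow> \<Sigma>X\<close> yields
  \<open>\<dots> \<rightarrow> h(\<Sigma>\<^sup>n\<^sup>+\<^sup>1Y) \<rightarrow> h(\<Sigma>\<^sup>n\<^sup>+\<^sup>1X) \<rightarrow> h(\<Sigma>\<^sup>nZ) \<rightarrow> h(\<Sigma>\<^sup>nY) \<rightarrow> h(\<Sigma>\<^sup>nX) \<rightarrow> \<dots>\<close> for \<open>n \<in> \<int>\<close>.\<close>

definition cohomological ::
    "('o, 'm, 'x) triangulated_scheme \<Rightarrow> ('o, 'm, 'r, 'v) mod_functor \<Rightarrow> bool" where
  "cohomological S h \<longleftrightarrow> (\<forall>u v w. (u, v, w) \<in> Tri S \<longrightarrow> (\<forall>n.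
     let hS = (\<lambda>n f. on_arr h (on_arr (Susp_pow S n) f)) in
       exact_at (hS (n + 1) u) (hS n w) \<and> exact_at (hS n w) (hS n v) \<and> exact_at (hS n v) (hS n u)))"

definition locally_finite ::
    "'r gring \<Rightarrow> ('o, 'm, 'x) triangulated_scheme \<Rightarrow> ('o, 'm, 'r, 'v) mod_functor \<Rightarrow> bool" where
  "locally_finite R S h \<longleftrightarrow> (\<forall>X\<in>Obj S. finitely_generated R (on_obj h X))"

text \<open>The functor \<open>Ext(-, X)\<close> and its identifications \<open>Ext(\<Sigma>\<^sup>nY, X) \<cong> Ext(Y, X)[-n]\<close> induced by
  \<open>\<Sigma>\<^sup>-\<^sup>n\<close>.\<close>

definition Ext_functor ::
    "('o, 'm, 'x) triangulated_scheme \<Rightarrow> (int \<Rightarrow> 'r \<Rightarrow> 'o \<Rightarrow> 'm) \<Rightarrow> 'o \<Rightarrow> ('o, 'm, 'r, 'm) mod_functor" where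
  "Ext_functor S \<phi> X = \<lparr>
     on_obj = (\<lambda>Y. Ext S \<phi> Y X),
     on_arr = (\<lambda>f. (Ext S \<phi> (Cod S f) X,
       \<lambda>d. \<lambda>g\<in>Hom S (Cod S f) (on_obj (Susp_pow S d) X). g \<cdot>\<^bsub>S\<^esub> f,
       Ext S \<phi> (Dom S f) X))\<rparr>"

definition Ext_shift ::
    "('o, 'm, 'x) triangulated_scheme \<Rightarrow> (int \<Rightarrow> 'r \<Rightarrow> 'o \<Rightarrow> 'm) \<Rightarrow> 'o \<Rightarrow> int \<Rightarrow> 'o \<Rightarrow> ('r, 'm) garrow" where
  "Ext_shift S \<phi> X n Y = (Ext S \<phi> (on_obj (Susp_pow S n) Y) X,
     \<lambda>d. \<lambda>g\<in>Hom S (on_obj (Susp_pow S n) Y) (on_obj (Susp_pow S d) X). on_arr (Susp_pow S (- n)) g,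
     shift (- n) (Ext S \<phi> Y X))"

definition graded_representable ::
    "'r gring \<Rightarrow> ('o, 'm, 'x) triangulated_scheme \<Rightarrow> (int \<Rightarrow> 'r \<Rightarrow> 'o \<Rightarrow> 'm) \<Rightarrow>
     ('o, 'm, 'r, 'm) mod_functor \<Rightarrow> (int \<Rightarrow> 'o \<Rightarrow> ('r, 'm) garrow) \<Rightarrow> bool" where
  "graded_representable R S \<phi> h \<iota> \<longleftrightarrow> (\<exists>X\<in>Obj S. \<exists>\<psi>.
     natural_isomorphism (opposite S) (grMod R) h (Ext_functor S \<phi> X) \<psi> \<and>
     (\<forall>n. \<forall>Y\<in>Obj S. Ext_shift S \<phi> X n Y \<cdot>\<^bsub>grMod R\<^esub> \<psi> (on_obj (Susp_pow S n) Y) =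
        on_arr (shift_functor (- n)) (\<psi> Y) \<cdot>\<^bsub>grMod R\<^esub> \<iota> n Y))"

section \<open>Graded linear functors between triangulated categories\<close>

definition graded_linear_functor ::
    "'r gring \<Rightarrow> ('a, 'm, 'x) triangulated_scheme \<Rightarrow> (int \<Rightarrow> 'r \<Rightarrow> 'a \<Rightarrow> 'm) \<Rightarrow>
     ('b, 'n, 'y) triangulated_scheme \<Rightarrow> (int \<Rightarrow> 'r \<Rightarrow> 'b \<Rightarrow> 'n) \<Rightarrow>
     ('a, 'm, 'b, 'n) cfunctor \<Rightarrow> ('a \<Rightarrow> 'n) \<Rightarrow> bool" where
  "graded_linear_functor R S \<phi>\<^sub>S T \<phi>\<^sub>T F \<theta> \<longleftrightarrow> exact_functor S T F \<theta> \<and>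
     (\<forall>X\<in>Obj S. \<forall>Y\<in>Obj S.
        graded_module_hom R (Ext S \<phi>\<^sub>S X Y) (Ext T \<phi>\<^sub>T (on_obj F X) (on_obj F Y))
          (\<lambda>d u. iter_susp_iso S T F \<theta> d Y \<cdot>\<^bsub>T\<^esub> on_arr F u))"

end

theory Submission
  imports Defs
begin

text \<open>
  For an object \<open>Y\<close> of \<open>T\<close> the functor \<open>Ext(F(-), Y)\<close> is locally finite by Ext-finiteness.  It is
  cohomological and graded linear because \<open>Ext(-, Y)\<close> is and because these properties survive
  restriction along \<open>F\<close>, the identifications being twisted by the isomorphisms \<open>F\<Sigma>\<^sup>n \<cong> \<Sigma>\<^sup>nF\<close>.  Hence it is
  represented by some \<open>G Y\<close>, and the degree \<open>0\<close> part of the representation is a bijection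
  \<open>Hom(F X, Y) \<cong> Hom(X, G Y)\<close> natural in \<open>X\<close>, which by the Yoneda lemma determines a right adjoint.
\<close>

section \<open>Categories and functors\<close>

text \<open>What has to be controlled is identifications and signs. \<Sigma> is a strict
  automorphism on both sides, but F commutes with it only up to \<theta>. Write \<Theta>_n for the
  iterate F \<Sigma>^n -> \<Sigma>^n F. The identification of h(F \<Sigma>^n X) with h(F X)[-n] is h
  of the inverse of \<Theta>_n, followed by the identification belonging to h. Its coherence rests
  on three facts: naturality of \<Theta>_n, the cocycle rule \<Theta>_{a+b} = \<Sigma>^a \<Theta>_b
  . \<Theta>_a \<Sigma>^b, and the linearity of F, which is itself stated through \<Theta>_d. Since
  n runs over all integers, laws of powers are proved by showing the cases n and n + 1 equivalent,
  which works because \<Sigma> is injective. Signs enter twice. The condition \<eta>\<Sigma> =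
  (-1)^d \<Sigma>\<eta> iterates to the sign (-1)^{nd}, which is the Koszul sign of a shift.
  Rotating a triangle produces -\<Sigma>u where exactness is asked for \<Sigma>u; the sign does not
  affect exactness.\<close>

lemma Hom_opposite [simp]: "Hom (opposite C) X Y = Hom C Y X"
  by (auto simp: Hom_def opposite_def)

lemma opposite_simps [simp]:
  "Obj (opposite C) = Obj C" "Arr (opposite C) = Arr C" "Dom (opposite C) = Cod C"
  "Cod (opposite C) = Dom C" "Ident (opposite C) = Ident C" "g \<cdot>\<^bsub>opposite C\<^esub> f = f \<cdot>\<^bsub>C\<^esub> g"
  by (simp_all add: opposite_def)

context category
begin

lemma HomD:
  assumes "f \<in> Hom C X Y"
  shows "f \<in> Arr C" "Dom C f = X" "Cod C f = Y" "X \<in> Obj C" "Y \<in> Obj C"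
  using assms Dom_Obj Cod_Obj by (auto simp: Hom_def)

lemma Arr_Hom: "f \<in> Arr C \<Longrightarrow> f \<in> Hom C (Dom C f) (Cod C f)"
  by (simp add: Hom_def)

lemma category_opposite: "category (opposite C)"
  by unfold_locales
    (auto simp: Dom_Obj Cod_Obj Ident_Hom Comp_Hom Ident_left Ident_right Comp_assoc)

lemma inverse_arrowsI:
  assumes "f \<in> Hom C X Y" "g \<in> Hom C Y X" "g \<cdot> f = Ident C X" "f \<cdot> g = Ident C Y"
  shows "inverse_arrows C f g"
  using assms by (auto simp: inverse_arrows_def Hom_def)

lemma inverse_arrowsD:
  assumes "inverse_arrows C f g" "f \<in> Hom C X Y"
  shows "g \<in> Hom C Y X" "g \<cdot> f = Ident C X" "f \<cdot> g = Ident C Y"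
  using assms by (auto simp: inverse_arrows_def Hom_def)

text \<open>Inverses are unique, since g' = g' f g = g. This makes the definite description in
  \<open>inv_arr\<close> computable from any known inverse.\<close>

lemma inv_arr_eq:
  assumes "inverse_arrows C f g"
  shows "inv_arr C f = g"
  unfolding inv_arr_def
proof (rule the_equality)
  fix g' assume g': "inverse_arrows C f g'"
  have f: "f \<in> Hom C (Dom C f) (Cod C f)"
    using assms by (simp add: inverse_arrows_def Hom_def)
  note a = inverse_arrowsD[OF assms f] and b = inverse_arrowsD[OF g' f]
  have "g' = g' \<cdot> (f \<cdot> g)"
    using a b Ident_right[OF b(1)] by simp
  also have "\<dots> = g"
    using Comp_assoc[OF a(1) f b(1)] a b Ident_left[OF a(1)] by simp
  finally show "g' = g" .
qed (rule assms)

lemma isomorphism_inv_arr: "isomorphism C f \<Longrightarrow> inverse_arrows C f (inv_arr C f)"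
  using inv_arr_eq by (auto simp: isomorphism_def)

lemma inv_arrD:
  assumes "isomorphism C f" "f \<in> Hom C X Y"
  shows "inv_arr C f \<in> Hom C Y X" "inv_arr C f \<cdot> f = Ident C X" "f \<cdot> inv_arr C f = Ident C Y"
  using inverse_arrowsD[OF isomorphism_inv_arr] assms by auto

lemma inverse_arrows_sym:
  assumes "inverse_arrows C f g"
  shows "inverse_arrows C g f"
proof -
  have f: "f \<in> Hom C (Dom C f) (Cod C f)"
    using assms by (simp add: inverse_arrows_def Hom_def)
  show ?thesis
    using inverse_arrowsD[OF assms f] f by (auto intro: inverse_arrowsI)
qed

lemma inverse_arrows_Comp:
  assumes "f \<in> Hom C X Y" "g \<in> Hom C Y Z" "inverse_arrows C f f'" "inverse_arrows C g g'"
  shows "inverse_arrows C (g \<cdot> f) (f' \<cdot> g')"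
proof -
  note f' = inverse_arrowsD[OF assms(3,1)] and g' = inverse_arrowsD[OF assms(4,2)]
  have "(f' \<cdot> g') \<cdot> (g \<cdot> f) = f' \<cdot> ((g' \<cdot> g) \<cdot> f)"
    using Comp_assoc[OF Comp_Hom[OF assms(1,2)] g'(1) f'(1)] Comp_assoc[OF assms(1,2) g'(1)] by simp
  moreover have "(g \<cdot> f) \<cdot> (f' \<cdot> g') = g \<cdot> ((f \<cdot> f') \<cdot> g')"
    using Comp_assoc[OF Comp_Hom[OF g'(1) f'(1)] assms(1,2)] Comp_assoc[OF g'(1) f'(1) assms(1)]
    by simp
  ultimately show ?thesis
    using assms(1,2) f' g'
    by (intro inverse_arrowsI[of _ X Z]) (auto simp: Ident_left intro: Comp_Hom)
qed

lemma isomorphism_Comp: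
  assumes "f \<in> Hom C X Y" "g \<in> Hom C Y Z" "isomorphism C f" "isomorphism C g"
  shows "isomorphism C (g \<cdot> f)"
  using inverse_arrows_Comp[OF assms(1,2)] assms(3,4) by (auto simp: isomorphism_def)

lemma isomorphism_Ident: "X \<in> Obj C \<Longrightarrow> isomorphism C (Ident C X)"
  unfolding isomorphism_def
  by (rule exI, rule inverse_arrowsI[of _ X X]) (auto intro: Ident_Hom Ident_left[OF Ident_Hom])

lemma isomorphism_inverse: "isomorphism C f \<Longrightarrow> isomorphism C (inv_arr C f)"
  using isomorphism_inv_arr inverse_arrows_sym unfolding isomorphism_def by blast

lemma isomorphism_cancel_right:
  assumes "isomorphism C f" "f \<in> Hom C X Y" "g \<in> Hom C Y Z" "g' \<in> Hom C Y Z" "g \<cdot> f = g' \<cdot> f"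
  shows "g = g'"
proof -
  note i = inv_arrD[OF assms(1,2)]
  have "k = (k \<cdot> f) \<cdot> inv_arr C f" if "k \<in> Hom C Y Z" for k
    using Comp_assoc[OF i(1) assms(2) that] i Ident_right[OF that] by simp
  from this[OF assms(3)] this[OF assms(4)] show ?thesis
    using assms(5) by simp
qed

end

context cfunctor
begin

lemma on_inverse_arrows:
  assumes "inverse_arrows C f g"
  shows "inverse_arrows D (on_arr F f) (on_arr F g)"
proof -
  have f: "f \<in> Hom C (Dom C f) (Cod C f)"
    using assms by (simp add: inverse_arrows_def Hom_def)
  note g = source.inverse_arrowsD[OF assms f]
  show ?thesis
    using g f on_Comp[OF f g(1)] on_Comp[OF g(1) f] source.HomD[OF f]
    by (intro target.inverse_arrowsI[OF on_arr[OF f] on_arr[OF g(1)]]) (simp_all add: on_Ident)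
qed

lemma on_isomorphism: "isomorphism C f \<Longrightarrow> isomorphism D (on_arr F f)"
  using on_inverse_arrows by (auto simp: isomorphism_def)

lemma on_inv_arr: "isomorphism C f \<Longrightarrow> on_arr F (inv_arr C f) = inv_arr D (on_arr F f)"
  using on_inverse_arrows source.isomorphism_inv_arr target.inv_arr_eq by metis

lemma cfunctor_opposite: "cfunctor (opposite C) (opposite D) F"
  by (intro cfunctor.intro source.category_opposite target.category_opposite cfunctor_axioms.intro)
    (auto simp: on_obj on_arr on_Ident on_Comp)

end

lemma comp_functor_simps [simp]:
  "on_obj (G \<circ>\<^sub>F F) X = on_obj G (on_obj F X)" "on_arr (G \<circ>\<^sub>F F) f = on_arr G (on_arr F f)"
  by (simp_all add: comp_functor_def)

lemma cfunctor_comp: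
  assumes "cfunctor C D F" "cfunctor D E G"
  shows "cfunctor C E (G \<circ>\<^sub>F F)"
proof -
  interpret F: cfunctor C D F by fact
  interpret G: cfunctor D E G by fact
  show ?thesis
    by unfold_locales
      (auto simp: F.on_obj G.on_obj F.on_Ident G.on_Ident F.on_Comp G.on_Comp[OF F.on_arr F.on_arr]
        intro: F.on_arr G.on_arr)
qed

lemma isomorphism_opposite [simp]: "isomorphism (opposite C) = isomorphism C"
  by (auto simp: fun_eq_iff isomorphism_def inverse_arrows_def)

text \<open>The value of the right adjoint on an arrow is forced by naturality in the second variable: with
  the counit \<open>\<epsilon> Y\<close>, corresponding to the identity of \<open>G Y\<close>, it corresponds to \<open>b \<cdot> \<epsilon> Y\<close>.\<close>

lemma has_right_adjoint_if_representable:
  assumes "cfunctor C D F"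
    and repr: "\<And>Y. Y \<in> Obj D \<Longrightarrow> \<exists>G\<in>Obj C. \<exists>\<beta>.
      (\<forall>X\<in>Obj C. bij_betw (\<beta> X) (Hom D (on_obj F X) Y) (Hom C X G)) \<and>
      (\<forall>X\<in>Obj C. \<forall>X'\<in>Obj C. \<forall>a\<in>Hom C X' X. \<forall>k\<in>Hom D (on_obj F X) Y.
         \<beta> X' (k \<cdot>\<^bsub>D\<^esub> on_arr F a) = \<beta> X k \<cdot>\<^bsub>C\<^esub> a)"
  shows "has_right_adjoint C D F"
proof -
  interpret cfunctor C D F by fact
  have "\<exists>G \<beta>. \<forall>Y\<in>Obj D. G Y \<in> Obj C \<and>
      (\<forall>X\<in>Obj C. bij_betw (\<beta> Y X) (Hom D (on_obj F X) Y) (Hom C X (G Y))) \<and>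
      (\<forall>X\<in>Obj C. \<forall>X'\<in>Obj C. \<forall>a\<in>Hom C X' X. \<forall>k\<in>Hom D (on_obj F X) Y.
         \<beta> Y X' (k \<cdot>\<^bsub>D\<^esub> on_arr F a) = \<beta> Y X k \<cdot>\<^bsub>C\<^esub> a)"
    using repr by metis
  then obtain G \<beta> where G: "\<And>Y. Y \<in> Obj D \<Longrightarrow> G Y \<in> Obj C"
    and bij: "\<And>X Y. \<lbrakk>X \<in> Obj C; Y \<in> Obj D\<rbrakk> \<Longrightarrow>
      bij_betw (\<beta> Y X) (Hom D (on_obj F X) Y) (Hom C X (G Y))"
    and nat: "\<And>X X' Y a k. \<lbrakk>Y \<in> Obj D; X \<in> Obj C; X' \<in> Obj C; a \<in> Hom C X' X;
      k \<in> Hom D (on_obj F X) Y\<rbrakk> \<Longrightarrow> \<beta> Y X' (k \<cdot>\<^bsub>D\<^esub> on_arr F a) = \<beta> Y X k \<cdot>\<^bsub>C\<^esub> a"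
    by metis
  define \<epsilon> where "\<epsilon> Y = inv_into (Hom D (on_obj F (G Y)) Y) (\<beta> Y (G Y)) (Ident C (G Y))" for Y
  have \<epsilon>: "\<epsilon> Y \<in> Hom D (on_obj F (G Y)) Y" "\<beta> Y (G Y) (\<epsilon> Y) = Ident C (G Y)"
    if "Y \<in> Obj D" for Y
    using bij[OF G[OF that] that] source.Ident_Hom[OF G[OF that]] unfolding \<epsilon>_def bij_betw_def
    by (metis inv_into_into, metis f_inv_into_f)
  have \<beta>: "\<beta> Y X k \<in> Hom C X (G Y)" if "k \<in> Hom D (on_obj F X) Y" "X \<in> Obj C" for X Y k
    using that bij target.HomD(5) bij_betwE by metis
  \<comment> \<open>Both sides have the same image under the injective \<open>\<beta> Y X\<close>:
    naturality turns the right-hand side into \<open>\<beta> Y (G Y) (\<epsilon> Y)\<close>, an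
    identity, composed with \<open>\<beta> Y X k\<close>.\<close>
  have counit: "k = \<epsilon> Y \<cdot>\<^bsub>D\<^esub> on_arr F (\<beta> Y X k)"
    if k: "k \<in> Hom D (on_obj F X) Y" and X: "X \<in> Obj C" for X Y k
  proof -
    have Y: "Y \<in> Obj D" using target.HomD(5)[OF k] .
    have "\<beta> Y X (\<epsilon> Y \<cdot>\<^bsub>D\<^esub> on_arr F (\<beta> Y X k)) = \<beta> Y X k"
      using \<beta>[OF k X] by (simp add: nat[OF Y G[OF Y] X] \<epsilon>[OF Y] source.Ident_left)
    moreover have "\<epsilon> Y \<cdot>\<^bsub>D\<^esub> on_arr F (\<beta> Y X k) \<in> Hom D (on_obj F X) Y"
      using \<epsilon>[OF Y] on_arr[OF \<beta>[OF k X]] by (auto intro: target.Comp_Hom)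
    ultimately show ?thesis
      using bij[OF X Y] k by (metis bij_betw_def inj_onD)
  qed
  define G' where "G' = \<lparr>on_obj = G,
    on_arr = (\<lambda>b. \<beta> (Cod D b) (G (Dom D b)) (b \<cdot>\<^bsub>D\<^esub> \<epsilon> (Dom D b)))\<rparr>"
  have G'_arr: "on_arr G' b = \<beta> Y' (G Y) (b \<cdot>\<^bsub>D\<^esub> \<epsilon> Y)" if "b \<in> Hom D Y Y'" for b Y Y'
    using target.HomD[OF that] by (simp add: G'_def)
  have be: "b \<cdot>\<^bsub>D\<^esub> \<epsilon> Y \<in> Hom D (on_obj F (G Y)) Y'" if "b \<in> Hom D Y Y'" for b Y Y'
    using that \<epsilon>(1) target.HomD(4) by (metis target.Comp_Hom)
  have G'_Hom: "on_arr G' b \<in> Hom C (G Y) (G Y')" if "b \<in> Hom D Y Y'" for b Y Y'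
    using be[OF that] target.HomD[OF that] G by (simp add: G'_arr[OF that] \<beta>)
  have natural: "\<beta> Y' X' ((b \<cdot>\<^bsub>D\<^esub> k) \<cdot>\<^bsub>D\<^esub> on_arr F a) = (on_arr G' b \<cdot>\<^bsub>C\<^esub> \<beta> Y X k) \<cdot>\<^bsub>C\<^esub> a"
    if a: "a \<in> Hom C X' X" and k: "k \<in> Hom D (on_obj F X) Y" and b: "b \<in> Hom D Y Y'"
    for X X' Y Y' a b k
  proof -
    note O = source.HomD(4,5)[OF a] target.HomD(4,5)[OF b]
    have bk: "b \<cdot>\<^bsub>D\<^esub> k \<in> Hom D (on_obj F X) Y'"
      using k b by (rule target.Comp_Hom)
    have "b \<cdot>\<^bsub>D\<^esub> k = (b \<cdot>\<^bsub>D\<^esub> \<epsilon> Y) \<cdot>\<^bsub>D\<^esub> on_arr F (\<beta> Y X k)"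
      using counit[OF k O(2)] target.Comp_assoc[OF on_arr[OF \<beta>[OF k O(2)]] \<epsilon>(1)[OF O(3)] b] by simp
    then have "\<beta> Y' X (b \<cdot>\<^bsub>D\<^esub> k) = on_arr G' b \<cdot>\<^bsub>C\<^esub> \<beta> Y X k"
      using nat[OF O(4) G[OF O(3)] O(2) \<beta>[OF k O(2)] be[OF b]] by (simp add: G'_arr[OF b])
    then show ?thesis
      using nat[OF O(4,2,1) a bk] by simp
  qed
  have "cfunctor D C G'"
  proof
    fix Y assume Y: "Y \<in> Obj D"
    show "on_obj G' Y \<in> Obj C" using G[OF Y] by (simp add: G'_def)
    show "on_arr G' (Ident D Y) = Ident C (on_obj G' Y)"
      using G'_arr[OF target.Ident_Hom[OF Y]] \<epsilon>[OF Y] by (simp add: target.Ident_left G'_def)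
  next
    fix b Y Y' assume "b \<in> Hom D Y Y'"
    then show "on_arr G' b \<in> Hom C (on_obj G' Y) (on_obj G' Y')"
      using G'_Hom by (simp add: G'_def)
  next
    fix b Y Y' b' Y'' assume b: "b \<in> Hom D Y Y'" and b': "b' \<in> Hom D Y' Y''"
    note Y = target.HomD(4)[OF b]
    have "on_arr G' (b' \<cdot>\<^bsub>D\<^esub> b) = \<beta> Y'' (G Y) (b' \<cdot>\<^bsub>D\<^esub> (b \<cdot>\<^bsub>D\<^esub> \<epsilon> Y))"
      using G'_arr[OF target.Comp_Hom[OF b b']] target.Comp_assoc[OF \<epsilon>(1)[OF Y] b b'] by simp
    \<comment> \<open>A factor F(id) is inserted to reach the shape of \<open>natural\<close>, which
      is then used with k = b \<epsilon>: functoriality of G is a case of naturality.\<close>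
    also have "\<dots> = \<beta> Y'' (G Y) ((b' \<cdot>\<^bsub>D\<^esub> (b \<cdot>\<^bsub>D\<^esub> \<epsilon> Y)) \<cdot>\<^bsub>D\<^esub> on_arr F (Ident C (G Y)))"
      using target.Comp_Hom[OF be[OF b] b'] by (simp add: on_Ident G Y target.Ident_right)
    also have "\<dots> = (on_arr G' b' \<cdot>\<^bsub>C\<^esub> on_arr G' b) \<cdot>\<^bsub>C\<^esub> Ident C (G Y)"
      using natural[OF source.Ident_Hom[OF G[OF Y]] be[OF b] b'] by (simp add: G'_arr[OF b])
    also have "\<dots> = on_arr G' b' \<cdot>\<^bsub>C\<^esub> on_arr G' b"
      using source.Comp_Hom[OF G'_Hom[OF b] G'_Hom[OF b']] by (rule source.Ident_right)
    finally show "on_arr G' (b' \<cdot>\<^bsub>D\<^esub> b) = on_arr G' b' \<cdot>\<^bsub>C\<^esub> on_arr G' b" .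
  qed
  then have "adjunction C D F G' (\<lambda>X Y. \<beta> Y X)"
    using assms(1) bij natural by (auto simp: adjunction_def G'_def)
  then show ?thesis
    unfolding has_right_adjoint_def by blast
qed

section \<open>Suspensions and triangles\<close>

text \<open>An equivalence between neighbouring integers lets the induction run from 0 in both
  directions at once. It suits statements on \<Sigma>^n: applying \<Sigma> raises n by one, and this
  can be undone by injectivity.\<close>

lemma int_iff_induct [case_names zero step]:
  fixes n :: int
  assumes "P 0" "\<And>n. P (n + 1) \<longleftrightarrow> P n"
  shows "P n"
proof (induct n rule: int_induct[where k = 0])
  case (step2 i)
  then show ?case using assms(2)[of "i - 1"] by simp
qed (use assms in auto)

text \<open>Common form of the object part and the arrow part of \<open>Susp_pow\<close>, so that
  the power laws are proved once. As \<open>inv_into A f\<close> inverts f only on A, the laws are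
  stated for elements of A.\<close>

definition bij_pow :: "'c set \<Rightarrow> ('c \<Rightarrow> 'c) \<Rightarrow> int \<Rightarrow> 'c \<Rightarrow> 'c" where
  "bij_pow A f n = (if 0 \<le> n then f ^^ nat n else inv_into A f ^^ nat (- n))"

lemma bij_pow_0 [simp]: "bij_pow A f 0 x = x"
  by (simp add: bij_pow_def)

lemma funpow_closed: "(\<And>x. x \<in> A \<Longrightarrow> f x \<in> A) \<Longrightarrow> x \<in> A \<Longrightarrow> (f ^^ n) x \<in> A"
  by (induct n) auto

lemma bij_pow_closed:
  assumes "bij_betw f A A" "x \<in> A"
  shows "bij_pow A f n x \<in> A"
  using assms funpow_closed[of A f x] funpow_closed[of A "inv_into A f" x]
    bij_betwE[OF assms(1)] bij_betwE[OF bij_betw_inv_into[OF assms(1)]]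
  by (auto simp: bij_pow_def)

lemma bij_pow_Suc:
  assumes "bij_betw f A A" "x \<in> A"
  shows "bij_pow A f (n + 1) x = f (bij_pow A f n x)"
proof (cases "0 \<le> n")
  case True
  then show ?thesis by (simp add: bij_pow_def nat_add_distrib)
next
  case False
  \<comment> \<open>For negative n the power n consists of m + 1 inverse steps and the power n + 1
    of m of them; f cancels the outermost one.\<close>
  define m where "m = nat (- n - 1)"
  have m: "nat (- n) = Suc m" "n = - int (Suc m)"
    using False by (simp_all add: m_def)
  have "(inv_into A f ^^ m) x \<in> A"
    using bij_betwE[OF bij_betw_inv_into[OF assms(1)]] by (intro funpow_closed assms(2)) auto
  then have "f (bij_pow A f n x) = (inv_into A f ^^ m) x"
    using m by (simp add: bij_pow_def bij_betw_inv_into_right[OF assms(1)])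
  \<comment> \<open>Here n + 1 = -m. For m = 0 this is no longer negative, and the definition
    switches to its other branch.\<close>
  also have "\<dots> = bij_pow A f (n + 1) x"
    using m(2) by (cases "m = 0") (simp_all add: bij_pow_def)
  finally show ?thesis by simp
qed

lemma bij_pow_add:
  assumes "bij_betw f A A" "x \<in> A"
  shows "bij_pow A f (a + b) x = bij_pow A f a (bij_pow A f b x)"
proof (induct a rule: int_iff_induct)
  case (step a)
  have "bij_pow A f (a + 1 + b) x = f (bij_pow A f (a + b) x)"
    using bij_pow_Suc[OF assms, of "a + b"] by (simp add: ac_simps)
  moreover have "bij_pow A f (a + 1) (bij_pow A f b x) = f (bij_pow A f a (bij_pow A f b x))"
    using bij_pow_Suc[OF assms(1) bij_pow_closed[OF assms]] .
  ultimately show ?case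
    using inj_onD[OF bij_betw_imp_inj_on[OF assms(1)]] bij_pow_closed[OF assms(1)] assms(2) by metis
qed simp

abbreviation "\<sigma>o T n \<equiv> on_obj (Susp_pow T n)"
abbreviation "\<sigma>a T n \<equiv> on_arr (Susp_pow T n)"

lemma Susp_pow_bij_pow:
  "\<sigma>o T n = bij_pow (Obj T) (on_obj (Susp T)) n" "\<sigma>a T n = bij_pow (Arr T) (on_arr (Susp T)) n"
  by (simp_all add: Susp_pow_def bij_pow_def)

lemma Susp_pow_0 [simp]: "\<sigma>o T 0 X = X" "\<sigma>a T 0 f = f"
  by (simp_all add: Susp_pow_def)

lemma Susp_pow_1 [simp]: "Susp_pow T 1 = Susp T"
  by (simp add: Susp_pow_def)

section \<open>Hom groups, signs and weak cokernels\<close>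

lemma Hom_group_simps [simp]:
  "carrier (Hom_group A X Y) = Hom A X Y" "f \<otimes>\<^bsub>Hom_group A X Y\<^esub> g = Plus A f g"
  "\<one>\<^bsub>Hom_group A X Y\<^esub> = Zero A X Y"
  by (simp_all add: Hom_group_def)

lemma comm_group_hom:
  assumes "h \<in> hom G H" "comm_group G" "comm_group H"
  shows "group_hom G H h"
  using assms by (simp add: group_hom_def group_hom_axioms_def comm_group_def)

lemma signed_closed:
  assumes "comm_group G" "x \<in> carrier G"
  shows "signed G n x \<in> carrier G"
  using assms by (simp add: signed_def comm_group_def group.inv_closed)

lemma signed_hom:
  assumes "h \<in> hom G H" "comm_group G" "comm_group H" "x \<in> carrier G"
  shows "h (signed G n x) = signed H n (h x)"
  using group_hom.hom_inv[OF comm_group_hom[OF assms(1-3)]] assms(4) by (simp add: signed_def)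

lemma signed_signed:
  assumes "comm_group G" "x \<in> carrier G"
  shows "signed G m (signed G n x) = signed G (m + n) x"
  using assms by (auto simp: signed_def comm_group_def group.inv_inv)

lemma signed_mult:
  assumes "comm_group G" "x \<in> carrier G" "y \<in> carrier G"
  shows "signed G n (x \<otimes>\<^bsub>G\<^esub> y) = signed G n x \<otimes>\<^bsub>G\<^esub> signed G n y"
  using assms by (simp add: signed_def comm_group.inv_mult)

lemma signed_even [simp]: "even n \<Longrightarrow> signed G n x = x"
  by (simp add: signed_def)

context preadditive
begin

lemma Hom_group_closed:
  assumes "X \<in> Obj A" "Y \<in> Obj A"
  shows "Zero A X Y \<in> Hom A X Y"
    and "\<lbrakk>f \<in> Hom A X Y; g \<in> Hom A X Y\<rbrakk> \<Longrightarrow> Plus A f g \<in> Hom A X Y"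
    and "f \<in> Hom A X Y \<Longrightarrow> signed (Hom_group A X Y) n f \<in> Hom A X Y"
  using monoid.one_closed[OF comm_group.axioms(1)[THEN comm_monoid.axioms(1)]]
    monoid.m_closed[OF comm_group.axioms(1)[THEN comm_monoid.axioms(1)]]
    Hom_comm_group[OF assms] signed_closed by fastforce+

lemma Comp_left_hom:
  assumes "f \<in> Hom A X Y" "Z \<in> Obj A"
  shows "(\<lambda>g. g \<cdot> f) \<in> hom (Hom_group A Y Z) (Hom_group A X Z)"
  using assms by (auto simp: hom_def Comp_Plus_left intro: Comp_Hom)

lemma Comp_right_hom:
  assumes "g \<in> Hom A Y Z" "X \<in> Obj A"
  shows "(\<lambda>f. g \<cdot> f) \<in> hom (Hom_group A X Y) (Hom_group A X Z)"
  using assms by (auto simp: hom_def Comp_Plus_right intro: Comp_Hom)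

lemma Comp_Zero:
  assumes "g \<in> Hom A Y Z" "X \<in> Obj A"
  shows "g \<cdot> Zero A X Y = Zero A X Z"
  using group_hom.hom_one[OF comm_group_hom[OF Comp_right_hom[OF assms]]] Hom_comm_group HomD[OF assms(1)]
    assms(2) by simp

lemma signed_Comp:
  assumes "f \<in> Hom A X Y" "g \<in> Hom A Y Z"
  shows "signed (Hom_group A Y Z) n g \<cdot> f = signed (Hom_group A X Z) n (g \<cdot> f)"
  using signed_hom[OF Comp_left_hom[OF assms(1) HomD(5)[OF assms(2)]]] Hom_comm_group
    HomD[OF assms(1)] HomD[OF assms(2)] assms(2) by simp

lemma Comp_signed:
  assumes "f \<in> Hom A X Y" "g \<in> Hom A Y Z"
  shows "g \<cdot> signed (Hom_group A X Y) n f = signed (Hom_group A X Z) n (g \<cdot> f)"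
  using signed_hom[OF Comp_right_hom[OF assms(2) HomD(4)[OF assms(1)]]] Hom_comm_group
    HomD[OF assms(1)] HomD[OF assms(2)] assms(1) by simp

text \<open>Subsumes the negative in a rotated triangle under the calculus of
  \<open>signed\<close>.\<close>

lemma neg_signed: "f \<in> Hom A X Y \<Longrightarrow> neg A f = signed (Hom_group A X Y) 1 f"
  by (auto simp: neg_def signed_def dest: HomD)

text \<open>Exactness of Hom(C, W) -> Hom(B, W) -> Hom(A, W) for all W, where p : A -> B and q : B
  -> C. The equivalence contains both q p = 0 (take g = q) and the factorization, in general not
  unique, of every map that kills p. Stating it inside the category allows suspensions and signs to
  be treated before any graded module appears.\<close>

definition weak_cokernel :: "'m \<Rightarrow> 'm \<Rightarrow> bool" where
  "weak_cokernel p q \<longleftrightarrow> p \<in> Arr A \<and> q \<in> Arr A \<and> Cod A p = Dom A q \<and>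
     (\<forall>W\<in>Obj A. \<forall>g\<in>Hom A (Cod A p) W.
        g \<cdot> p = Zero A (Dom A p) W \<longleftrightarrow> (\<exists>g'\<in>Hom A (Cod A q) W. g = g' \<cdot> q))"

text \<open>A factorization k (-q) is the same as (-k) q, and k |-> -k is an involution of the Hom
  group. This disposes of the sign that rotation puts on \<Sigma>u.\<close>

lemma weak_cokernel_neg:
  assumes "weak_cokernel p (neg A q)" "q \<in> Arr A"
  shows "weak_cokernel p q"
proof -
  have q: "q \<in> Hom A (Dom A q) (Cod A q)"
    using assms(2) by (rule Arr_Hom)
  have nq: "neg A q \<in> Hom A (Dom A q) (Cod A q)"
    using HomD[OF q] q by (simp add: neg_signed[OF q] Hom_group_closed)
  have "(\<exists>g'\<in>Hom A (Cod A q) W. g = g' \<cdot> neg A q) \<longleftrightarrow> (\<exists>g'\<in>Hom A (Cod A q) W. g = g' \<cdot> q)"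
    if "W \<in> Obj A" for g W
  proof -
    let ?s = "signed (Hom_group A (Cod A q) W) 1"
    have *: "?s k \<in> Hom A (Cod A q) W \<and> k \<cdot> neg A q = ?s k \<cdot> q \<and> ?s (?s k) = k"
      if k: "k \<in> Hom A (Cod A q) W" for k
      using HomD[OF k] k signed_signed[OF Hom_comm_group[OF HomD(4,5)[OF k]], of k 1 1]
      by (simp add: Hom_group_closed neg_signed[OF q] Comp_signed[OF q] signed_Comp[OF q])
    then show ?thesis by metis
  qed
  then show ?thesis
    using assms HomD[OF nq] by (simp add: weak_cokernel_def)
qed

end

section \<open>Powers of the suspension and exact triangles\<close>

context triangulated
begin

sublocale Susp: cfunctor T T "Susp T"
  using Susp_additive by (simp add: additive_functor_def)

lemma Susp_inj: "\<lbrakk>f \<in> Arr T; g \<in> Arr T; on_arr (Susp T) f = on_arr (Susp T) g\<rbrakk> \<Longrightarrow> f = g"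
  using inj_onD[OF bij_betw_imp_inj_on[OF Susp_bij_Arr]] by blast

lemma Susp_pow_add:
  shows "X \<in> Obj T \<Longrightarrow> \<sigma>o T a (\<sigma>o T b X) = \<sigma>o T (a + b) X"
    and "f \<in> Arr T \<Longrightarrow> \<sigma>a T a (\<sigma>a T b f) = \<sigma>a T (a + b) f"
  by (simp_all add: Susp_pow_bij_pow bij_pow_add[OF Susp_bij_Obj] bij_pow_add[OF Susp_bij_Arr])

lemma Susp_pow_Suc:
  shows "X \<in> Obj T \<Longrightarrow> \<sigma>o T (n + 1) X = on_obj (Susp T) (\<sigma>o T n X)"
    and "f \<in> Arr T \<Longrightarrow> \<sigma>a T (n + 1) f = on_arr (Susp T) (\<sigma>a T n f)"
  by (simp_all add: Susp_pow_bij_pow bij_pow_Suc[OF Susp_bij_Obj] bij_pow_Suc[OF Susp_bij_Arr])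

lemma Susp_pow_Obj: "X \<in> Obj T \<Longrightarrow> \<sigma>o T n X \<in> Obj T"
  and Susp_pow_Arr: "f \<in> Arr T \<Longrightarrow> \<sigma>a T n f \<in> Arr T"
  by (simp_all add: Susp_pow_bij_pow bij_pow_closed[OF Susp_bij_Obj] bij_pow_closed[OF Susp_bij_Arr])

text \<open>Injectivity of \<Sigma> on objects lets it reflect source and target. This is the
  descending half of the induction that gives the source and target of \<Sigma>^n f.\<close>

lemma Susp_Hom_iff:
  assumes "f \<in> Arr T" "X \<in> Obj T" "Y \<in> Obj T"
  shows "on_arr (Susp T) f \<in> Hom T (on_obj (Susp T) X) (on_obj (Susp T) Y) \<longleftrightarrow> f \<in> Hom T X Y"
proof
  assume "on_arr (Susp T) f \<in> Hom T (on_obj (Susp T) X) (on_obj (Susp T) Y)"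
  with HomD[OF Susp.on_arr[OF Arr_Hom[OF assms(1)]]]
  have "on_obj (Susp T) (Dom T f) = on_obj (Susp T) X" "on_obj (Susp T) (Cod T f) = on_obj (Susp T) Y"
    by (auto dest: HomD)
  then have "Dom T f = X" "Cod T f = Y"
    using inj_onD[OF bij_betw_imp_inj_on[OF Susp_bij_Obj]] assms Dom_Obj Cod_Obj by blast+
  then show "f \<in> Hom T X Y"
    using assms(1) by (simp add: Hom_def)
qed (rule Susp.on_arr)

lemma Susp_pow_Hom:
  assumes "f \<in> Hom T X Y"
  shows "\<sigma>a T n f \<in> Hom T (\<sigma>o T n X) (\<sigma>o T n Y)"
proof (induct n rule: int_iff_induct)
  case (step n)
  note f = HomD[OF assms]
  show ?case
    using f by (simp add: Susp_pow_Suc Susp_Hom_iff Susp_pow_Obj Susp_pow_Arr)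
qed (simp add: assms)

lemma Susp_pow_Ident:
  assumes "X \<in> Obj T"
  shows "\<sigma>a T n (Ident T X) = Ident T (\<sigma>o T n X)"
proof (induct n rule: int_iff_induct)
  case (step n)
  have I: "Ident T X \<in> Arr T" "Ident T (\<sigma>o T n X) \<in> Arr T"
    using assms Ident_Hom HomD(1) Susp_pow_Obj by blast+
  then show ?case
    using assms Susp_inj[OF Susp_pow_Arr[OF I(1)] I(2)]
    by (auto simp: Susp_pow_Suc Susp.on_Ident[OF Susp_pow_Obj, symmetric])
qed simp

lemma Susp_pow_Comp:
  assumes "f \<in> Hom T X Y" "g \<in> Hom T Y Z"
  shows "\<sigma>a T n (g \<cdot> f) = \<sigma>a T n g \<cdot> \<sigma>a T n f"
proof (induct n rule: int_iff_induct)
  case (step n)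
  note f = Susp_pow_Hom[OF assms(1), of n] and g = Susp_pow_Hom[OF assms(2), of n]
  have "\<sigma>a T (n + 1) (g \<cdot> f) = on_arr (Susp T) (\<sigma>a T n (g \<cdot> f))"
    and "\<sigma>a T (n + 1) g \<cdot> \<sigma>a T (n + 1) f = on_arr (Susp T) (\<sigma>a T n g \<cdot> \<sigma>a T n f)"
    using HomD[OF assms(1)] HomD[OF assms(2)] HomD[OF Comp_Hom[OF assms]]
    by (simp_all add: Susp_pow_Suc Susp.on_Comp[OF f g])
  then show ?case
    using Susp_inj[OF Susp_pow_Arr[OF HomD(1)[OF Comp_Hom[OF assms]]] HomD(1)[OF Comp_Hom[OF f g]]]
    by auto
qed simp

lemma Susp_pow_Plus:
  assumes "f \<in> Hom T X Y" "g \<in> Hom T X Y"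
  shows "\<sigma>a T n (Plus T f g) = Plus T (\<sigma>a T n f) (\<sigma>a T n g)"
proof (induct n rule: int_iff_induct)
  case (step n)
  note O = HomD(4,5)[OF assms(1)]
  note p = Hom_group_closed(2)[OF O assms]
  note f = Susp_pow_Hom[OF assms(1), of n] and g = Susp_pow_Hom[OF assms(2), of n]
  note q = Hom_group_closed(2)[OF HomD(4,5)[OF f] f g]
  have "\<sigma>a T (n + 1) (Plus T f g) = on_arr (Susp T) (\<sigma>a T n (Plus T f g))"
    using HomD[OF p] by (simp add: Susp_pow_Suc)
  moreover have "Plus T (\<sigma>a T (n + 1) f) (\<sigma>a T (n + 1) g) = on_arr (Susp T) (Plus T (\<sigma>a T n f) (\<sigma>a T n g))"
    using HomD(1)[OF assms(1)] HomD(1)[OF assms(2)] Susp_additive HomD(4,5)[OF f] f g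
    by (simp add: Susp_pow_Suc additive_functor_def)
  ultimately show ?case
    using Susp_inj[OF Susp_pow_Arr[OF HomD(1)[OF p]] HomD(1)[OF q]] by auto
qed simp

lemma cfunctor_Susp_pow: "cfunctor T T (Susp_pow T n)"
  by unfold_locales (auto simp: Susp_pow_Obj Susp_pow_Ident Susp_pow_Comp intro: Susp_pow_Hom)

lemma Susp_pow_hom:
  assumes "X \<in> Obj T" "Y \<in> Obj T"
  shows "\<sigma>a T n \<in> hom (Hom_group T X Y) (Hom_group T (\<sigma>o T n X) (\<sigma>o T n Y))"
  by (auto simp: hom_def Susp_pow_Plus intro: Susp_pow_Hom)

lemma Susp_pow_signed:
  assumes "f \<in> Hom T X Y"
  shows "\<sigma>a T n (signed (Hom_group T X Y) k f) = signed (Hom_group T (\<sigma>o T n X) (\<sigma>o T n Y)) k (\<sigma>a T n f)"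
  using HomD[OF assms] assms
  by (intro signed_hom Susp_pow_hom) (auto simp: Hom_comm_group Susp_pow_Obj)

lemma Susp_pow_Zero:
  assumes "X \<in> Obj T" "Y \<in> Obj T"
  shows "\<sigma>a T n (Zero T X Y) = Zero T (\<sigma>o T n X) (\<sigma>o T n Y)"
  using group_hom.hom_one[OF comm_group_hom[OF Susp_pow_hom[OF assms]]] assms
  by (simp add: Hom_comm_group Susp_pow_Obj)

text \<open>As \<Sigma>^n is an additive automorphism, a test map g into W corresponds to the test
  map \<Sigma>^{-n} g into \<Sigma>^{-n} W; vanishing and factorizations correspond as well.\<close>

lemma weak_cokernel_Susp_pow:
  assumes "weak_cokernel p q"
  shows "weak_cokernel (\<sigma>a T n p) (\<sigma>a T n q)"
proof -
  from assms obtain X Y Z where p: "p \<in> Hom T X Y" and q: "q \<in> Hom T Y Z"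
    and wc: "\<And>W g. \<lbrakk>W \<in> Obj T; g \<in> Hom T Y W\<rbrakk> \<Longrightarrow>
      g \<cdot> p = Zero T X W \<longleftrightarrow> (\<exists>g'\<in>Hom T Z W. g = g' \<cdot> q)"
    by (auto simp: weak_cokernel_def Hom_def)
  note O = HomD(4,5)[OF p] HomD(5)[OF q]
  have inv: "\<sigma>a T n (\<sigma>a T (- n) f) = f" "\<sigma>a T (- n) (\<sigma>a T n f) = f" if "f \<in> Hom T U V" for f U V
    using HomD(1)[OF that] by (simp_all add: Susp_pow_add)
  have inv_obj: "\<sigma>o T n (\<sigma>o T (- n) U) = U" "\<sigma>o T (- n) (\<sigma>o T n U) = U" if "U \<in> Obj T" for U
    using that by (simp_all add: Susp_pow_add)
  have "g \<cdot> \<sigma>a T n p = Zero T (\<sigma>o T n X) W \<longleftrightarrow> (\<exists>g'\<in>Hom T (\<sigma>o T n Z) W. g = g' \<cdot> \<sigma>a T n q)"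
    if W: "W \<in> Obj T" and g: "g \<in> Hom T (\<sigma>o T n Y) W" for W g
  proof -
    let ?g = "\<sigma>a T (- n) g" and ?W = "\<sigma>o T (- n) W"
    have W': "?W \<in> Obj T" using W by (rule Susp_pow_Obj)
    have g': "?g \<in> Hom T Y ?W"
      using Susp_pow_Hom[OF g, of "- n"] O by (simp add: inv_obj)
    have "g \<cdot> \<sigma>a T n p = Zero T (\<sigma>o T n X) W \<longleftrightarrow> ?g \<cdot> p = Zero T X ?W"
    proof
      assume "g \<cdot> \<sigma>a T n p = Zero T (\<sigma>o T n X) W"
      then show "?g \<cdot> p = Zero T X ?W"
        using Susp_pow_Comp[OF Susp_pow_Hom[OF p, of n] g, of "- n"] O W
        by (simp add: inv[OF p] Susp_pow_Zero Susp_pow_Obj inv_obj)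
    next
      assume "?g \<cdot> p = Zero T X ?W"
      then show "g \<cdot> \<sigma>a T n p = Zero T (\<sigma>o T n X) W"
        using Susp_pow_Comp[OF p g', of n] O W W'
        by (simp add: inv[OF g] Susp_pow_Zero Susp_pow_Obj inv_obj)
    qed
    also have "\<dots> \<longleftrightarrow> (\<exists>g'\<in>Hom T Z ?W. ?g = g' \<cdot> q)"
      using wc[OF W' g'] .
    also have "\<dots> \<longleftrightarrow> (\<exists>g'\<in>Hom T (\<sigma>o T n Z) W. g = g' \<cdot> \<sigma>a T n q)"
    proof safe
      fix k assume k: "k \<in> Hom T Z ?W" "?g = k \<cdot> q"
      have "\<sigma>a T n k \<in> Hom T (\<sigma>o T n Z) W"
        using Susp_pow_Hom[OF k(1), of n] W by (simp add: inv_obj)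
      moreover have "g = \<sigma>a T n k \<cdot> \<sigma>a T n q"
        using Susp_pow_Comp[OF q k(1), of n] k(2) inv(1)[OF g] by simp
      ultimately show "\<exists>g'\<in>Hom T (\<sigma>o T n Z) W. g = g' \<cdot> \<sigma>a T n q" by blast
    next
      fix k assume k: "k \<in> Hom T (\<sigma>o T n Z) W" "g = k \<cdot> \<sigma>a T n q"
      have "\<sigma>a T (- n) k \<in> Hom T Z ?W"
        using Susp_pow_Hom[OF k(1), of "- n"] O by (simp add: inv_obj)
      moreover have "\<sigma>a T (- n) (k \<cdot> \<sigma>a T n q) = \<sigma>a T (- n) k \<cdot> q"
        using Susp_pow_Comp[OF Susp_pow_Hom[OF q, of n] k(1), of "- n"] inv(2)[OF q] by simp
      ultimately show "\<exists>g'\<in>Hom T Z ?W. \<sigma>a T (- n) (k \<cdot> \<sigma>a T n q) = g' \<cdot> q" by blast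
    qed
    finally show ?thesis .
  qed
  then show ?thesis
    using HomD[OF Susp_pow_Hom[OF p, of n]] HomD[OF Susp_pow_Hom[OF q, of n]]
    by (simp add: weak_cokernel_def)
qed

text \<open>Every object X is the suspension of \<Sigma>^{-1} X, and every map between suspensions
  is a suspension, so unique existence carries over from Z. The result supplies the zero object at
  the end of the triangle 0 -> W -> W -> 0.\<close>

lemma zero_object_Susp:
  assumes "zero_object T Z"
  shows "zero_object T (on_obj (Susp T) Z)"
proof -
  have Z: "Z \<in> Obj T" using assms by (simp add: zero_object_def)
  have "\<exists>!f. f \<in> Hom T X (on_obj (Susp T) Z)" and "\<exists>!f. f \<in> Hom T (on_obj (Susp T) Z) X"
    if X: "X \<in> Obj T" for X
  proof -
    have X': "\<sigma>o T (- 1) X \<in> Obj T" "on_obj (Susp T) (\<sigma>o T (- 1) X) = X"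
      using X Susp_pow_add(1)[of X 1 "- 1"] by (simp_all add: Susp_pow_Obj)
    have lift: "f \<in> Hom T (on_obj (Susp T) U) (on_obj (Susp T) V) \<longleftrightarrow>
        (\<exists>f'\<in>Hom T U V. f = on_arr (Susp T) f')" if "U \<in> Obj T" "V \<in> Obj T" for f U V
    proof
      assume f: "f \<in> Hom T (on_obj (Susp T) U) (on_obj (Susp T) V)"
      then obtain f' where "f' \<in> Arr T" "f = on_arr (Susp T) f'"
        using HomD(1) bij_betw_imp_surj_on[OF Susp_bij_Arr] by blast
      then show "\<exists>f'\<in>Hom T U V. f = on_arr (Susp T) f'"
        using Susp_Hom_iff that f by blast
    qed (auto intro: Susp.on_arr)
    have u: "\<exists>!f. f \<in> Hom T (\<sigma>o T (- 1) X) Z" "\<exists>!f. f \<in> Hom T Z (\<sigma>o T (- 1) X)"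
      using assms X'(1) by (simp_all add: zero_object_def)
    note f = lift[OF X'(1) Z] lift[OF Z X'(1)]
    show "\<exists>!f. f \<in> Hom T X (on_obj (Susp T) Z)" "\<exists>!f. f \<in> Hom T (on_obj (Susp T) Z) X"
      using f[unfolded X'(2)] u by metis+
  qed
  then show ?thesis
    using Susp.on_obj[OF Z] by (simp add: zero_object_def)
qed

text \<open>A map out of \<open>Y\<close> that kills \<open>u\<close> extends along \<open>v\<close> because it is the middle component of a
  morphism from \<open>(u, v, w)\<close> to the triangle \<open>0 \<rightarrow> W \<rightarrow> W \<rightarrow> 0\<close>.\<close>

lemma weak_cokernel_Tri:
  assumes "(u, v, w) \<in> Tri T"
  shows "weak_cokernel u v"
proof -
  have "candidate_triangle T (u, v, w)"
    using assms by (rule Tri_candidate)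
  then obtain X Y Z where u: "u \<in> Hom T X Y" and v: "v \<in> Hom T Y Z"
    by (auto simp: candidate_triangle_def Hom_def)
  note O = HomD(4,5)[OF u] HomD(5)[OF v] and hu = HomD[OF u] and hv = HomD[OF v]
  obtain N where N: "zero_object T N" using ex_zero_object by blast
  then have NO: "N \<in> Obj T" by (simp add: zero_object_def)
  have vu: "v \<cdot> u = Zero T X Z"
  proof -
    \<comment> \<open>The pair (id, u) maps the trivial triangle X -> X -> 0 to the given one. Its
      completion shows that v u factors through a zero object.\<close>
    have "\<exists>c. triangle_morphism T (Ident T X, Zero T X N, Zero T N (on_obj (Susp T) X)) (u, v, w)
        (Ident T X, u, c)"
      using Ident_Hom[OF O(1)] u hu Ident_right[OF u] HomD[OF Ident_Hom[OF O(1)]]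
      by (intro Tri_complete[OF Tri_Ident[OF O(1) N] assms]) simp_all
    then obtain c where c: "c \<in> Hom T N Z" "c \<cdot> Zero T X N = v \<cdot> u"
      using hv HomD[OF Hom_group_closed(1)[OF O(1) NO]] by (auto simp: triangle_morphism_def)
    then show ?thesis using Comp_Zero[OF c(1) O(1)] by simp
  qed
  have "\<exists>g'\<in>Hom T Z W. g = g' \<cdot> v"
    if W: "W \<in> Obj T" and g: "g \<in> Hom T Y W" and gu: "g \<cdot> u = Zero T X W" for g W
  proof -
    \<comment> \<open>\<open>Tri_Ident\<close> only offers W -> W -> 0. The triangle N -> W -> W ->
      \<Sigma>N is obtained by undoing a rotation of it, taken with \<Sigma>N as zero object; the
      negated third map of the rotation is then the unique map out of \<Sigma>N.\<close>
    let ?N = "on_obj (Susp T) N"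
    have N': "zero_object T ?N" using zero_object_Susp[OF N] .
    have N'O: "?N \<in> Obj T" using N' by (simp add: zero_object_def)
    note z = Hom_group_closed(1)[OF NO W] and z' = Hom_group_closed(1)[OF W N'O]
    have sz: "on_arr (Susp T) (Zero T N W) \<in> Hom T ?N (on_obj (Susp T) W)"
      using Susp.on_arr[OF z] .
    have "neg T (on_arr (Susp T) (Zero T N W)) \<in> Hom T ?N (on_obj (Susp T) W)"
      unfolding neg_signed[OF sz] using HomD[OF sz] sz by (simp add: Hom_group_closed(3))
    then have "neg T (on_arr (Susp T) (Zero T N W)) = Zero T ?N (on_obj (Susp T) W)"
      using Hom_group_closed(1)[OF N'O Susp.on_obj[OF W]] N' Susp.on_obj[OF W]
      unfolding zero_object_def by blast
    moreover have "candidate_triangle T (Zero T N W, Ident T W, Zero T W ?N)"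
      using HomD[OF z] HomD[OF z'] HomD[OF Ident_Hom[OF W]] by (simp add: candidate_triangle_def)
    ultimately have tri: "(Zero T N W, Ident T W, Zero T W ?N) \<in> Tri T"
      using Tri_Ident[OF W N'] by (simp add: Tri_rotate)
    have "\<exists>c. triangle_morphism T (u, v, w) (Zero T N W, Ident T W, Zero T W ?N) (Zero T X N, g, c)"
      using hu HomD[OF z] g gu Hom_group_closed(1)[OF O(1) NO] Comp_Zero[OF z O(1)]
      by (intro Tri_complete[OF assms tri]) simp_all
    then obtain c where "c \<in> Hom T Z W" "c \<cdot> v = Ident T W \<cdot> g"
      using hv HomD[OF Ident_Hom[OF W]] by (auto simp: triangle_morphism_def)
    then show ?thesis
      using Ident_left[OF g] by auto
  qed
  moreover have "(g \<cdot> v) \<cdot> u = Zero T X W" if "W \<in> Obj T" "g \<in> Hom T Z W" for g W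
    using Comp_assoc[OF u v that(2)] Comp_Zero[OF that(2) O(1)] vu by simp
  ultimately show ?thesis
    using hu hv by (auto simp: weak_cokernel_def)
qed

text \<open>Any two consecutive maps begin an exact triangle after zero, one or two rotations. Two
  rotations lead to -\<Sigma>u, and the sign is then dropped.\<close>

lemma weak_cokernels_Tri:
  assumes "(u, v, w) \<in> Tri T"
  shows "weak_cokernel u v" "weak_cokernel v w" "weak_cokernel w (on_arr (Susp T) u)"
proof -
  have 1: "(v, w, neg T (on_arr (Susp T) u)) \<in> Tri T"
    using Tri_rotate[OF Tri_candidate[OF assms]] assms by simp
  have 2: "(w, neg T (on_arr (Susp T) u), neg T (on_arr (Susp T) v)) \<in> Tri T"
    using Tri_rotate[OF Tri_candidate[OF 1]] 1 by simp
  have "u \<in> Arr T"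
    using Tri_candidate[OF assms] by (simp add: candidate_triangle_def)
  then show "weak_cokernel u v" "weak_cokernel v w" "weak_cokernel w (on_arr (Susp T) u)"
    using weak_cokernel_Tri[OF assms] weak_cokernel_Tri[OF 1] weak_cokernel_Tri[OF 2]
      weak_cokernel_neg HomD(1)[OF Susp.on_arr[OF Arr_Hom]] by blast+
qed

end

section \<open>Graded modules\<close>

lemma graded_module_homD:
  assumes "graded_module_hom R M N \<alpha>"
  shows "m \<in> carrier (Mdeg M d) \<Longrightarrow> \<alpha> d m \<in> carrier (Mdeg N d)"
    and "\<lbrakk>m \<in> carrier (Mdeg M d); m' \<in> carrier (Mdeg M d)\<rbrakk> \<Longrightarrow>
      \<alpha> d (m \<otimes>\<^bsub>Mdeg M d\<^esub> m') = \<alpha> d m \<otimes>\<^bsub>Mdeg N d\<^esub> \<alpha> d m'"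
    and "\<lbrakk>r \<in> carrier (Rdeg R d); m \<in> carrier (Mdeg M e)\<rbrakk> \<Longrightarrow>
      \<alpha> (d + e) (Mact M d e r m) = Mact N d e r (\<alpha> e m)"
  using assms by (auto simp: graded_module_hom_def hom_def)

lemma graded_module_homI:
  assumes "\<And>d m. m \<in> carrier (Mdeg M d) \<Longrightarrow> \<alpha> d m \<in> carrier (Mdeg N d)"
    and "\<And>d m m'. \<lbrakk>m \<in> carrier (Mdeg M d); m' \<in> carrier (Mdeg M d)\<rbrakk> \<Longrightarrow>
      \<alpha> d (m \<otimes>\<^bsub>Mdeg M d\<^esub> m') = \<alpha> d m \<otimes>\<^bsub>Mdeg N d\<^esub> \<alpha> d m'"
    and "\<And>d e r m. \<lbrakk>r \<in> carrier (Rdeg R d); m \<in> carrier (Mdeg M e)\<rbrakk> \<Longrightarrow>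
      \<alpha> (d + e) (Mact M d e r m) = Mact N d e r (\<alpha> e m)"
  shows "graded_module_hom R M N \<alpha>"
  using assms by (auto simp: graded_module_hom_def hom_def)

lemma graded_module_hom_compose:
  assumes "graded_module_hom R L M \<alpha>" "graded_module_hom R M N \<beta>"
  shows "graded_module_hom R L N (\<lambda>d m. \<beta> d (\<alpha> d m))"
  by (rule graded_module_homI)
    (simp_all add: graded_module_homD[OF assms(1)] graded_module_homD[OF assms(2)])

context graded_module
begin

lemma Mdeg_mult_closed:
  "\<lbrakk>m \<in> carrier (Mdeg M d); m' \<in> carrier (Mdeg M d)\<rbrakk> \<Longrightarrow> m \<otimes>\<^bsub>Mdeg M d\<^esub> m' \<in> carrier (Mdeg M d)"
  using monoid.m_closed[OF comm_group.axioms(1)[OF Mdeg_comm_group, THEN comm_monoid.axioms(1)]] .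

text \<open>The conditions concern only values on homogeneous elements. This permits passing between
  a formula and its extensional restriction, the form required of arrows in
  \<open>grMod\<close>.\<close>

lemma graded_module_hom_cong:
  assumes "\<And>d m. m \<in> carrier (Mdeg M d) \<Longrightarrow> \<alpha> d m = \<beta> d m" "graded_module_hom R M N \<beta>"
  shows "graded_module_hom R M N \<alpha>"
  using assms(1) graded_module_homD[OF assms(2)]
  by (intro graded_module_homI) (simp_all add: Mdeg_mult_closed Mact_closed)

lemma Mact_hom:
  "r \<in> carrier (Rdeg R d) \<Longrightarrow> Mact M d e r \<in> hom (Mdeg M e) (Mdeg M (d + e))"
  by (auto simp: hom_def Mact_closed Mact_add_right)

lemma Mact_signed:
  assumes "r \<in> carrier (Rdeg R d)" "m \<in> carrier (Mdeg M e)"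
  shows "Mact M d e r (signed (Mdeg M e) n m) = signed (Mdeg M (d + e)) n (Mact M d e r m)"
  using assms by (intro signed_hom Mact_hom Mdeg_comm_group)

text \<open>The Koszul sign is multiplicative in the scalar: (-1)^{nd} (-1)^{ne} = (-1)^{n(d+e)},
  which gives associativity. The unit has degree 0 and receives no sign.\<close>

lemma graded_module_shift: "graded_module R (shift n M)"
proof (intro graded_module.intro graded_module_axioms.intro graded_ring_axioms)
  fix d e k r r' s m m'
  note comm = add.assoc add.commute add.left_commute
  show "comm_group (Mdeg (shift n M) d)"
    by (simp add: shift_def Mdeg_comm_group)
  show "Mact (shift n M) d e r m \<in> carrier (Mdeg (shift n M) (d + e))"
    if "r \<in> carrier (Rdeg R d)" "m \<in> carrier (Mdeg (shift n M) e)"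
    using that Mact_closed[of r d m "n + e"]
    by (simp add: shift_def comm signed_closed Mdeg_comm_group)
  show "Mact (shift n M) d e (r \<otimes>\<^bsub>Rdeg R d\<^esub> r') m =
      Mact (shift n M) d e r m \<otimes>\<^bsub>Mdeg (shift n M) (d + e)\<^esub> Mact (shift n M) d e r' m"
    if "r \<in> carrier (Rdeg R d)" "r' \<in> carrier (Rdeg R d)" "m \<in> carrier (Mdeg (shift n M) e)"
    using that by (simp add: shift_def comm Mact_add_left signed_mult Mdeg_comm_group Mact_closed)
  show "Mact (shift n M) d e r (m \<otimes>\<^bsub>Mdeg (shift n M) e\<^esub> m') =
      Mact (shift n M) d e r m \<otimes>\<^bsub>Mdeg (shift n M) (d + e)\<^esub> Mact (shift n M) d e r m'"
    if "r \<in> carrier (Rdeg R d)" "m \<in> carrier (Mdeg (shift n M) e)" "m' \<in> carrier (Mdeg (shift n M) e)"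
    using that by (simp add: shift_def comm Mact_add_right signed_mult Mdeg_comm_group Mact_closed)
  show "Mact (shift n M) (d + e) k (Rmult R d e r s) m =
      Mact (shift n M) d (e + k) r (Mact (shift n M) e k s m)"
    if "r \<in> carrier (Rdeg R d)" "s \<in> carrier (Rdeg R e)" "m \<in> carrier (Mdeg (shift n M) k)"
  proof -
    note m = that[unfolded shift_def, simplified]
    have "Mact (shift n M) d (e + k) r (Mact (shift n M) e k s m) =
        signed (Mdeg M (d + (e + (n + k)))) (n * d + n * e) (Mact M d (e + (n + k)) r (Mact M e (n + k) s m))"
      using m Mact_closed[OF m(2,3)] Mact_closed[OF m(1) Mact_closed[OF m(2,3)]]
      by (simp add: shift_def comm Mact_signed signed_signed Mdeg_comm_group)
    also have "Mact M d (e + (n + k)) r (Mact M e (n + k) s m) = Mact M (d + e) (n + k) (Rmult R d e r s) m"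
      using Mact_assoc[OF m] by simp
    finally show ?thesis
      by (simp add: shift_def comm distrib_left add.assoc)
  qed
  show "Mact (shift n M) 0 d (Rone R) m = m" if "m \<in> carrier (Mdeg (shift n M) d)"
    using that by (simp add: shift_def Mact_one)
qed

end

section \<open>The category of graded modules\<close>

lemma grMod_simps [simp]:
  "Obj (grMod R) = {M. graded_module R M}"
  "(M', \<beta>, N) \<cdot>\<^bsub>grMod R\<^esub> (L, \<alpha>, M) = (L, \<lambda>d. compose (carrier (Mdeg L d)) (\<beta> d) (\<alpha> d), N)"
  "Dom (grMod R) (L, \<alpha>, M) = L" "Cod (grMod R) (L, \<alpha>, M) = M"
  by (simp_all add: grMod_def)

lemma maps_simps [simp]: "maps (M, \<alpha>, N) = \<alpha>"
  by (simp add: maps_def)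

lemma maps_Ident [simp]: "m \<in> carrier (Mdeg M d) \<Longrightarrow> maps (Ident (grMod R) M) d m = m"
  by (simp add: grMod_def maps_def)

lemma Hom_grMod:
  "f \<in> Hom (grMod R) M N \<longleftrightarrow> graded_module R M \<and> graded_module R N \<and> f = (M, maps f, N) \<and>
     graded_module_hom R M N (maps f) \<and> (\<forall>d. maps f d \<in> extensional (carrier (Mdeg M d)))"
  by (cases f) (auto simp: Hom_def grMod_def)

lemma Hom_grModI:
  assumes "graded_module R M" "graded_module R N" "graded_module_hom R M N \<alpha>"
  shows "(M, \<lambda>d. \<lambda>m\<in>carrier (Mdeg M d). \<alpha> d m, N) \<in> Hom (grMod R) M N"
  using graded_module.graded_module_hom_cong[OF assms(1) _ assms(3)] assms by (simp add: Hom_grMod)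

lemma Hom_grModD:
  assumes "f \<in> Hom (grMod R) M N"
  shows "graded_module R M" "graded_module R N" "graded_module_hom R M N (maps f)"
    "m \<in> carrier (Mdeg M d) \<Longrightarrow> maps f d m \<in> carrier (Mdeg N d)"
    "f = (M, maps f, N)" "maps f d \<in> extensional (carrier (Mdeg M d))"
  using assms graded_module_homD(1) by (auto simp: Hom_grMod)

text \<open>Extensionality fixes the values off the carriers, so arrows can be compared on
  homogeneous elements alone.\<close>

lemma Hom_grMod_eqI:
  assumes "f \<in> Hom (grMod R) M N" "g \<in> Hom (grMod R) M N"
    and "\<And>d m. m \<in> carrier (Mdeg M d) \<Longrightarrow> maps f d m = maps g d m"
  shows "f = g"
proof -
  have "maps f = maps g"
    using Hom_grModD(6)[OF assms(1)] Hom_grModD(6)[OF assms(2)] assms(3)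
    by (intro ext[where f = "maps f"]) (rule extensionalityI)
  then show ?thesis
    using Hom_grModD(5)[OF assms(1)] Hom_grModD(5)[OF assms(2)] by simp
qed

lemma Comp_grMod:
  assumes "f \<in> Hom (grMod R) L M" "g \<in> Hom (grMod R) M N"
  shows "g \<cdot>\<^bsub>grMod R\<^esub> f = (L, \<lambda>d. \<lambda>m\<in>carrier (Mdeg L d). maps g d (maps f d m), N)"
  using grMod_simps(2)[of R M "maps g" N L "maps f" M] Hom_grModD(5)[OF assms(1)] Hom_grModD(5)[OF assms(2)]
  by (simp add: compose_def)

lemma maps_Comp:
  assumes "f \<in> Hom (grMod R) L M" "g \<in> Hom (grMod R) M N" "m \<in> carrier (Mdeg L d)"
  shows "maps (g \<cdot>\<^bsub>grMod R\<^esub> f) d m = maps g d (maps f d m)"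
  using assms(3) by (simp add: Comp_grMod[OF assms(1,2)])

lemma category_grMod: "category (grMod R)"
proof
  fix f assume "f \<in> Arr (grMod R)"
  then show "Dom (grMod R) f \<in> Obj (grMod R)" "Cod (grMod R) f \<in> Obj (grMod R)"
    by (auto simp: grMod_def)
next
  have Comp: "g \<cdot>\<^bsub>grMod R\<^esub> f \<in> Hom (grMod R) L N"
    if "f \<in> Hom (grMod R) L M" "g \<in> Hom (grMod R) M N" for f g L M N
    unfolding Comp_grMod[OF that]
    using Hom_grModI[OF Hom_grModD(1)[OF that(1)] Hom_grModD(2)[OF that(2)]
      graded_module_hom_compose[OF Hom_grModD(3)[OF that(1)] Hom_grModD(3)[OF that(2)]]] .
  have I: "Ident (grMod R) M \<in> Hom (grMod R) M M" if "graded_module R M" for M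
    using Hom_grModI[OF that that, of "\<lambda>d m. m"] by (simp add: graded_module_hom_def hom_def grMod_def)
  then show "Ident (grMod R) M \<in> Hom (grMod R) M M" if "M \<in> Obj (grMod R)" for M
    using that by simp
  fix f L M assume f: "f \<in> Hom (grMod R) L M"
  note I = I[OF Hom_grModD(1)[OF f]] I[OF Hom_grModD(2)[OF f]]
  show "Ident (grMod R) M \<cdot>\<^bsub>grMod R\<^esub> f = f" "f \<cdot>\<^bsub>grMod R\<^esub> Ident (grMod R) L = f"
    by (rule Hom_grMod_eqI[OF Comp[OF f I(2)] f], simp add: maps_Comp[OF f I(2)] Hom_grModD(4)[OF f],
        rule Hom_grMod_eqI[OF Comp[OF I(1) f] f], simp add: maps_Comp[OF I(1) f])
  fix g N assume g: "g \<in> Hom (grMod R) M N"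
  show "g \<cdot>\<^bsub>grMod R\<^esub> f \<in> Hom (grMod R) L N"
    using f g by (rule Comp)
  fix k P assume k: "k \<in> Hom (grMod R) N P"
  show "(k \<cdot>\<^bsub>grMod R\<^esub> g) \<cdot>\<^bsub>grMod R\<^esub> f = k \<cdot>\<^bsub>grMod R\<^esub> (g \<cdot>\<^bsub>grMod R\<^esub> f)"
    by (rule Hom_grMod_eqI[OF Comp[OF f Comp[OF g k]] Comp[OF Comp[OF f g] k]])
      (simp add: maps_Comp[OF f Comp[OF g k]] maps_Comp[OF Comp[OF f g] k] maps_Comp[OF f g]
        maps_Comp[OF g k] Hom_grModD(4)[OF f])
qed

global_interpretation grMod: category "grMod R" for R
  by (rule category_grMod)

text \<open>A degreewise inverse of a module map is automatically additive and linear. The inverse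
  is given explicitly so that \<open>inv_arr\<close> can later be evaluated on elements.\<close>

lemma inverse_arrows_grModI:
  assumes f: "f \<in> Hom (grMod R) M N"
    and \<beta>: "\<And>d n. n \<in> carrier (Mdeg N d) \<Longrightarrow> \<beta> d n \<in> carrier (Mdeg M d)"
    and left: "\<And>d m. m \<in> carrier (Mdeg M d) \<Longrightarrow> \<beta> d (maps f d m) = m"
    and right: "\<And>d n. n \<in> carrier (Mdeg N d) \<Longrightarrow> maps f d (\<beta> d n) = n"
  shows "inverse_arrows (grMod R) f (N, \<lambda>d. \<lambda>n\<in>carrier (Mdeg N d). \<beta> d n, M)"
proof -
  interpret M: graded_module R M using Hom_grModD(1)[OF f] .
  interpret N: graded_module R N using Hom_grModD(2)[OF f] .
  note hom = graded_module_homD[OF Hom_grModD(3)[OF f]]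
  have "graded_module_hom R N M \<beta>"
  proof (rule graded_module_homI)
    fix d m m' assume m: "m \<in> carrier (Mdeg N d)" "m' \<in> carrier (Mdeg N d)"
    then show "\<beta> d (m \<otimes>\<^bsub>Mdeg N d\<^esub> m') = \<beta> d m \<otimes>\<^bsub>Mdeg M d\<^esub> \<beta> d m'"
      using left[of "\<beta> d m \<otimes>\<^bsub>Mdeg M d\<^esub> \<beta> d m'" d] by (simp add: hom \<beta> right M.Mdeg_mult_closed)
  next
    fix d e r m assume m: "r \<in> carrier (Rdeg R d)" "m \<in> carrier (Mdeg N e)"
    then show "\<beta> (d + e) (Mact N d e r m) = Mact M d e r (\<beta> e m)"
      using left[of "Mact M d e r (\<beta> e m)" "d + e"] by (simp add: hom \<beta> right M.Mact_closed)
  qed (rule \<beta>)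
  define g where "g = (N, \<lambda>d. \<lambda>n\<in>carrier (Mdeg N d). \<beta> d n, M)"
  have g: "g \<in> Hom (grMod R) N M"
    unfolding g_def using \<open>graded_module_hom R N M \<beta>\<close>
    by (intro Hom_grModI M.graded_module_axioms N.graded_module_axioms)
  have maps_g: "n \<in> carrier (Mdeg N d) \<Longrightarrow> maps g d n = \<beta> d n" for d n
    by (simp add: g_def)
  have I: "Ident (grMod R) M \<in> Hom (grMod R) M M" "Ident (grMod R) N \<in> Hom (grMod R) N N"
    by (rule grMod.Ident_Hom, simp add: M.graded_module_axioms N.graded_module_axioms)+
  have "g \<cdot>\<^bsub>grMod R\<^esub> f = Ident (grMod R) M"
  proof (rule Hom_grMod_eqI[OF grMod.Comp_Hom[OF f g] I(1)])
    fix d m assume "m \<in> carrier (Mdeg M d)"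
    then show "maps (g \<cdot>\<^bsub>grMod R\<^esub> f) d m = maps (Ident (grMod R) M) d m"
      by (simp add: maps_Comp[OF f g] maps_g left hom(1))
  qed
  moreover have "f \<cdot>\<^bsub>grMod R\<^esub> g = Ident (grMod R) N"
  proof (rule Hom_grMod_eqI[OF grMod.Comp_Hom[OF g f] I(2)])
    fix d m assume "m \<in> carrier (Mdeg N d)"
    then show "maps (f \<cdot>\<^bsub>grMod R\<^esub> g) d m = maps (Ident (grMod R) N) d m"
      by (simp add: maps_Comp[OF g f] maps_g right)
  qed
  ultimately show ?thesis
    unfolding g_def[symmetric] by (intro grMod.inverse_arrowsI[OF f g])
qed

lemma isomorphism_grMod_bij:
  assumes "isomorphism (grMod R) f" "f \<in> Hom (grMod R) M N"
  shows "bij_betw (maps f d) (carrier (Mdeg M d)) (carrier (Mdeg N d))"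
proof -
  note i = grMod.inv_arrD[OF assms]
  show ?thesis
  proof (rule bij_betwI[where g = "maps (inv_arr (grMod R) f) d"])
    show "maps (inv_arr (grMod R) f) d (maps f d m) = m" if "m \<in> carrier (Mdeg M d)" for m
      using maps_Comp[OF assms(2) i(1) that] that by (simp add: i(2))
    show "maps f d (maps (inv_arr (grMod R) f) d m) = m" if "m \<in> carrier (Mdeg N d)" for m
      using maps_Comp[OF i(1) assms(2) that] that by (simp add: i(3))
  qed (use Hom_grModD(4)[OF assms(2)] Hom_grModD(4)[OF i(1)] in auto)
qed

section \<open>Shifts of module maps\<close>

lemma shift_functor_simps [simp]:
  "on_obj (shift_functor n) M = shift n M"
  "on_arr (shift_functor n) (M, \<alpha>, N) = (shift n M, \<lambda>d. \<alpha> (n + d), shift n N)"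
  by (simp_all add: shift_functor_def)

lemma maps_shift [simp]: "maps (on_arr (shift_functor n) f) d = maps f (n + d)"
  by (cases f) simp

lemma Mdeg_shift [simp]: "Mdeg (shift n M) d = Mdeg M (n + d)"
  by (simp add: shift_def)

text \<open>Additive maps commute with signs, hence linearity survives the twist of the action on
  source and target.\<close>

lemma shift_Hom:
  assumes "f \<in> Hom (grMod R) M N"
  shows "on_arr (shift_functor n) f \<in> Hom (grMod R) (shift n M) (shift n N)"
proof -
  interpret M: graded_module R M using Hom_grModD(1)[OF assms] .
  interpret N: graded_module R N using Hom_grModD(2)[OF assms] .
  note hom = graded_module_homD[OF Hom_grModD(3)[OF assms]]
  have signed: "maps f d (signed (Mdeg M d) k m) = signed (Mdeg N d) k (maps f d m)"
    if "m \<in> carrier (Mdeg M d)" for d k m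
    using hom that by (intro signed_hom M.Mdeg_comm_group N.Mdeg_comm_group) (auto simp: hom_def)
  have comm: "n + (d + e) = d + (n + e)" for d e by simp
  have "graded_module_hom R (shift n M) (shift n N) (\<lambda>d. maps f (n + d))"
    by (rule graded_module_homI) (simp_all add: hom shift_def comm signed M.Mact_closed)
  then show ?thesis
    using Hom_grModD[OF assms] graded_module.graded_module_shift
    by (cases f) (auto simp: Hom_grMod)
qed

section \<open>Exactness, and maps of nonzero degree\<close>

lemma exact_at_iff:
  assumes "f \<in> Hom (grMod R) L M" "g \<in> Hom (grMod R) M N"
  shows "exact_at f g \<longleftrightarrow> (\<forall>d. \<forall>m\<in>carrier (Mdeg M d).
    maps g d m = \<one>\<^bsub>Mdeg N d\<^esub> \<longleftrightarrow> (\<exists>l\<in>carrier (Mdeg L d). m = maps f d l))"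
proof -
  have "exact_at f g \<longleftrightarrow> (\<forall>d. maps f d ` carrier (Mdeg L d) = kernel (Mdeg M d) (Mdeg N d) (maps g d))"
    by (subst Hom_grModD(5)[OF assms(1)], subst Hom_grModD(5)[OF assms(2)]) (simp add: exact_at_def)
  also have "\<dots> \<longleftrightarrow> (\<forall>d. \<forall>m\<in>carrier (Mdeg M d).
      maps g d m = \<one>\<^bsub>Mdeg N d\<^esub> \<longleftrightarrow> (\<exists>l\<in>carrier (Mdeg L d). m = maps f d l))"
    using Hom_grModD(4)[OF assms(1)] unfolding kernel_def by (intro all_cong1) blast
  finally show ?thesis .
qed

text \<open>Exactness is invariant under isomorphism of three-term sequences: c reflects zero, b is
  bijective, and a is onto. It is used with vertical maps h(\<Theta>_n).\<close>

lemma exact_at_iso: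
  assumes f: "f \<in> Hom (grMod R) L M" and g: "g \<in> Hom (grMod R) M N"
    and f': "f' \<in> Hom (grMod R) L' M'" and g': "g' \<in> Hom (grMod R) M' N'"
    and a: "a \<in> Hom (grMod R) L L'" "isomorphism (grMod R) a"
    and b: "b \<in> Hom (grMod R) M M'" "isomorphism (grMod R) b"
    and c: "c \<in> Hom (grMod R) N N'" "isomorphism (grMod R) c"
    and sq: "b \<cdot>\<^bsub>grMod R\<^esub> f = f' \<cdot>\<^bsub>grMod R\<^esub> a" "c \<cdot>\<^bsub>grMod R\<^esub> g = g' \<cdot>\<^bsub>grMod R\<^esub> b"
    and exact: "exact_at f g"
  shows "exact_at f' g'"
  unfolding exact_at_iff[OF f' g']
proof (intro allI ballI)
  fix d m' assume m': "m' \<in> carrier (Mdeg M' d)"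
  note bij = isomorphism_grMod_bij[OF a(2,1), of d] isomorphism_grMod_bij[OF b(2,1), of d]
    isomorphism_grMod_bij[OF c(2,1), of d]
  obtain m where m: "m \<in> carrier (Mdeg M d)" "m' = maps b d m"
    using m' bij(2) unfolding bij_betw_def by blast
  note cl = Hom_grModD(4)
  have one: "maps c d \<one>\<^bsub>Mdeg N d\<^esub> = \<one>\<^bsub>Mdeg N' d\<^esub>"
    using Hom_grModD(1-3)[OF c(1)]
    by (intro group_hom.hom_one comm_group_hom) (auto simp: graded_module_hom_def graded_module.Mdeg_comm_group)
  have "\<one>\<^bsub>Mdeg N d\<^esub> \<in> carrier (Mdeg N d)"
    using graded_module.Mdeg_comm_group[OF Hom_grModD(1)[OF c(1)]]
      monoid.one_closed[OF comm_group.axioms(1)[THEN comm_monoid.axioms(1)]] by blast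
  moreover have "maps g' d m' = maps c d (maps g d m)"
    using maps_Comp[OF g c(1) m(1)] maps_Comp[OF b(1) g' m(1)] sq(2) m(2) by simp
  ultimately have "maps g' d m' = \<one>\<^bsub>Mdeg N' d\<^esub> \<longleftrightarrow> maps g d m = \<one>\<^bsub>Mdeg N d\<^esub>"
    using bij(3) cl[OF g m(1)] one unfolding bij_betw_def by (metis inj_onD)
  also have "\<dots> \<longleftrightarrow> (\<exists>l\<in>carrier (Mdeg L d). m = maps f d l)"
    using exact m(1) unfolding exact_at_iff[OF f g] by blast
  also have "\<dots> \<longleftrightarrow> (\<exists>l\<in>carrier (Mdeg L d). m' = maps f' d (maps a d l))"
  proof (intro bex_cong refl)
    fix l assume l: "l \<in> carrier (Mdeg L d)"
    have "maps f' d (maps a d l) = maps b d (maps f d l)"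
      using maps_Comp[OF f b(1) l] maps_Comp[OF a(1) f' l] sq(1) by simp
    then show "m = maps f d l \<longleftrightarrow> m' = maps f' d (maps a d l)"
      using bij(2) cl[OF f l] m unfolding bij_betw_def by (metis inj_onD)
  qed
  also have "\<dots> \<longleftrightarrow> (\<exists>l\<in>carrier (Mdeg L' d). m' = maps f' d l)"
    using bij_betw_imp_surj_on[OF bij(1)] by (metis (no_types, lifting) imageE imageI)
  finally show "maps g' d m' = \<one>\<^bsub>Mdeg N' d\<^esub> \<longleftrightarrow> (\<exists>l\<in>carrier (Mdeg L' d). m' = maps f' d l)" .
qed

text \<open>A map M[-d] -> N, reindexed by k |-> d + k, becomes a map M -> N[d]: for a scalar of
  degree e the sign (-1)^{-de} on the source and the sign (-1)^{de} on the target cancel. This is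
  the passage from h(u) to a degree d map in \<open>graded_Hom\<close>.\<close>

lemma shift_adjoint_Arr:
  assumes "c \<in> Hom (grMod R) (shift (- d) M) N" "graded_module R M"
  shows "(M, \<lambda>k. maps c (d + k), shift d N) \<in> Arr (grMod R)"
proof -
  interpret M: graded_module R M by fact
  interpret N: graded_module R N using Hom_grModD(2)[OF assms(1)] .
  note hom = graded_module_homD[OF Hom_grModD(3)[OF assms(1)], simplified]
  have "graded_module_hom R M (shift d N) (\<lambda>k. maps c (d + k))"
  proof (rule graded_module_homI)
    fix e k r m assume r: "r \<in> carrier (Rdeg R e)" and m: "m \<in> carrier (Mdeg M k)"
    have act: "Mact (shift (- d) M) e (d + k) r m = signed (Mdeg M (e + k)) (- d * e) (Mact M e k r m)"
      by (simp add: shift_def)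
    have s: "maps c (d + (e + k)) (signed (Mdeg M (e + k)) n x) =
        signed (Mdeg N (d + (e + k))) n (maps c (d + (e + k)) x)" if "x \<in> carrier (Mdeg M (e + k))" for n x
      using hom(1,2)[of _ "d + (e + k)"] that
      by (intro signed_hom M.Mdeg_comm_group N.Mdeg_comm_group) (auto simp: hom_def)
    have x: "Mact M e k r m \<in> carrier (Mdeg M (e + k))"
      using r m by (rule M.Mact_closed)
    let ?s = "signed (Mdeg N (d + (e + k)))" and ?y = "maps c (d + (e + k)) (Mact M e k r m)"
    have y: "?y \<in> carrier (Mdeg N (d + (e + k)))"
      using hom(1)[of "Mact M e k r m" "d + (e + k)"] x by simp
    have eq: "Mact N e (d + k) r (maps c (d + k) m) = ?s (- d * e) ?y"
      using hom(3)[of r e m "d + k"] r m s[OF x]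
      by (simp add: act add.left_commute[of e d k])
    \<comment> \<open>Applying the target sign cancels the source sign, the total exponent being d e
      - d e.\<close>
    have "?s (d * e) (Mact N e (d + k) r (maps c (d + k) m)) = ?y"
      unfolding eq using y by (simp add: signed_signed[OF N.Mdeg_comm_group])
    then show "maps c (d + (e + k)) (Mact M e k r m) = Mact (shift d N) e k r (maps c (d + k) m)"
      by (simp add: shift_def)
  next
    fix k m m' assume "m \<in> carrier (Mdeg M k)" "m' \<in> carrier (Mdeg M k)"
    then show "maps c (d + k) m \<in> carrier (Mdeg (shift d N) k)"
      and "maps c (d + k) (m \<otimes>\<^bsub>Mdeg M k\<^esub> m') = maps c (d + k) m \<otimes>\<^bsub>Mdeg (shift d N) k\<^esub> maps c (d + k) m'"
      using hom(1)[of m "d + k"] hom(2)[of m "d + k" m'] by simp_all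
  qed
  then have "(M, \<lambda>k. maps c (d + k), shift d N) \<in> Hom (grMod R) M (shift d N)"
    using Hom_grModD(6)[OF assms(1), of "d + _"] N.graded_module_shift assms(2)
    by (simp add: Hom_grMod)
  then show ?thesis by (rule grMod.HomD)
qed

section \<open>The functors \<open>Ext(-, Z)\<close>\<close>

lemma Ext_simps [simp]:
  "Mdeg (Ext T \<phi> X Y) d = Hom_group T X (\<sigma>o T d Y)"
  "Mact (Ext T \<phi> X Y) d e r f = \<phi> d r (\<sigma>o T e Y) \<cdot>\<^bsub>T\<^esub> f"
  by (simp_all add: Ext_def)

context graded_linear_category
begin

lemma structure_hom_closed:
  assumes "r \<in> carrier (Rdeg R d)"
  shows "\<phi> d r \<in> carrier (Rdeg (graded_center T) d)"
  using structure_hom assms by (auto simp: graded_ring_hom_def hom_def)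

lemma center_Hom: "\<lbrakk>r \<in> carrier (Rdeg R d); X \<in> Obj T\<rbrakk> \<Longrightarrow> \<phi> d r X \<in> Hom T X (\<sigma>o T d X)"
  using structure_hom_closed[of r d]
  by (simp add: graded_center_def natural_transformation_def id_functor_def)

lemma center_natural:
  assumes "r \<in> carrier (Rdeg R d)" "f \<in> Hom T X Y"
  shows "\<phi> d r Y \<cdot>\<^bsub>T\<^esub> f = \<sigma>a T d f \<cdot>\<^bsub>T\<^esub> \<phi> d r X"
  using structure_hom_closed[OF assms(1)] assms(2) HomD[OF assms(2)]
  by (simp add: graded_center_def natural_transformation_def id_functor_def)

lemma center_Susp:
  assumes "r \<in> carrier (Rdeg R d)" "X \<in> Obj T"
  shows "\<phi> d r (on_obj (Susp T) X) =
    signed (Hom_group T (on_obj (Susp T) X) (\<sigma>o T d (on_obj (Susp T) X))) d (on_arr (Susp T) (\<phi> d r X))"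
  using structure_hom_closed[OF assms(1)] assms(2) by (simp add: graded_center_def)

lemma center_add:
  assumes "r \<in> carrier (Rdeg R d)" "s \<in> carrier (Rdeg R d)" "X \<in> Obj T"
  shows "\<phi> d (r \<otimes>\<^bsub>Rdeg R d\<^esub> s) X = Plus T (\<phi> d r X) (\<phi> d s X)"
  using structure_hom assms by (simp add: graded_ring_hom_def hom_def graded_center_def)

lemma center_mult:
  assumes "r \<in> carrier (Rdeg R d)" "s \<in> carrier (Rdeg R e)" "X \<in> Obj T"
  shows "\<phi> (d + e) (Rmult R d e r s) X = \<phi> d r (\<sigma>o T e X) \<cdot>\<^bsub>T\<^esub> \<phi> e s X"
  using structure_hom assms by (simp add: graded_ring_hom_def graded_center_def)

lemma center_one: "X \<in> Obj T \<Longrightarrow> \<phi> 0 (Rone R) X = Ident T X"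
  using structure_hom by (simp add: graded_ring_hom_def graded_center_def)

text \<open>Each suspension contributes (-1)^d, so n of them give (-1)^{nd}. For negative n the step
  is read backwards. The exponent is that of the action on a shift by n, which is why \<Sigma>^{-n}
  can be linear in \<open>Ext_shift\<close>.\<close>

lemma center_Susp_pow:
  assumes r: "r \<in> carrier (Rdeg R d)" and X: "X \<in> Obj T"
  shows "\<phi> d r (\<sigma>o T n X) =
    signed (Hom_group T (\<sigma>o T n X) (\<sigma>o T (n + d) X)) (n * d) (\<sigma>a T n (\<phi> d r X))"
proof (induct n rule: int_iff_induct)
  case (step n)
  let ?H = "Hom_group T (\<sigma>o T n X) (\<sigma>o T (n + d) X)"
    and ?H' = "Hom_group T (\<sigma>o T (n + 1) X) (\<sigma>o T (n + 1 + d) X)"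
  let ?a = "\<phi> d r (\<sigma>o T n X)" and ?b = "signed ?H (n * d) (\<sigma>a T n (\<phi> d r X))"
  note nX = Susp_pow_Obj[OF X]
  have f: "\<sigma>a T n (\<phi> d r X) \<in> Hom T (\<sigma>o T n X) (\<sigma>o T (n + d) X)"
    using Susp_pow_Hom[OF center_Hom[OF r X]] X by (simp add: Susp_pow_add)
  then have b: "?b \<in> Hom T (\<sigma>o T n X) (\<sigma>o T (n + d) X)"
    by (simp add: nX Hom_group_closed)
  have a: "?a \<in> Hom T (\<sigma>o T n X) (\<sigma>o T (n + d) X)"
    using center_Hom[OF r nX] X by (simp add: Susp_pow_add add.commute[of n d])
  have S: "on_obj (Susp T) (\<sigma>o T m X) = \<sigma>o T (m + 1) X" for m
    using X by (simp add: Susp_pow_Suc)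
  have SH: "on_arr (Susp T) g \<in> Hom T (\<sigma>o T (n + 1) X) (\<sigma>o T (n + 1 + d) X)"
    if "g \<in> Hom T (\<sigma>o T n X) (\<sigma>o T (n + d) X)" for g
    using Susp.on_arr[OF that] by (simp add: S ac_simps)
  have H': "comm_group ?H'" using Hom_comm_group nX by blast
  have "\<phi> d r (\<sigma>o T (n + 1) X) = signed ?H' d (on_arr (Susp T) ?a)"
    using center_Susp[OF r nX[of n]] X by (simp add: S Susp_pow_add ac_simps)
  moreover have "signed ?H' ((n + 1) * d) (\<sigma>a T (n + 1) (\<phi> d r X)) = signed ?H' d (on_arr (Susp T) ?b)"
  proof -
    have "on_arr (Susp T) ?b = signed ?H' (n * d) (on_arr (Susp T) (\<sigma>a T n (\<phi> d r X)))"
      using Susp_pow_signed[OF f, where n = 1] by (simp add: S ac_simps)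
    moreover have "on_arr (Susp T) (\<sigma>a T n (\<phi> d r X)) = \<sigma>a T (n + 1) (\<phi> d r X)"
      using HomD(1)[OF center_Hom[OF r X]] by (simp add: Susp_pow_Suc)
    ultimately show ?thesis
      using SH[OF f] signed_signed[OF H'] by (simp add: distrib_right add.commute)
  qed
  \<comment> \<open>The descending direction: a sign applied twice disappears, and \<Sigma> is
    injective on arrows.\<close>
  moreover have "signed ?H' d (on_arr (Susp T) ?a) = signed ?H' d (on_arr (Susp T) ?b) \<longleftrightarrow> ?a = ?b"
  proof
    assume "signed ?H' d (on_arr (Susp T) ?a) = signed ?H' d (on_arr (Susp T) ?b)"
    then have "signed ?H' d (signed ?H' d (on_arr (Susp T) ?a)) =
        signed ?H' d (signed ?H' d (on_arr (Susp T) ?b))"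
      by simp
    then have "on_arr (Susp T) ?a = on_arr (Susp T) ?b"
      using SH[OF a] SH[OF b] by (simp add: signed_signed[OF H'])
    then show "?a = ?b"
      using HomD(1)[OF a] HomD(1)[OF b] by (rule Susp_inj[rotated 2])
  qed simp
  ultimately show ?case by simp
qed simp

text \<open>The product of the graded center is arranged so that associativity of the action is
  associativity of composition. The remaining axioms are biadditivity of composition and
  \<open>center_one\<close>.\<close>

lemma graded_module_Ext:
  assumes X: "X \<in> Obj T" and Y: "Y \<in> Obj T"
  shows "graded_module R (Ext T \<phi> X Y)"
proof (intro graded_module.intro graded_module_axioms.intro graded_ring_axioms)
  fix d e k r r' s m m'
  note nY = Susp_pow_Obj[OF Y]
  have c: "\<phi> d r (\<sigma>o T e Y) \<in> Hom T (\<sigma>o T e Y) (\<sigma>o T (d + e) Y)"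
    if "r \<in> carrier (Rdeg R d)" for d e r
    using center_Hom[OF that nY] Y by (simp add: Susp_pow_add)
  show "comm_group (Mdeg (Ext T \<phi> X Y) d)"
    using Hom_comm_group[OF X nY] by simp
  show "Mact (Ext T \<phi> X Y) d e r m \<in> carrier (Mdeg (Ext T \<phi> X Y) (d + e))"
    if "r \<in> carrier (Rdeg R d)" "m \<in> carrier (Mdeg (Ext T \<phi> X Y) e)"
    using Comp_Hom[OF _ c] that by simp
  show "Mact (Ext T \<phi> X Y) d e (r \<otimes>\<^bsub>Rdeg R d\<^esub> r') m =
      Mact (Ext T \<phi> X Y) d e r m \<otimes>\<^bsub>Mdeg (Ext T \<phi> X Y) (d + e)\<^esub> Mact (Ext T \<phi> X Y) d e r' m"
    if "r \<in> carrier (Rdeg R d)" "r' \<in> carrier (Rdeg R d)" "m \<in> carrier (Mdeg (Ext T \<phi> X Y) e)"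
    using that Comp_Plus_left[OF _ c c, of m X e r d r'] by (simp add: center_add nY)
  show "Mact (Ext T \<phi> X Y) d e r (m \<otimes>\<^bsub>Mdeg (Ext T \<phi> X Y) e\<^esub> m') =
      Mact (Ext T \<phi> X Y) d e r m \<otimes>\<^bsub>Mdeg (Ext T \<phi> X Y) (d + e)\<^esub> Mact (Ext T \<phi> X Y) d e r m'"
    if "r \<in> carrier (Rdeg R d)" "m \<in> carrier (Mdeg (Ext T \<phi> X Y) e)" "m' \<in> carrier (Mdeg (Ext T \<phi> X Y) e)"
    using that Comp_Plus_right[OF _ _ c, of m X e m' r d] by simp
  show "Mact (Ext T \<phi> X Y) (d + e) k (Rmult R d e r s) m =
      Mact (Ext T \<phi> X Y) d (e + k) r (Mact (Ext T \<phi> X Y) e k s m)"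
    if "r \<in> carrier (Rdeg R d)" "s \<in> carrier (Rdeg R e)" "m \<in> carrier (Mdeg (Ext T \<phi> X Y) k)"
    using that Comp_assoc[OF _ c c, of m X k s e r d] Y by (simp add: center_mult nY Susp_pow_add)
  show "Mact (Ext T \<phi> X Y) 0 d (Rone R) m = m" if "m \<in> carrier (Mdeg (Ext T \<phi> X Y) d)"
    using that by (simp add: center_one nY Ident_left)
qed

lemma Ext_functor_simps [simp]:
  "on_obj (Ext_functor T \<phi> Z) X = Ext T \<phi> X Z"
  "g \<in> Hom T (Cod T f) (\<sigma>o T d Z) \<Longrightarrow> maps (on_arr (Ext_functor T \<phi> Z) f) d g = g \<cdot>\<^bsub>T\<^esub> f"
  by (simp_all add: Ext_functor_def maps_def)

lemma Ext_functor_Hom: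
  assumes f: "f \<in> Hom T X Y" and Z: "Z \<in> Obj T"
  shows "on_arr (Ext_functor T \<phi> Z) f \<in> Hom (grMod R) (Ext T \<phi> Y Z) (Ext T \<phi> X Z)"
proof -
  note O = HomD(4,5)[OF f]
  have "graded_module_hom R (Ext T \<phi> Y Z) (Ext T \<phi> X Z) (\<lambda>d g. g \<cdot>\<^bsub>T\<^esub> f)"
  proof (rule graded_module_homI)
    fix d e r m assume r: "r \<in> carrier (Rdeg R d)" and m: "m \<in> carrier (Mdeg (Ext T \<phi> Y Z) e)"
    then show "Mact (Ext T \<phi> Y Z) d e r m \<cdot>\<^bsub>T\<^esub> f = Mact (Ext T \<phi> X Z) d e r (m \<cdot>\<^bsub>T\<^esub> f)"
      using Comp_assoc[OF f _ center_Hom[OF r Susp_pow_Obj[OF Z]]] by simp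
  qed (auto simp: Comp_Plus_left[OF f] intro: Comp_Hom[OF f])
  from Hom_grModI[OF graded_module_Ext[OF O(2) Z] graded_module_Ext[OF O(1) Z] this]
  show ?thesis
    using HomD(2,3)[OF f] by (simp add: Ext_functor_def)
qed

lemma maps_Ext_functor:
  assumes "f \<in> Hom T X Y" "g \<in> Hom T Y (\<sigma>o T d Z)"
  shows "maps (on_arr (Ext_functor T \<phi> Z) f) d g = g \<cdot>\<^bsub>T\<^esub> f"
  using assms HomD(3)[OF assms(1)] by simp

lemma cfunctor_Ext:
  assumes Z: "Z \<in> Obj T"
  shows "cfunctor (opposite T) (grMod R) (Ext_functor T \<phi> Z)"
proof (intro cfunctor.intro cfunctor_axioms.intro category_opposite category_grMod)
  fix X assume X: "X \<in> Obj (opposite T)"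
  then show "on_obj (Ext_functor T \<phi> Z) X \<in> Obj (grMod R)"
    by (simp add: graded_module_Ext Z)
  have I: "Ident T X \<in> Hom T X X"
    using X Ident_Hom by simp
  show "on_arr (Ext_functor T \<phi> Z) (Ident (opposite T) X) = Ident (grMod R) (on_obj (Ext_functor T \<phi> Z) X)"
    using X Ext_functor_Hom[OF I Z] grMod.Ident_Hom[of "Ext T \<phi> X Z" R]
    by (intro Hom_grMod_eqI[of _ R "Ext T \<phi> X Z" "Ext T \<phi> X Z"])
      (simp_all add: graded_module_Ext Z maps_Ext_functor[OF I] Ident_right)
next
  fix f X Y assume "f \<in> Hom (opposite T) X Y"
  then show "on_arr (Ext_functor T \<phi> Z) f \<in> Hom (grMod R) (on_obj (Ext_functor T \<phi> Z) X) (on_obj (Ext_functor T \<phi> Z) Y)"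
    by (simp add: Ext_functor_Hom Z)
next
  fix f X Y g W assume fg: "f \<in> Hom (opposite T) X Y" "g \<in> Hom (opposite T) Y W"
  then have f: "f \<in> Hom T Y X" and g: "g \<in> Hom T W Y" by simp_all
  note F = Ext_functor_Hom[OF f Z] and G = Ext_functor_Hom[OF g Z]
  show "on_arr (Ext_functor T \<phi> Z) (g \<cdot>\<^bsub>opposite T\<^esub> f) =
      on_arr (Ext_functor T \<phi> Z) g \<cdot>\<^bsub>grMod R\<^esub> on_arr (Ext_functor T \<phi> Z) f"
  proof (rule Hom_grMod_eqI)
    show "on_arr (Ext_functor T \<phi> Z) (g \<cdot>\<^bsub>opposite T\<^esub> f) \<in> Hom (grMod R) (Ext T \<phi> X Z) (Ext T \<phi> W Z)"
      using Ext_functor_Hom[OF Comp_Hom[OF g f] Z] by simp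
    fix d m assume "m \<in> carrier (Mdeg (Ext T \<phi> X Z) d)"
    then have m: "m \<in> Hom T X (\<sigma>o T d Z)" by simp
    show "maps (on_arr (Ext_functor T \<phi> Z) (g \<cdot>\<^bsub>opposite T\<^esub> f)) d m =
      maps (on_arr (Ext_functor T \<phi> Z) g \<cdot>\<^bsub>grMod R\<^esub> on_arr (Ext_functor T \<phi> Z) f) d m"
      using m Comp_assoc[OF g f m]
      by (simp add: maps_Comp[OF F G] maps_Ext_functor[OF Comp_Hom[OF g f]] maps_Ext_functor[OF f]
          maps_Ext_functor[OF g Comp_Hom[OF f]])
  qed (rule grMod.Comp_Hom[OF F G])
qed

lemma maps_Ext_shift:
  "g \<in> Hom T (\<sigma>o T n Y) (\<sigma>o T d Z) \<Longrightarrow> maps (Ext_shift T \<phi> Z n Y) d g = \<sigma>a T (- n) g"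
  by (simp add: Ext_shift_def)

text \<open>For r of degree d, \<Sigma>^{-n} carries the central map at \<Sigma>^e Z to the one at
  \<Sigma>^{-n+e} Z up to (-1)^{-nd}. Exactly this sign is built into the action on the module
  shifted by -n, so desuspension is linear.\<close>

lemma Ext_shift_Hom:
  assumes Y: "Y \<in> Obj T" and Z: "Z \<in> Obj T"
  shows "Ext_shift T \<phi> Z n Y \<in> Hom (grMod R) (Ext T \<phi> (\<sigma>o T n Y) Z) (shift (- n) (Ext T \<phi> Y Z))"
proof -
  note nY = Susp_pow_Obj[OF Y] and nZ = Susp_pow_Obj[OF Z]
  have H: "\<sigma>a T (- n) m \<in> Hom T Y (\<sigma>o T (- n + d) Z)" if "m \<in> Hom T (\<sigma>o T n Y) (\<sigma>o T d Z)" for d m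
    using Susp_pow_Hom[OF that, of "- n"] Y Z by (simp add: Susp_pow_add)
  have "graded_module_hom R (Ext T \<phi> (\<sigma>o T n Y) Z) (shift (- n) (Ext T \<phi> Y Z)) (\<lambda>d. \<sigma>a T (- n))"
  proof (rule graded_module_homI)
    fix d e r m assume r: "r \<in> carrier (Rdeg R d)" and "m \<in> carrier (Mdeg (Ext T \<phi> (\<sigma>o T n Y) Z) e)"
    then have m: "m \<in> Hom T (\<sigma>o T n Y) (\<sigma>o T e Z)" by simp
    have r': "\<phi> d r (\<sigma>o T e Z) \<in> Hom T (\<sigma>o T e Z) (\<sigma>o T (d + e) Z)"
      using center_Hom[OF r nZ] Z by (simp add: Susp_pow_add)
    let ?x = "\<sigma>a T (- n) (\<phi> d r (\<sigma>o T e Z))" and ?m = "\<sigma>a T (- n) m"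
    have x: "?x \<in> Hom T (\<sigma>o T (- n + e) Z) (\<sigma>o T (- n + (d + e)) Z)"
      using Susp_pow_Hom[OF r', of "- n"] Z by (simp add: Susp_pow_add)
    have "\<phi> d r (\<sigma>o T (- n + e) Z) =
        signed (Hom_group T (\<sigma>o T (- n + e) Z) (\<sigma>o T (- n + (d + e)) Z)) (- n * d) ?x"
      using center_Susp_pow[OF r nZ, of "- n" e] Z
      by (simp add: Susp_pow_add add.assoc del: uminus_add_conv_diff)
    then have "\<phi> d r (\<sigma>o T (- n + e) Z) \<cdot>\<^bsub>T\<^esub> ?m =
        signed (Hom_group T Y (\<sigma>o T (- n + (d + e)) Z)) (- n * d) (?x \<cdot>\<^bsub>T\<^esub> ?m)"
      by (simp only: signed_Comp[OF H[OF m] x])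
    then have "signed (Hom_group T Y (\<sigma>o T (- n + (d + e)) Z)) (- n * d) (\<phi> d r (\<sigma>o T (- n + e) Z) \<cdot>\<^bsub>T\<^esub> ?m)
        = ?x \<cdot>\<^bsub>T\<^esub> ?m"
      using Comp_Hom[OF H[OF m] x] signed_signed[OF Hom_comm_group[OF Y nZ]] by simp
    also have "\<dots> = \<sigma>a T (- n) (\<phi> d r (\<sigma>o T e Z) \<cdot>\<^bsub>T\<^esub> m)"
      using Susp_pow_Comp[OF m r'] by simp
    finally show "\<sigma>a T (- n) (Mact (Ext T \<phi> (\<sigma>o T n Y) Z) d e r m) =
        Mact (shift (- n) (Ext T \<phi> Y Z)) d e r (\<sigma>a T (- n) m)"
      by (simp add: shift_def)
  qed (use H in \<open>auto simp: Susp_pow_Plus\<close>)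
  from Hom_grModI[OF graded_module_Ext[OF nY Z]
      graded_module.graded_module_shift[OF graded_module_Ext[OF Y Z]] this]
  show ?thesis by (simp add: Ext_shift_def)
qed

text \<open>The inverse of \<Sigma>^{-n} is \<Sigma>^n in every degree; this explicit form evaluates
  \<open>inv_arr\<close> in the linearity condition.\<close>

lemma Ext_shift_inverse:
  assumes Y: "Y \<in> Obj T" and Z: "Z \<in> Obj T"
  shows "inverse_arrows (grMod R) (Ext_shift T \<phi> Z n Y)
    (shift (- n) (Ext T \<phi> Y Z), \<lambda>d. \<lambda>g\<in>Hom T Y (\<sigma>o T (- n + d) Z). \<sigma>a T n g, Ext T \<phi> (\<sigma>o T n Y) Z)"
proof -
  have H: "\<sigma>a T (- n) m \<in> Hom T Y (\<sigma>o T (- n + d) Z)" if "m \<in> Hom T (\<sigma>o T n Y) (\<sigma>o T d Z)" for d m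
    using Susp_pow_Hom[OF that, of "- n"] Y Z by (simp add: Susp_pow_add)
  have H': "\<sigma>a T n m \<in> Hom T (\<sigma>o T n Y) (\<sigma>o T d Z)" if "m \<in> Hom T Y (\<sigma>o T (- n + d) Z)" for d m
    using Susp_pow_Hom[OF that, of n] Y Z by (simp add: Susp_pow_add)
  show ?thesis
    using inverse_arrows_grModI[OF Ext_shift_Hom[OF Y Z, of n], of "\<lambda>d. \<sigma>a T n"] H H'
    by (simp add: maps_Ext_shift Susp_pow_add HomD(1))
qed

text \<open>Coherence of the identifications is the law for \<Sigma>^{-a-b}. Linearity holds because
  u of degree d induces m |-> \<Sigma>^d m . u, and central elements slide past \<Sigma>^d m by
  naturality.\<close>

lemma graded_linear_Ext_functor:
  assumes Z: "Z \<in> Obj T"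
  shows "graded_linear_mod_functor R T \<phi> (Ext_functor T \<phi> Z) (Ext_shift T \<phi> Z)"
  unfolding graded_linear_mod_functor_def
proof (intro conjI allI ballI)
  let ?h = "Ext_functor T \<phi> Z" and ?i = "Ext_shift T \<phi> Z"
  show "cfunctor (opposite T) (grMod R) ?h"
    using Z by (rule cfunctor_Ext)
  show "natural_isomorphism (opposite T) (grMod R) (?h \<circ>\<^sub>F Susp_pow T n) (shift_functor (- n) \<circ>\<^sub>F ?h) (?i n)" for n
    unfolding natural_isomorphism_def natural_transformation_def
  proof (intro conjI ballI)
    fix Y assume "Y \<in> Obj (opposite T)"
    then have Y: "Y \<in> Obj T" by simp
    show "?i n Y \<in> Hom (grMod R) (on_obj (?h \<circ>\<^sub>F Susp_pow T n) Y) (on_obj (shift_functor (- n) \<circ>\<^sub>F ?h) Y)"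
      using Ext_shift_Hom[OF Y Z] by simp
    show "isomorphism (grMod R) (?i n Y)"
      using Ext_shift_inverse[OF Y Z] by (auto simp: isomorphism_def)
  next
    fix X Y f assume "f \<in> Hom (opposite T) X Y"
    then have f: "f \<in> Hom T Y X" by simp
    note O = HomD(4,5)[OF f]
    note i = Ext_shift_Hom[OF O(1) Z, of n] Ext_shift_Hom[OF O(2) Z, of n]
    note hf = Ext_functor_Hom[OF Susp_pow_Hom[OF f] Z, of n] shift_Hom[OF Ext_functor_Hom[OF f Z], of "- n"]
    show "?i n Y \<cdot>\<^bsub>grMod R\<^esub> on_arr (?h \<circ>\<^sub>F Susp_pow T n) f =
        on_arr (shift_functor (- n) \<circ>\<^sub>F ?h) f \<cdot>\<^bsub>grMod R\<^esub> ?i n X"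
    proof (rule Hom_grMod_eqI)
      fix d m assume "m \<in> carrier (Mdeg (Ext T \<phi> (\<sigma>o T n X) Z) d)"
      then have m: "m \<in> Hom T (\<sigma>o T n X) (\<sigma>o T d Z)" by simp
      have m': "\<sigma>a T (- n) m \<in> Hom T X (\<sigma>o T (- n + d) Z)"
        using Susp_pow_Hom[OF m, of "- n"] O Z by (simp add: Susp_pow_add)
      have "\<sigma>a T (- n) (m \<cdot>\<^bsub>T\<^esub> \<sigma>a T n f) = \<sigma>a T (- n) m \<cdot>\<^bsub>T\<^esub> f"
        using Susp_pow_Comp[OF Susp_pow_Hom[OF f] m, of "- n"] HomD(1)[OF f] by (simp add: Susp_pow_add)
      then show "maps (?i n Y \<cdot>\<^bsub>grMod R\<^esub> on_arr (?h \<circ>\<^sub>F Susp_pow T n) f) d m =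
          maps (on_arr (shift_functor (- n) \<circ>\<^sub>F ?h) f \<cdot>\<^bsub>grMod R\<^esub> ?i n X) d m"
        using m m' Comp_Hom[OF Susp_pow_Hom[OF f, of n] m]
        by (simp add: maps_Comp[OF hf(1) i(1)] maps_Comp[OF i(2) hf(2)] maps_Ext_shift
            maps_Ext_functor[OF f] maps_Ext_functor[OF Susp_pow_Hom[OF f]])
    qed (use grMod.Comp_Hom[OF hf(1) i(1)] grMod.Comp_Hom[OF i(2) hf(2)] in simp_all)
  qed
next
  fix a b X d m assume X: "X \<in> Obj T"
    and m: "m \<in> carrier (Mdeg (on_obj (Ext_functor T \<phi> Z) (\<sigma>o T (a + b) X)) d)"
  \<comment> \<open>The two Hom sets coincide because \<Sigma>^a \<Sigma>^b X and \<Sigma>^{a+b} X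
    are equal objects, not merely isomorphic ones.\<close>
  have m1: "m \<in> Hom T (\<sigma>o T a (\<sigma>o T b X)) (\<sigma>o T d Z)" "m \<in> Hom T (\<sigma>o T (a + b) X) (\<sigma>o T d Z)"
    using m X by (simp_all add: Susp_pow_add)
  have m2: "\<sigma>a T (- a) m \<in> Hom T (\<sigma>o T b X) (\<sigma>o T (- a + d) Z)"
    using Susp_pow_Hom[OF m1(2), of "- a"] X Z by (simp add: Susp_pow_add)
  show "maps (Ext_shift T \<phi> Z (a + b) X) d m =
      maps (Ext_shift T \<phi> Z b X) (- a + d) (maps (Ext_shift T \<phi> Z a (\<sigma>o T b X)) d m)"
    using Susp_pow_add(2)[OF HomD(1)[OF m1(1)], of "- b" "- a"]
    by (simp only: maps_Ext_shift[OF m1(1)] maps_Ext_shift[OF m1(2)] maps_Ext_shift[OF m2]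
        minus_add_distrib add.commute[of "- b" "- a"])
next
  fix X Y assume X: "X \<in> Obj T" and Y: "Y \<in> Obj T"
  interpret E: graded_module R "Ext T \<phi> X Y" using graded_module_Ext[OF X Y] .
  note nY = Susp_pow_Obj[OF Y] and nZ = Susp_pow_Obj[OF Z]
  let ?c = "\<lambda>d u. on_arr (Ext_functor T \<phi> Z) u \<cdot>\<^bsub>grMod R\<^esub> inv_arr (grMod R) (Ext_shift T \<phi> Z d Y)"
  let ?G = "graded_Hom R (Ext T \<phi> Y Z) (Ext T \<phi> X Z)"
  \<comment> \<open>The degree d map of u made explicit: undoing the identification applies
    \<Sigma>^d, and the functor then precomposes with u.\<close>
  let ?f = "\<lambda>d u k. \<lambda>m\<in>Hom T Y (\<sigma>o T k Z). \<sigma>a T d m \<cdot>\<^bsub>T\<^esub> u"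
  have H: "\<sigma>a T d m \<in> Hom T (\<sigma>o T d Y) (\<sigma>o T (d + k) Z)" if "m \<in> Hom T Y (\<sigma>o T k Z)" for d k m
    using Susp_pow_Hom[OF that, of d] Z by (simp add: Susp_pow_add)
  have c: "(\<lambda>k. maps (?c d u) (d + k)) = ?f d u" "?f d u \<in> carrier (Mdeg ?G d)"
    if u: "u \<in> Hom T X (\<sigma>o T d Y)" for d u
  proof -
    have inv: "inv_arr (grMod R) (Ext_shift T \<phi> Z d Y) \<in>
        Hom (grMod R) (shift (- d) (Ext T \<phi> Y Z)) (Ext T \<phi> (\<sigma>o T d Y) Z)"
      using grMod.inverse_arrowsD(1)[OF Ext_shift_inverse[OF Y Z, of d] Ext_shift_Hom[OF Y Z, of d]]
        grMod.inv_arr_eq[OF Ext_shift_inverse[OF Y Z, of d]] by simp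
    note comp = grMod.Comp_Hom[OF inv Ext_functor_Hom[OF u Z]]
    have "maps (?c d u) (d + k) = ?f d u k" for k
    proof (rule extensionalityI)
      show "maps (?c d u) (d + k) \<in> extensional (Hom T Y (\<sigma>o T k Z))"
        using Hom_grModD(6)[OF comp, of "d + k"] by simp
      fix m assume m: "m \<in> Hom T Y (\<sigma>o T k Z)"
      then show "maps (?c d u) (d + k) m = ?f d u k m"
        using H[OF m] maps_Comp[OF inv Ext_functor_Hom[OF u Z], of m "d + k"]
        by (simp add: grMod.inv_arr_eq[OF Ext_shift_inverse[OF Y Z]] maps_Ext_functor[OF u])
    qed simp
    then show eq: "(\<lambda>k. maps (?c d u) (d + k)) = ?f d u" by (rule ext)
    show "?f d u \<in> carrier (Mdeg ?G d)"
      using shift_adjoint_Arr[OF comp graded_module_Ext[OF Y Z]]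
      unfolding eq by (simp add: graded_Hom_def)
  qed
  have "graded_module_hom R (Ext T \<phi> X Y) ?G ?f"
  proof (rule graded_module_homI)
    fix d u assume "u \<in> carrier (Mdeg (Ext T \<phi> X Y) d)"
    then show "?f d u \<in> carrier (Mdeg ?G d)"
      using c(2) by simp
  next
    fix d u u' assume "u \<in> carrier (Mdeg (Ext T \<phi> X Y) d)" "u' \<in> carrier (Mdeg (Ext T \<phi> X Y) d)"
    then show "?f d (u \<otimes>\<^bsub>Mdeg (Ext T \<phi> X Y) d\<^esub> u') = ?f d u \<otimes>\<^bsub>Mdeg ?G d\<^esub> ?f d u'"
      using Comp_Plus_right[OF _ _ H] by (auto simp: graded_Hom_def fun_eq_iff restrict_def)
  next
    fix e d r u assume r: "r \<in> carrier (Rdeg R e)" and "u \<in> carrier (Mdeg (Ext T \<phi> X Y) d)"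
    then have u: "u \<in> Hom T X (\<sigma>o T d Y)" by simp
    \<comment> \<open>Naturality of the central element r at the arrow \<Sigma>^d m replaces it by
      \<Sigma>^{e+d} m; no sign arises because no central element is suspended.\<close>
    have "\<sigma>a T (e + d) m \<cdot>\<^bsub>T\<^esub> (\<phi> e r (\<sigma>o T d Y) \<cdot>\<^bsub>T\<^esub> u) = \<phi> e r (\<sigma>o T (d + k) Z) \<cdot>\<^bsub>T\<^esub> (\<sigma>a T d m \<cdot>\<^bsub>T\<^esub> u)"
      if m: "m \<in> Hom T Y (\<sigma>o T k Z)" for k m
    proof -
      have r': "\<phi> e r (\<sigma>o T d Y) \<in> Hom T (\<sigma>o T d Y) (\<sigma>o T (e + d) Y)"
        using center_Hom[OF r nY] Y by (simp add: Susp_pow_add)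
      have "\<phi> e r (\<sigma>o T (d + k) Z) \<cdot>\<^bsub>T\<^esub> (\<sigma>a T d m \<cdot>\<^bsub>T\<^esub> u) = (\<phi> e r (\<sigma>o T (d + k) Z) \<cdot>\<^bsub>T\<^esub> \<sigma>a T d m) \<cdot>\<^bsub>T\<^esub> u"
        using Comp_assoc[OF u H[OF m] center_Hom[OF r nZ]] by simp
      also have "\<phi> e r (\<sigma>o T (d + k) Z) \<cdot>\<^bsub>T\<^esub> \<sigma>a T d m = \<sigma>a T (e + d) m \<cdot>\<^bsub>T\<^esub> \<phi> e r (\<sigma>o T d Y)"
        using center_natural[OF r H[OF m]] HomD(1)[OF m] by (simp add: Susp_pow_add)
      also have "\<dots> \<cdot>\<^bsub>T\<^esub> u = \<sigma>a T (e + d) m \<cdot>\<^bsub>T\<^esub> (\<phi> e r (\<sigma>o T d Y) \<cdot>\<^bsub>T\<^esub> u)"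
        using Comp_assoc[OF u r' H[OF m]] .
      finally show ?thesis by simp
    qed
    then show "?f (e + d) (Mact (Ext T \<phi> X Y) e d r u) = Mact ?G e d r (?f d u)"
      by (auto simp: graded_Hom_def fun_eq_iff restrict_def)
  qed
  from E.graded_module_hom_cong[OF _ this]
  have "graded_module_hom R (Ext T \<phi> X Y) ?G (\<lambda>d u k. maps (?c d u) (d + k))"
    using c(1) by simp
  then show "graded_module_hom R (Ext T \<phi> X Y)
      (graded_Hom R (on_obj (Ext_functor T \<phi> Z) Y) (on_obj (Ext_functor T \<phi> Z) X))
      (\<lambda>d u k. maps (?c d u) (d + k))"
    by simp
qed

text \<open>In degree d this is the defining property of a weak cokernel for the test object
  \<Sigma>^d Z.\<close>

lemma exact_at_Ext_functor:
  assumes "weak_cokernel p q" and Z: "Z \<in> Obj T"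
  shows "exact_at (on_arr (Ext_functor T \<phi> Z) q) (on_arr (Ext_functor T \<phi> Z) p)"
proof -
  from assms(1) obtain A B C where p: "p \<in> Hom T A B" and q: "q \<in> Hom T B C"
    and wc: "\<And>W g. \<lbrakk>W \<in> Obj T; g \<in> Hom T B W\<rbrakk> \<Longrightarrow>
      g \<cdot>\<^bsub>T\<^esub> p = Zero T A W \<longleftrightarrow> (\<exists>g'\<in>Hom T C W. g = g' \<cdot>\<^bsub>T\<^esub> q)"
    by (auto simp: weak_cokernel_def Hom_def)
  show ?thesis
    using wc[OF Susp_pow_Obj[OF Z]]
    by (simp add: exact_at_iff[OF Ext_functor_Hom[OF q Z] Ext_functor_Hom[OF p Z]]
        maps_Ext_functor[OF p] maps_Ext_functor[OF q] cong: bex_cong)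
qed

lemma cohomological_Ext_functor:
  assumes "Z \<in> Obj T"
  shows "cohomological T (Ext_functor T \<phi> Z)"
  unfolding cohomological_def Let_def
proof (intro allI impI)
  fix u v w n assume tri: "(u, v, w) \<in> Tri T"
  have "u \<in> Arr T"
    using Tri_candidate[OF tri] by (simp add: candidate_triangle_def)
  then have "\<sigma>a T n (on_arr (Susp T) u) = \<sigma>a T (n + 1) u"
    using Susp_pow_add(2)[of u n 1] by simp
  then show "exact_at (on_arr (Ext_functor T \<phi> Z) (\<sigma>a T (n + 1) u)) (on_arr (Ext_functor T \<phi> Z) (\<sigma>a T n w)) \<and>
      exact_at (on_arr (Ext_functor T \<phi> Z) (\<sigma>a T n w)) (on_arr (Ext_functor T \<phi> Z) (\<sigma>a T n v)) \<and>
      exact_at (on_arr (Ext_functor T \<phi> Z) (\<sigma>a T n v)) (on_arr (Ext_functor T \<phi> Z) (\<sigma>a T n u))"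
    using weak_cokernels_Tri[OF tri, THEN weak_cokernel_Susp_pow[of _ _ n]] assms
    by (metis exact_at_Ext_functor)
qed

end

section \<open>Restriction along an exact functor\<close>

locale exact_triangulated_functor = S: triangulated S + T: triangulated T
  for S :: "('a, 'm, 'x) triangulated_scheme" and T :: "('b, 'n, 'y) triangulated_scheme" +
  fixes F :: "('a, 'm, 'b, 'n) cfunctor" and \<theta> :: "'a \<Rightarrow> 'n"
  assumes exact: "exact_functor S T F \<theta>"
begin

sublocale cfunctor S T F
  using exact by (simp add: exact_functor_def additive_functor_def)

lemma comparison_Hom: "X \<in> Obj S \<Longrightarrow> \<theta> X \<in> Hom T (on_obj F (on_obj (Susp S) X)) (on_obj (Susp T) (on_obj F X))"
  and comparison_isomorphism: "X \<in> Obj S \<Longrightarrow> isomorphism T (\<theta> X)"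
  using exact by (simp_all add: exact_functor_def natural_isomorphism_def natural_transformation_def)

lemma comparison_natural:
  assumes "f \<in> Hom S X Y"
  shows "\<theta> Y \<cdot>\<^bsub>T\<^esub> on_arr F (on_arr (Susp S) f) = on_arr (Susp T) (on_arr F f) \<cdot>\<^bsub>T\<^esub> \<theta> X"
  using exact assms S.HomD[OF assms]
  by (simp add: exact_functor_def natural_isomorphism_def natural_transformation_def)

lemma on_Tri: "(u, v, w) \<in> Tri S \<Longrightarrow> (on_arr F u, on_arr F v, \<theta> (Dom S u) \<cdot>\<^bsub>T\<^esub> on_arr F w) \<in> Tri T"
  using exact by (simp add: exact_functor_def)

section \<open>The iterated comparison isomorphisms\<close>

abbreviation "\<Theta> \<equiv> iter_susp_iso S T F \<theta>"

lemma iter_pos_isomorphism: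
  assumes "Y \<in> Obj S"
  shows "iter_pos S T F \<theta> n Y \<in> Hom T (on_obj F (\<sigma>o S (int n) Y)) (\<sigma>o T (int n) (on_obj F Y)) \<and>
    isomorphism T (iter_pos S T F \<theta> n Y)"
proof (induct n)
  case 0
  show ?case using T.Ident_Hom on_obj T.isomorphism_Ident assms by simp
next
  case (Suc n)
  note O = on_obj[OF assms] S.Susp_pow_Obj[OF assms, of "int n"]
  have 1: "\<theta> (\<sigma>o S (int n) Y) \<in> Hom T (on_obj F (\<sigma>o S (int n + 1) Y)) (on_obj (Susp T) (on_obj F (\<sigma>o S (int n) Y)))"
    using comparison_Hom[OF O(2)] assms by (simp add: S.Susp_pow_Suc)
  have 2: "on_arr (Susp T) (iter_pos S T F \<theta> n Y) \<in>
      Hom T (on_obj (Susp T) (on_obj F (\<sigma>o S (int n) Y))) (\<sigma>o T (int n + 1) (on_obj F Y))"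
    using T.Susp.on_arr[of "iter_pos S T F \<theta> n Y"] Suc O(1) by (simp add: T.Susp_pow_Suc)
  show ?case
    using T.Comp_Hom[OF 1 2] T.isomorphism_Comp[OF 1 2 comparison_isomorphism[OF O(2)]]
      T.Susp.on_isomorphism Suc by (simp add: add.commute)
qed

text \<open>The inverse of \<theta> leads from \<Sigma> F \<Sigma>^{-n-1} Y to F \<Sigma>^{-n} Y,
  the previous iterate from there to \<Sigma>^{-n} F Y. Desuspending the composite once gives the
  next iterate.\<close>

lemma iter_neg_isomorphism:
  assumes "Y \<in> Obj S"
  shows "iter_neg S T F \<theta> n Y \<in> Hom T (on_obj F (\<sigma>o S (- int n) Y)) (\<sigma>o T (- int n) (on_obj F Y)) \<and>
    isomorphism T (iter_neg S T F \<theta> n Y)"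
proof (induct n)
  case 0
  show ?case using T.Ident_Hom on_obj T.isomorphism_Ident assms by simp
next
  case (Suc n)
  let ?m = "- int (Suc n)"
  have m: "?m + 1 = - int n" "- 1 + - int n = ?m" by simp_all
  note O = on_obj[OF assms] S.Susp_pow_Obj[OF assms, of ?m] on_obj[OF S.Susp_pow_Obj[OF assms, of ?m]]
  have s: "on_obj (Susp S) (\<sigma>o S ?m Y) = \<sigma>o S (- int n) Y"
    using S.Susp_pow_Suc(1)[OF assms, of ?m] unfolding m by simp
  note i = T.inv_arrD(1)[OF comparison_isomorphism[OF O(2)] comparison_Hom[OF O(2)], unfolded s]
  note c = T.Comp_Hom[OF i conjunct1[OF Suc]]
  have c': "isomorphism T (iter_neg S T F \<theta> n Y \<cdot>\<^bsub>T\<^esub> inv_arr T (\<theta> (\<sigma>o S ?m Y)))"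
    using T.isomorphism_Comp[OF i conjunct1[OF Suc]] T.isomorphism_inverse[OF comparison_isomorphism[OF O(2)]]
      Suc by blast
  have "\<sigma>o T (- 1) (on_obj (Susp T) (on_obj F (\<sigma>o S ?m Y))) = on_obj F (\<sigma>o S ?m Y)"
    using T.Susp_pow_add(1)[OF O(3), of "- 1" 1] by simp
  moreover have "\<sigma>o T (- 1) (\<sigma>o T (- int n) (on_obj F Y)) = \<sigma>o T ?m (on_obj F Y)"
    using T.Susp_pow_add(1)[OF O(1), of "- 1" "- int n"] unfolding m .
  ultimately have "iter_neg S T F \<theta> (Suc n) Y \<in> Hom T (on_obj F (\<sigma>o S ?m Y)) (\<sigma>o T ?m (on_obj F Y))"
    using T.Susp_pow_Hom[OF c, of "- 1"] by simp
  moreover have "isomorphism T (iter_neg S T F \<theta> (Suc n) Y)"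
    using cfunctor.on_isomorphism[OF T.cfunctor_Susp_pow c', of "- 1"] by simp
  ultimately show ?case ..
qed

lemma iter_Hom: "Y \<in> Obj S \<Longrightarrow> \<Theta> n Y \<in> Hom T (on_obj F (\<sigma>o S n Y)) (\<sigma>o T n (on_obj F Y))"
  and iter_isomorphism: "Y \<in> Obj S \<Longrightarrow> isomorphism T (\<Theta> n Y)"
  using iter_pos_isomorphism[of Y "nat n"] iter_neg_isomorphism[of Y "nat (- n)"]
  by (cases "0 \<le> n"; simp add: iter_susp_iso_def)+

lemma iter_0 [simp]: "\<Theta> 0 Y = Ident T (on_obj F Y)"
  by (simp add: iter_susp_iso_def)

text \<open>One recursion covering both branches of the definition: for negative n, \<Sigma> undoes
  the desuspension and \<theta> cancels its inverse. Everything further about \<Theta> is induction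
  over this formula.\<close>

lemma iter_Suc:
  assumes "Y \<in> Obj S"
  shows "\<Theta> (n + 1) Y = on_arr (Susp T) (\<Theta> n Y) \<cdot>\<^bsub>T\<^esub> \<theta> (\<sigma>o S n Y)"
proof (cases "0 \<le> n")
  case True
  then show ?thesis by (simp add: iter_susp_iso_def nat_add_distrib)
next
  case False
  define m where "m = nat (- n - 1)"
  have n: "n = - int (Suc m)" using False by (simp add: m_def)
  note O = S.Susp_pow_Obj[OF assms, of n]
  have s: "on_obj (Susp S) (\<sigma>o S n Y) = \<sigma>o S (- int m) Y"
    using S.Susp_pow_Suc(1)[OF assms, of n] by (simp add: n)
  note \<theta> = comparison_isomorphism[OF O] comparison_Hom[OF O, unfolded s]
  note i = T.inv_arrD[OF \<theta>]
  note g = conjunct1[OF iter_neg_isomorphism[OF assms, of m]]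
  let ?g = "iter_neg S T F \<theta> m Y \<cdot>\<^bsub>T\<^esub> inv_arr T (\<theta> (\<sigma>o S n Y))"
  have "\<Theta> n Y = \<sigma>a T (- 1) ?g"
    using False by (simp add: iter_susp_iso_def n nat_add_distrib)
  then have "on_arr (Susp T) (\<Theta> n Y) = ?g"
    using T.Susp_pow_add(2)[OF T.HomD(1)[OF T.Comp_Hom[OF i(1) g]], of 1 "- 1"] by simp
  then have "on_arr (Susp T) (\<Theta> n Y) \<cdot>\<^bsub>T\<^esub> \<theta> (\<sigma>o S n Y) = iter_neg S T F \<theta> m Y"
    using T.Comp_assoc[OF \<theta>(2) i(1) g] T.Ident_right[OF g] by (simp add: i(2))
  \<comment> \<open>For m = 0 the right-hand side is the iterate at 0 and comes from the nonnegative
    branch; both recursions start with the identity.\<close>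
  also have "\<dots> = \<Theta> (n + 1) Y"
    by (cases "m = 0") (simp_all add: iter_susp_iso_def n)
  finally show ?thesis by simp
qed

text \<open>The operation g |-> \<Sigma>g . \<theta>, which raises the index of an iterate, is
  injective. It turns the induction steps below into equivalences.\<close>

lemma Susp_comparison_cancel:
  assumes "X \<in> Obj S" "g \<in> Hom T (on_obj F X) W" "g' \<in> Hom T (on_obj F X) W"
  shows "on_arr (Susp T) g \<cdot>\<^bsub>T\<^esub> \<theta> X = on_arr (Susp T) g' \<cdot>\<^bsub>T\<^esub> \<theta> X \<longleftrightarrow> g = g'"
  using T.isomorphism_cancel_right[OF comparison_isomorphism comparison_Hom T.Susp.on_arr T.Susp.on_arr]
    T.Susp_inj T.HomD(1) assms by metis

text \<open>By naturality of \<theta>, passing from n to n + 1 changes both sides by the same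
  operation g |-> \<Sigma>g . \<theta>.\<close>

lemma iter_natural:
  assumes f: "f \<in> Hom S X Y"
  shows "\<Theta> n Y \<cdot>\<^bsub>T\<^esub> on_arr F (\<sigma>a S n f) = \<sigma>a T n (on_arr F f) \<cdot>\<^bsub>T\<^esub> \<Theta> n X"
proof (induct n rule: int_iff_induct)
  case zero
  then show ?case using on_arr[OF f] by (simp add: T.Ident_left T.Ident_right)
next
  case (step n)
  note O = S.HomD(4,5)[OF f] and nO = S.Susp_pow_Obj[OF S.HomD(4)[OF f], of n] S.Susp_pow_Obj[OF S.HomD(5)[OF f], of n]
  note nf = S.Susp_pow_Hom[OF f, of n]
  note g = iter_Hom[OF O(1), of n] iter_Hom[OF O(2), of n]
  note Ff = on_arr[OF nf] T.Susp_pow_Hom[OF on_arr[OF f], of n]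
  note \<theta> = comparison_Hom[OF nO(1)] comparison_Hom[OF nO(2)]
  have "\<Theta> (n + 1) Y \<cdot>\<^bsub>T\<^esub> on_arr F (\<sigma>a S (n + 1) f) =
      on_arr (Susp T) (\<Theta> n Y) \<cdot>\<^bsub>T\<^esub> (\<theta> (\<sigma>o S n Y) \<cdot>\<^bsub>T\<^esub> on_arr F (on_arr (Susp S) (\<sigma>a S n f)))"
    using T.Comp_assoc[OF on_arr[OF S.Susp.on_arr[OF nf]] \<theta>(2) T.Susp.on_arr[OF g(2)]] S.HomD(1)[OF f]
    by (simp add: iter_Suc O S.Susp_pow_Suc)
  also have "\<dots> = on_arr (Susp T) (\<Theta> n Y) \<cdot>\<^bsub>T\<^esub> (on_arr (Susp T) (on_arr F (\<sigma>a S n f)) \<cdot>\<^bsub>T\<^esub> \<theta> (\<sigma>o S n X))"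
    by (simp add: comparison_natural[OF nf])
  also have "\<dots> = on_arr (Susp T) (\<Theta> n Y \<cdot>\<^bsub>T\<^esub> on_arr F (\<sigma>a S n f)) \<cdot>\<^bsub>T\<^esub> \<theta> (\<sigma>o S n X)"
    using T.Comp_assoc[OF \<theta>(1) T.Susp.on_arr[OF Ff(1)] T.Susp.on_arr[OF g(2)]]
    by (simp add: T.Susp.on_Comp[OF Ff(1) g(2)])
  finally have 1: "\<Theta> (n + 1) Y \<cdot>\<^bsub>T\<^esub> on_arr F (\<sigma>a S (n + 1) f) =
      on_arr (Susp T) (\<Theta> n Y \<cdot>\<^bsub>T\<^esub> on_arr F (\<sigma>a S n f)) \<cdot>\<^bsub>T\<^esub> \<theta> (\<sigma>o S n X)" .
  have 2: "\<sigma>a T (n + 1) (on_arr F f) \<cdot>\<^bsub>T\<^esub> \<Theta> (n + 1) X =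
      on_arr (Susp T) (\<sigma>a T n (on_arr F f) \<cdot>\<^bsub>T\<^esub> \<Theta> n X) \<cdot>\<^bsub>T\<^esub> \<theta> (\<sigma>o S n X)"
    using T.Comp_assoc[OF \<theta>(1) T.Susp.on_arr[OF g(1)] T.Susp.on_arr[OF Ff(2)]] T.HomD(1)[OF on_arr[OF f]]
    by (simp add: iter_Suc O T.Susp_pow_Suc T.Susp.on_Comp[OF g(1) Ff(2)])
  show ?case
    unfolding 1 2 using T.Comp_Hom[OF Ff(1) g(2)] T.Comp_Hom[OF g(1) Ff(2)]
    by (rule Susp_comparison_cancel[OF nO(1)])
qed

text \<open>The cocycle rule. It makes the twisted identifications compose correctly and, for b = 1,
  relates the iterates at X and at \<Sigma>X along a triangle. Both sides obey the same recursion in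
  a.\<close>

lemma iter_add:
  assumes Y: "Y \<in> Obj S"
  shows "\<Theta> (a + b) Y = \<sigma>a T a (\<Theta> b Y) \<cdot>\<^bsub>T\<^esub> \<Theta> a (\<sigma>o S b Y)"
proof (induct a rule: int_iff_induct)
  case zero
  then show ?case using T.Ident_right[OF iter_Hom[OF Y, of b]] by simp
next
  case (step a)
  note bY = S.Susp_pow_Obj[OF Y, of b]
  note abY = S.Susp_pow_Obj[OF Y, of "a + b"]
  have 0: "\<Theta> (a + b) Y \<in> Hom T (on_obj F (\<sigma>o S (a + b) Y)) (\<sigma>o T (a + b) (on_obj F Y))"
    by (rule iter_Hom[OF Y])
  have 1: "\<Theta> a (\<sigma>o S b Y) \<in> Hom T (on_obj F (\<sigma>o S (a + b) Y)) (\<sigma>o T a (on_obj F (\<sigma>o S b Y)))"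
    using iter_Hom[OF bY, of a] Y by (simp add: S.Susp_pow_add)
  have 2: "\<sigma>a T a (\<Theta> b Y) \<in> Hom T (\<sigma>o T a (on_obj F (\<sigma>o S b Y))) (\<sigma>o T (a + b) (on_obj F Y))"
    using T.Susp_pow_Hom[OF iter_Hom[OF Y], of a b] on_obj[OF Y] by (simp add: T.Susp_pow_add)
  have "\<Theta> (a + 1 + b) Y = on_arr (Susp T) (\<Theta> (a + b) Y) \<cdot>\<^bsub>T\<^esub> \<theta> (\<sigma>o S (a + b) Y)"
    using iter_Suc[OF Y, of "a + b"] by (simp add: ac_simps)
  moreover have "\<sigma>a T (a + 1) (\<Theta> b Y) \<cdot>\<^bsub>T\<^esub> \<Theta> (a + 1) (\<sigma>o S b Y) =
      on_arr (Susp T) (\<sigma>a T a (\<Theta> b Y) \<cdot>\<^bsub>T\<^esub> \<Theta> a (\<sigma>o S b Y)) \<cdot>\<^bsub>T\<^esub> \<theta> (\<sigma>o S (a + b) Y)"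
    using T.Comp_assoc[OF comparison_Hom[OF abY] T.Susp.on_arr[OF 1] T.Susp.on_arr[OF 2]]
      T.HomD(1)[OF iter_Hom[OF Y]] Y
    by (simp add: iter_Suc bY T.Susp_pow_Suc T.Susp.on_Comp[OF 1 2] S.Susp_pow_add)
  ultimately show ?case
    using Susp_comparison_cancel[OF abY 0 T.Comp_Hom[OF 1 2]] by simp
qed

lemma iter_1: "Y \<in> Obj S \<Longrightarrow> \<Theta> 1 Y = \<theta> Y"
  using iter_Suc[of Y 0] T.Susp.on_Ident[of "on_obj F Y"] T.Ident_left[OF comparison_Hom[of Y]] on_obj
  by simp

text \<open>h is exact on the image triangle, whose third map is \<theta> . F w, and the maps
  h(\<Theta>_n) compare the resulting sequence with that of h F. Naturality of \<Theta> gives the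
  squares at u and v; the square at w also has to absorb \<theta>.\<close>

lemma cohomological_restriction:
  assumes h: "cfunctor (opposite T) (grMod R) h" and coh: "cohomological T h"
  shows "cohomological S (h \<circ>\<^sub>F F)"
  unfolding cohomological_def Let_def comp_functor_simps
proof (intro allI impI)
  fix u v w n assume tri: "(u, v, w) \<in> Tri S"
  interpret h: cfunctor "opposite T" "grMod R" h by fact
  have h_Hom: "on_arr h f \<in> Hom (grMod R) (on_obj h B) (on_obj h A)" if "f \<in> Hom T A B" for f A B
    using h.on_arr that by simp
  have h_Comp: "on_arr h (g \<cdot>\<^bsub>T\<^esub> f) = on_arr h f \<cdot>\<^bsub>grMod R\<^esub> on_arr h g"
    if "f \<in> Hom T A B" "g \<in> Hom T B C" for f g A B C
    using h.on_Comp[of g C B f A] that by simp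
  have h_iso: "isomorphism (grMod R) (on_arr h f)" if "isomorphism T f" for f
    using h.on_isomorphism that by simp
  from S.Tri_candidate[OF tri] obtain X Y Z where u: "u \<in> Hom S X Y" and v: "v \<in> Hom S Y Z"
    and w: "w \<in> Hom S Z (on_obj (Susp S) X)"
    by (auto simp: candidate_triangle_def Hom_def)
  note O = S.HomD(4,5)[OF u] S.HomD(5)[OF v]
  note X = S.HomD(2)[OF u]
  note SX = S.Susp.on_obj[OF O(1)]
  have nSX: "\<sigma>o S n (on_obj (Susp S) X) = \<sigma>o S (n + 1) X"
    "\<sigma>o T n (on_obj (Susp T) (on_obj F X)) = \<sigma>o T (n + 1) (on_obj F X)"
    using S.Susp_pow_add(1)[OF O(1), of n 1] T.Susp_pow_add(1)[OF on_obj[OF O(1)], of n 1] by simp_all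
  have sq: "on_arr h (\<Theta> k A) \<cdot>\<^bsub>grMod R\<^esub> on_arr h (\<sigma>a T k (on_arr F f)) =
      on_arr h (on_arr F (\<sigma>a S k f)) \<cdot>\<^bsub>grMod R\<^esub> on_arr h (\<Theta> k B)"
    if f: "f \<in> Hom S A B" for f A B k
    using iter_natural[OF f, of k] h_Comp[OF iter_Hom[OF S.HomD(4)[OF f]] T.Susp_pow_Hom[OF on_arr[OF f], of k]]
      h_Comp[OF on_arr[OF S.Susp_pow_Hom[OF f, of k]] iter_Hom[OF S.HomD(5)[OF f]]] by simp
  note Fw = on_arr[OF w] and nFw = T.Susp_pow_Hom[OF on_arr[OF w], of n]
  note \<theta> = comparison_Hom[OF O(1)] and n\<theta> = T.Susp_pow_Hom[OF comparison_Hom[OF O(1)], of n]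
  note \<Theta>Z = iter_Hom[OF O(3), of n] and \<Theta>SX = iter_Hom[OF SX, of n]
  have \<theta>Fw: "\<sigma>a T n (\<theta> X \<cdot>\<^bsub>T\<^esub> on_arr F w) \<in> Hom T (\<sigma>o T n (on_obj F Z)) (\<sigma>o T (n + 1) (on_obj F X))"
    using T.Susp_pow_Hom[OF T.Comp_Hom[OF Fw \<theta>], of n] by (simp add: nSX)
  have nw: "\<sigma>a S n w \<in> Hom S (\<sigma>o S n Z) (\<sigma>o S (n + 1) X)"
    using S.Susp_pow_Hom[OF w, of n] by (simp add: nSX)
  have "\<sigma>a T n (\<theta> X \<cdot>\<^bsub>T\<^esub> on_arr F w) \<cdot>\<^bsub>T\<^esub> \<Theta> n Z = \<sigma>a T n (\<theta> X) \<cdot>\<^bsub>T\<^esub> (\<sigma>a T n (on_arr F w) \<cdot>\<^bsub>T\<^esub> \<Theta> n Z)"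
    using T.Comp_assoc[OF \<Theta>Z nFw n\<theta>] by (simp add: T.Susp_pow_Comp[OF Fw \<theta>])
  also have "\<dots> = (\<sigma>a T n (\<theta> X) \<cdot>\<^bsub>T\<^esub> \<Theta> n (on_obj (Susp S) X)) \<cdot>\<^bsub>T\<^esub> on_arr F (\<sigma>a S n w)"
    using T.Comp_assoc[OF on_arr[OF S.Susp_pow_Hom[OF w, of n]] \<Theta>SX n\<theta>] by (simp add: iter_natural[OF w])
  \<comment> \<open>The cocycle rule with b = 1: the extra \<theta> is what turns the iterate n at
    \<Sigma>X into the iterate n + 1 at X.\<close>
  also have "\<sigma>a T n (\<theta> X) \<cdot>\<^bsub>T\<^esub> \<Theta> n (on_obj (Susp S) X) = \<Theta> (n + 1) X"
    using iter_add[OF O(1), of n 1] by (simp add: iter_1[OF O(1)])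
  finally have "\<sigma>a T n (\<theta> X \<cdot>\<^bsub>T\<^esub> on_arr F w) \<cdot>\<^bsub>T\<^esub> \<Theta> n Z = \<Theta> (n + 1) X \<cdot>\<^bsub>T\<^esub> on_arr F (\<sigma>a S n w)" .
  then have sqw: "on_arr h (\<Theta> n Z) \<cdot>\<^bsub>grMod R\<^esub> on_arr h (\<sigma>a T n (\<theta> X \<cdot>\<^bsub>T\<^esub> on_arr F w)) =
      on_arr h (on_arr F (\<sigma>a S n w)) \<cdot>\<^bsub>grMod R\<^esub> on_arr h (\<Theta> (n + 1) X)"
    using h_Comp[OF \<Theta>Z \<theta>Fw] h_Comp[OF on_arr[OF nw] iter_Hom[OF O(1)]] by simp
  have ex: "exact_at (on_arr h (\<sigma>a T (n + 1) (on_arr F u))) (on_arr h (\<sigma>a T n (\<theta> X \<cdot>\<^bsub>T\<^esub> on_arr F w)))"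
    "exact_at (on_arr h (\<sigma>a T n (\<theta> X \<cdot>\<^bsub>T\<^esub> on_arr F w))) (on_arr h (\<sigma>a T n (on_arr F v)))"
    "exact_at (on_arr h (\<sigma>a T n (on_arr F v))) (on_arr h (\<sigma>a T n (on_arr F u)))"
    using coh on_Tri[OF tri] unfolding X cohomological_def Let_def by blast+
  note iso = h_Hom[OF iter_Hom] h_iso[OF iter_isomorphism]
  note HT = h_Hom[OF T.Susp_pow_Hom[OF on_arr]] and HS = h_Hom[OF on_arr[OF S.Susp_pow_Hom]]
  show "exact_at (on_arr h (on_arr F (\<sigma>a S (n + 1) u))) (on_arr h (on_arr F (\<sigma>a S n w))) \<and>
      exact_at (on_arr h (on_arr F (\<sigma>a S n w))) (on_arr h (on_arr F (\<sigma>a S n v))) \<and>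
      exact_at (on_arr h (on_arr F (\<sigma>a S n v))) (on_arr h (on_arr F (\<sigma>a S n u)))"
  proof (intro conjI)
    show "exact_at (on_arr h (on_arr F (\<sigma>a S (n + 1) u))) (on_arr h (on_arr F (\<sigma>a S n w)))"
      by (rule exact_at_iso[OF HT[OF u] h_Hom[OF \<theta>Fw] HS[OF u] h_Hom[OF on_arr[OF nw]]
            iso(1)[OF O(2)] iso(2)[OF O(2)] iso(1)[OF O(1)] iso(2)[OF O(1)] iso(1)[OF O(3)] iso(2)[OF O(3)] sq[OF u] sqw ex(1)])
    show "exact_at (on_arr h (on_arr F (\<sigma>a S n w))) (on_arr h (on_arr F (\<sigma>a S n v)))"
      by (rule exact_at_iso[OF h_Hom[OF \<theta>Fw] HT[OF v] h_Hom[OF on_arr[OF nw]] HS[OF v]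
            iso(1)[OF O(1)] iso(2)[OF O(1)] iso(1)[OF O(3)] iso(2)[OF O(3)] iso(1)[OF O(2)] iso(2)[OF O(2)] sqw sq[OF v] ex(2)])
    show "exact_at (on_arr h (on_arr F (\<sigma>a S n v))) (on_arr h (on_arr F (\<sigma>a S n u)))"
      by (rule exact_at_iso[OF HT[OF v] HT[OF u] HS[OF v] HS[OF u]
            iso(1)[OF O(3)] iso(2)[OF O(3)] iso(1)[OF O(2)] iso(2)[OF O(2)] iso(1)[OF O(1)] iso(2)[OF O(1)] sq[OF v] sq[OF u] ex(3)])
  qed
qed

end

text \<open>The inverse of \<Theta>_n appears because h is contravariant: h of it leads from h(F
  \<Sigma>^n X) to h(\<Sigma>^n F X), where the identification of h applies.\<close>

lemma graded_linear_restriction: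
  assumes S: "graded_linear_category R S \<phi>\<^sub>S" and T: "graded_linear_category R T \<phi>\<^sub>T"
    and F: "graded_linear_functor R S \<phi>\<^sub>S T \<phi>\<^sub>T F \<theta>"
    and h: "graded_linear_mod_functor R T \<phi>\<^sub>T h \<iota>"
  shows "graded_linear_mod_functor R S \<phi>\<^sub>S (h \<circ>\<^sub>F F)
    (\<lambda>n X. \<iota> n (on_obj F X) \<cdot>\<^bsub>grMod R\<^esub> on_arr h (inv_arr T (iter_susp_iso S T F \<theta> n X)))"
proof -
  interpret S: graded_linear_category R S \<phi>\<^sub>S by fact
  interpret T: graded_linear_category R T \<phi>\<^sub>T by fact
  interpret exact_triangulated_functor S T F \<theta>
    using F by unfold_locales (simp add: graded_linear_functor_def)
  interpret h: cfunctor "opposite T" "grMod R" h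
    using h by (simp add: graded_linear_mod_functor_def)
  have h_Hom: "on_arr h f \<in> Hom (grMod R) (on_obj h B) (on_obj h A)" if "f \<in> Hom T A B" for f A B
    using h.on_arr that by simp
  have h_Comp: "on_arr h (g \<cdot>\<^bsub>T\<^esub> f) = on_arr h f \<cdot>\<^bsub>grMod R\<^esub> on_arr h g"
    if "f \<in> Hom T A B" "g \<in> Hom T B C" for f g A B C
    using h.on_Comp[of g C B f A] that by simp
  have h_iso: "isomorphism (grMod R) (on_arr h f)" if "isomorphism T f" for f
    using h.on_isomorphism that by simp
  have \<iota>: "\<iota> n X \<in> Hom (grMod R) (on_obj h (\<sigma>o T n X)) (shift (- n) (on_obj h X))"
    "isomorphism (grMod R) (\<iota> n X)" if "X \<in> Obj T" for n X
    using h that by (simp_all add: graded_linear_mod_functor_def natural_isomorphism_def natural_transformation_def)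
  have \<iota>_nat: "\<iota> n X \<cdot>\<^bsub>grMod R\<^esub> on_arr h (\<sigma>a T n f) = on_arr (shift_functor (- n)) (on_arr h f) \<cdot>\<^bsub>grMod R\<^esub> \<iota> n Y"
    if "f \<in> Hom T X Y" for f X Y n
    using h that T.HomD[OF that]
    by (simp add: graded_linear_mod_functor_def natural_isomorphism_def natural_transformation_def)
  have \<iota>_add: "maps (\<iota> (a + b) X) d m = maps (\<iota> b X) (- a + d) (maps (\<iota> a (\<sigma>o T b X)) d m)"
    if "X \<in> Obj T" "m \<in> carrier (Mdeg (on_obj h (\<sigma>o T (a + b) X)) d)" for X m a b d
    using h that unfolding graded_linear_mod_functor_def by blast
  let ?J = "\<lambda>n X. inv_arr T (\<Theta> n X)"
  let ?\<iota> = "\<lambda>n X. \<iota> n (on_obj F X) \<cdot>\<^bsub>grMod R\<^esub> on_arr h (?J n X)"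
  have J: "?J n X \<in> Hom T (\<sigma>o T n (on_obj F X)) (on_obj F (\<sigma>o S n X))"
    "\<Theta> n X \<cdot>\<^bsub>T\<^esub> ?J n X = Ident T (\<sigma>o T n (on_obj F X))"
    "?J n X \<cdot>\<^bsub>T\<^esub> \<Theta> n X = Ident T (on_obj F (\<sigma>o S n X))"
    "isomorphism T (?J n X)" if "X \<in> Obj S" for n X
    using T.inv_arrD[OF iter_isomorphism iter_Hom] T.isomorphism_inverse[OF iter_isomorphism] that by blast+
  have J_nat: "on_arr F (\<sigma>a S n f) \<cdot>\<^bsub>T\<^esub> ?J n X = ?J n Y \<cdot>\<^bsub>T\<^esub> \<sigma>a T n (on_arr F f)"
    if f: "f \<in> Hom S X Y" for f X Y n
  proof -
    note O = S.HomD(4,5)[OF f]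
    note g = on_arr[OF S.Susp_pow_Hom[OF f, of n]] and g' = T.Susp_pow_Hom[OF on_arr[OF f], of n]
    note t = iter_Hom[OF O(1), of n] iter_Hom[OF O(2), of n]
    note j = J(1)[OF O(1), of n] J(1)[OF O(2), of n]
    have "on_arr F (\<sigma>a S n f) \<cdot>\<^bsub>T\<^esub> ?J n X = (?J n Y \<cdot>\<^bsub>T\<^esub> \<Theta> n Y) \<cdot>\<^bsub>T\<^esub> (on_arr F (\<sigma>a S n f) \<cdot>\<^bsub>T\<^esub> ?J n X)"
      using T.Comp_Hom[OF j(1) g] by (simp add: J(3)[OF O(2)] T.Ident_left)
    also have "\<dots> = ?J n Y \<cdot>\<^bsub>T\<^esub> ((\<Theta> n Y \<cdot>\<^bsub>T\<^esub> on_arr F (\<sigma>a S n f)) \<cdot>\<^bsub>T\<^esub> ?J n X)"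
      using T.Comp_assoc[OF T.Comp_Hom[OF j(1) g] t(2) j(2)] T.Comp_assoc[OF j(1) g t(2)] by simp
    also have "\<dots> = ?J n Y \<cdot>\<^bsub>T\<^esub> (\<sigma>a T n (on_arr F f) \<cdot>\<^bsub>T\<^esub> (\<Theta> n X \<cdot>\<^bsub>T\<^esub> ?J n X))"
      using T.Comp_assoc[OF j(1) t(1) g'] by (simp add: iter_natural[OF f])
    also have "\<dots> = ?J n Y \<cdot>\<^bsub>T\<^esub> \<sigma>a T n (on_arr F f)"
      using g' by (simp add: J(2)[OF O(1)] T.Ident_right)
    finally show ?thesis .
  qed
  \<comment> \<open>The cocycle rule inverted, hence with its factors in the opposite order.\<close>
  have J_add: "?J (a + b) X = ?J a (\<sigma>o S b X) \<cdot>\<^bsub>T\<^esub> \<sigma>a T a (?J b X)" if X: "X \<in> Obj S" for X a b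
  proof -
    note bX = S.Susp_pow_Obj[OF X, of b]
    note 1 = iter_Hom[OF bX, of a] and 2 = T.Susp_pow_Hom[OF iter_Hom[OF X], of a b]
    have "inv_arr T (\<sigma>a T a (\<Theta> b X)) = \<sigma>a T a (?J b X)"
      using cfunctor.on_inv_arr[OF T.cfunctor_Susp_pow iter_isomorphism[OF X]] by simp
    moreover have "isomorphism T (\<sigma>a T a (\<Theta> b X))"
      using cfunctor.on_isomorphism[OF T.cfunctor_Susp_pow iter_isomorphism[OF X]] .
    ultimately have "inverse_arrows T (\<sigma>a T a (\<Theta> b X)) (\<sigma>a T a (?J b X))"
      using T.isomorphism_inv_arr by metis
    from T.inverse_arrows_Comp[OF 1 2 T.isomorphism_inv_arr[OF iter_isomorphism[OF bX]] this]
    show ?thesis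
      by (simp add: iter_add[OF X] T.inv_arr_eq)
  qed
  have \<iota>': "?\<iota> n X \<in> Hom (grMod R) (on_obj h (on_obj F (\<sigma>o S n X))) (shift (- n) (on_obj h (on_obj F X)))"
    "isomorphism (grMod R) (?\<iota> n X)" if X: "X \<in> Obj S" for n X
    using grMod.Comp_Hom[OF h_Hom[OF J(1)[OF X]] \<iota>(1)[OF on_obj[OF X]]]
      grMod.isomorphism_Comp[OF h_Hom[OF J(1)[OF X]] \<iota>(1)[OF on_obj[OF X]] h_iso[OF J(4)[OF X]] \<iota>(2)[OF on_obj[OF X]]]
    by blast+
  have maps_\<iota>': "maps (?\<iota> n X) d m = maps (\<iota> n (on_obj F X)) d (maps (on_arr h (?J n X)) d m)"
    if "X \<in> Obj S" "m \<in> carrier (Mdeg (on_obj h (on_obj F (\<sigma>o S n X))) d)" for n X d m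
    using maps_Comp[OF h_Hom[OF J(1)[OF that(1)]] \<iota>(1)[OF on_obj[OF that(1)]] that(2)] .
  show ?thesis
    unfolding graded_linear_mod_functor_def
  proof (intro conjI allI ballI)
    show "cfunctor (opposite S) (grMod R) (h \<circ>\<^sub>F F)"
      using cfunctor_opposite h.cfunctor_axioms by (rule cfunctor_comp)
    show "natural_isomorphism (opposite S) (grMod R) ((h \<circ>\<^sub>F F) \<circ>\<^sub>F Susp_pow S n)
        (shift_functor (- n) \<circ>\<^sub>F (h \<circ>\<^sub>F F)) (?\<iota> n)" for n
      unfolding natural_isomorphism_def natural_transformation_def
    proof (intro conjI ballI)
      fix X assume "X \<in> Obj (opposite S)"
      then show "?\<iota> n X \<in> Hom (grMod R) (on_obj ((h \<circ>\<^sub>F F) \<circ>\<^sub>F Susp_pow S n) X)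
          (on_obj (shift_functor (- n) \<circ>\<^sub>F (h \<circ>\<^sub>F F)) X)"
        and "isomorphism (grMod R) (?\<iota> n X)"
        using \<iota>'[of X n] by simp_all
    next
      fix X Y f assume "f \<in> Hom (opposite S) X Y"
      then have f: "f \<in> Hom S Y X" by simp
      note O = S.HomD(4,5)[OF f]
      note Ff = on_arr[OF f] and Fnf = on_arr[OF S.Susp_pow_Hom[OF f, of n]]
      note nFf = T.Susp_pow_Hom[OF Ff, of n]
      note j = J(1)[OF O(1), of n] J(1)[OF O(2), of n]
      note i = \<iota>(1)[OF on_obj[OF O(1)], of n] \<iota>(1)[OF on_obj[OF O(2)], of n]
      have "?\<iota> n Y \<cdot>\<^bsub>grMod R\<^esub> on_arr h (on_arr F (\<sigma>a S n f)) =
          \<iota> n (on_obj F Y) \<cdot>\<^bsub>grMod R\<^esub> on_arr h (on_arr F (\<sigma>a S n f) \<cdot>\<^bsub>T\<^esub> ?J n Y)"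
        using grMod.Comp_assoc[OF h_Hom[OF Fnf] h_Hom[OF j(1)] i(1)] by (simp add: h_Comp[OF j(1) Fnf])
      also have "\<dots> = (\<iota> n (on_obj F Y) \<cdot>\<^bsub>grMod R\<^esub> on_arr h (\<sigma>a T n (on_arr F f))) \<cdot>\<^bsub>grMod R\<^esub> on_arr h (?J n X)"
        using grMod.Comp_assoc[OF h_Hom[OF j(2)] h_Hom[OF nFf] i(1)]
        by (simp add: J_nat[OF f] h_Comp[OF nFf j(2)])
      also have "\<dots> = on_arr (shift_functor (- n)) (on_arr h (on_arr F f)) \<cdot>\<^bsub>grMod R\<^esub> ?\<iota> n X"
        using grMod.Comp_assoc[OF h_Hom[OF j(2)] i(2) shift_Hom[OF h_Hom[OF Ff]]] by (simp add: \<iota>_nat[OF Ff])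
      finally show "?\<iota> n Y \<cdot>\<^bsub>grMod R\<^esub> on_arr ((h \<circ>\<^sub>F F) \<circ>\<^sub>F Susp_pow S n) f =
          on_arr (shift_functor (- n) \<circ>\<^sub>F (h \<circ>\<^sub>F F)) f \<cdot>\<^bsub>grMod R\<^esub> ?\<iota> n X"
        by simp
    qed
  next
    fix a b X d m assume X: "X \<in> Obj S"
      and "m \<in> carrier (Mdeg (on_obj (h \<circ>\<^sub>F F) (\<sigma>o S (a + b) X)) d)"
    then have m: "m \<in> carrier (Mdeg (on_obj h (on_obj F (\<sigma>o S (a + b) X))) d)" by simp
    note bX = S.Susp_pow_Obj[OF X, of b] and FX = on_obj[OF X] and bFX = T.Susp_pow_Obj[OF on_obj[OF X], of b]
    have m': "m \<in> carrier (Mdeg (on_obj h (on_obj F (\<sigma>o S a (\<sigma>o S b X)))) d)"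
      using m X by (simp add: S.Susp_pow_add)
    let ?y = "maps (on_arr h (?J a (\<sigma>o S b X))) d m"
    note ja = J(1)[OF bX, of a] and jb = J(1)[OF X, of b] and jab = T.Susp_pow_Hom[OF J(1)[OF X], of a b]
    have y: "?y \<in> carrier (Mdeg (on_obj h (\<sigma>o T a (on_obj F (\<sigma>o S b X)))) d)"
      using Hom_grModD(4)[OF h_Hom[OF ja] m'] .
    have z: "maps (on_arr h (?J (a + b) X)) d m = maps (on_arr h (\<sigma>a T a (?J b X))) d ?y"
      using maps_Comp[OF h_Hom[OF ja] h_Hom[OF jab] m'] by (simp add: J_add[OF X] h_Comp[OF jab ja])
    \<comment> \<open>Naturality of the identification for a at the arrow \<open>?J b X\<close>
      interchanges the two. Since its target is shifted by -a, the map moved across is read in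
      degree -a + d.\<close>
    have "maps (\<iota> a (\<sigma>o T b (on_obj F X))) d (maps (on_arr h (\<sigma>a T a (?J b X))) d ?y) =
        maps (\<iota> a (\<sigma>o T b (on_obj F X)) \<cdot>\<^bsub>grMod R\<^esub> on_arr h (\<sigma>a T a (?J b X))) d ?y"
      using maps_Comp[OF h_Hom[OF jab] \<iota>(1)[OF bFX] y] by simp
    also have "\<dots> = maps (on_arr h (?J b X)) (- a + d) (maps (\<iota> a (on_obj F (\<sigma>o S b X))) d ?y)"
      using maps_Comp[OF \<iota>(1)[OF on_obj[OF bX]] shift_Hom[OF h_Hom[OF jb]] y] by (simp add: \<iota>_nat[OF jb])
    finally have "maps (?\<iota> (a + b) X) d m = maps (\<iota> b (on_obj F X)) (- a + d)
        (maps (on_arr h (?J b X)) (- a + d) (maps (?\<iota> a (\<sigma>o S b X)) d m))"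
      using \<iota>_add[OF FX Hom_grModD(4)[OF h_Hom[OF J(1)[OF X]] m]]
      by (simp only: maps_\<iota>'[OF X m] maps_\<iota>'[OF bX m'] z)
    moreover have "maps (?\<iota> a (\<sigma>o S b X)) d m \<in> carrier (Mdeg (on_obj h (on_obj F (\<sigma>o S b X))) (- a + d))"
      using Hom_grModD(4)[OF \<iota>'(1)[OF bX] m'] by simp
    ultimately show "maps (?\<iota> (a + b) X) d m = maps (?\<iota> b X) (- a + d) (maps (?\<iota> a (\<sigma>o S b X)) d m)"
      by (simp only: maps_\<iota>'[OF X])
  next
    fix X Y assume X: "X \<in> Obj S" and Y: "Y \<in> Obj S"
    interpret E: graded_module R "Ext S \<phi>\<^sub>S X Y" using S.graded_module_Ext[OF X Y] .
    have "graded_module_hom R (Ext S \<phi>\<^sub>S X Y) (Ext T \<phi>\<^sub>T (on_obj F X) (on_obj F Y)) (\<lambda>d u. \<Theta> d Y \<cdot>\<^bsub>T\<^esub> on_arr F u)"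
      using F X Y by (simp add: graded_linear_functor_def)
    moreover have "graded_module_hom R (Ext T \<phi>\<^sub>T (on_obj F X) (on_obj F Y))
        (graded_Hom R (on_obj h (on_obj F Y)) (on_obj h (on_obj F X)))
        (\<lambda>d u k. maps (on_arr h u \<cdot>\<^bsub>grMod R\<^esub> inv_arr (grMod R) (\<iota> d (on_obj F Y))) (d + k))"
      using h on_obj X Y by (simp add: graded_linear_mod_functor_def)
    ultimately have hom: "graded_module_hom R (Ext S \<phi>\<^sub>S X Y)
        (graded_Hom R (on_obj h (on_obj F Y)) (on_obj h (on_obj F X)))
        (\<lambda>d u k. maps (on_arr h (\<Theta> d Y \<cdot>\<^bsub>T\<^esub> on_arr F u) \<cdot>\<^bsub>grMod R\<^esub> inv_arr (grMod R) (\<iota> d (on_obj F Y))) (d + k))"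
      by (rule graded_module_hom_compose)
    \<comment> \<open>Inverting the twisted identification puts h(\<Theta>_d) next to h(F u). The
      degree d map that u induces through h F is thus the one that \<Theta>_d . F u induces through
      h, and \<open>hom\<close> applies.\<close>
    have "on_arr h (on_arr F u) \<cdot>\<^bsub>grMod R\<^esub> inv_arr (grMod R) (?\<iota> d Y) =
        on_arr h (\<Theta> d Y \<cdot>\<^bsub>T\<^esub> on_arr F u) \<cdot>\<^bsub>grMod R\<^esub> inv_arr (grMod R) (\<iota> d (on_obj F Y))"
      if u: "u \<in> Hom S X (\<sigma>o S d Y)" for d u
    proof -
      note t = iter_Hom[OF Y, of d] and i = \<iota>[OF on_obj[OF Y], of d]
      note ii = grMod.inv_arrD(1)[OF i(2,1)]
      have "inverse_arrows T (?J d Y) (\<Theta> d Y)"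
        using T.isomorphism_inv_arr[OF iter_isomorphism[OF Y]] by (rule T.inverse_arrows_sym)
      then have "inverse_arrows (grMod R) (on_arr h (?J d Y)) (on_arr h (\<Theta> d Y))"
        using h.on_inverse_arrows[of "?J d Y" "\<Theta> d Y"] by (simp add: inverse_arrows_def)
      from grMod.inverse_arrows_Comp[OF h_Hom[OF J(1)[OF Y]] i(1) this grMod.isomorphism_inv_arr[OF i(2)]]
      have "inv_arr (grMod R) (?\<iota> d Y) = on_arr h (\<Theta> d Y) \<cdot>\<^bsub>grMod R\<^esub> inv_arr (grMod R) (\<iota> d (on_obj F Y))"
        by (rule grMod.inv_arr_eq)
      then show ?thesis
        using grMod.Comp_assoc[OF ii h_Hom[OF t] h_Hom[OF on_arr[OF u]]] by (simp add: h_Comp[OF on_arr[OF u] t])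
    qed
    with E.graded_module_hom_cong[OF _ hom]
    show "graded_module_hom R (Ext S \<phi>\<^sub>S X Y)
        (graded_Hom R (on_obj (h \<circ>\<^sub>F F) Y) (on_obj (h \<circ>\<^sub>F F) X))
        (\<lambda>d u k. maps (on_arr (h \<circ>\<^sub>F F) u \<cdot>\<^bsub>grMod R\<^esub> inv_arr (grMod R) (?\<iota> d Y)) (d + k))"
      by simp
  qed
qed

section \<open>Right adjoints\<close>

text \<open>S and T share the type of arrows, so that the modules Ext(F X, Y), whose elements are
  arrows of T, live in the same category \<open>grMod R\<close> as the Ext modules of S that
  represent them.\<close>

theorem lemma3p1:
  fixes R :: "'r gring"
    and S :: "('a, 'u) triangulated" and \<phi>\<^sub>S :: "int \<Rightarrow> 'r \<Rightarrow> 'a \<Rightarrow> 'u"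
    and T :: "('b, 'u) triangulated" and \<phi>\<^sub>T :: "int \<Rightarrow> 'r \<Rightarrow> 'b \<Rightarrow> 'u"
  assumes "graded_commutative_ring R"
    and "graded_linear_category R S \<phi>\<^sub>S"
    and "graded_linear_category R T \<phi>\<^sub>T"
    and "Ext_finite R T \<phi>\<^sub>T"
    and "\<And>(h :: ('a, 'u, 'r, 'u) mod_functor) \<iota>.
      \<lbrakk>graded_linear_mod_functor R S \<phi>\<^sub>S h \<iota>; cohomological S h; locally_finite R S h\<rbrakk> \<Longrightarrow>
      graded_representable R S \<phi>\<^sub>S h \<iota>"
  shows "\<forall>F \<theta>. graded_linear_functor R S \<phi>\<^sub>S T \<phi>\<^sub>T F \<theta> \<longrightarrow> has_right_adjoint S T F"
proof (intro allI impI)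
  fix F :: "('a, 'u, 'b, 'u) cfunctor" and \<theta> :: "'a \<Rightarrow> 'u"
  assume F: "graded_linear_functor R S \<phi>\<^sub>S T \<phi>\<^sub>T F \<theta>"
  interpret S: graded_linear_category R S \<phi>\<^sub>S by fact
  interpret T: graded_linear_category R T \<phi>\<^sub>T by fact
  interpret exact_triangulated_functor S T F \<theta>
    using F by unfold_locales (simp add: graded_linear_functor_def)
  show "has_right_adjoint S T F"
  proof (rule has_right_adjoint_if_representable[OF cfunctor_axioms])
    fix Y assume Y: "Y \<in> Obj T"
    let ?h = "Ext_functor T \<phi>\<^sub>T Y \<circ>\<^sub>F F"
    have "locally_finite R S ?h"
      using \<open>Ext_finite R T \<phi>\<^sub>T\<close> Y on_obj by (simp add: locally_finite_def Ext_finite_def)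
    then obtain \<iota> where "graded_representable R S \<phi>\<^sub>S ?h \<iota>"
      using assms(5) graded_linear_restriction[OF assms(2,3) F T.graded_linear_Ext_functor[OF Y]]
        cohomological_restriction[OF T.cfunctor_Ext[OF Y] T.cohomological_Ext_functor[OF Y]] by blast
    then obtain G \<psi> where G: "G \<in> Obj S"
      and \<psi>: "natural_isomorphism (opposite S) (grMod R) ?h (Ext_functor S \<phi>\<^sub>S G) \<psi>"
      unfolding graded_representable_def by blast
    have \<psi>_Hom: "\<psi> X \<in> Hom (grMod R) (Ext T \<phi>\<^sub>T (on_obj F X) Y) (Ext S \<phi>\<^sub>S X G)"
      "isomorphism (grMod R) (\<psi> X)" if "X \<in> Obj S" for X
      using \<psi> that by (simp_all add: natural_isomorphism_def natural_transformation_def)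
    \<comment> \<open>As \<Sigma>^0 is the identity, the degree 0 parts of the two modules are Hom(F
      X, Y) and Hom(X, G Y).\<close>
    have bij: "bij_betw (maps (\<psi> X) 0) (Hom T (on_obj F X) Y) (Hom S X G)" if "X \<in> Obj S" for X
      using isomorphism_grMod_bij[OF \<psi>_Hom(2)[OF that] \<psi>_Hom(1)[OF that], of 0] by simp
    have "maps (\<psi> X') 0 (k \<cdot>\<^bsub>T\<^esub> on_arr F a) = maps (\<psi> X) 0 k \<cdot>\<^bsub>S\<^esub> a"
      if "X \<in> Obj S" "X' \<in> Obj S" and a: "a \<in> Hom S X' X" and k: "k \<in> Hom T (on_obj F X) Y" for X X' a k
    proof -
      note h = T.Ext_functor_Hom[OF on_arr[OF a] Y] and e = S.Ext_functor_Hom[OF a G]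
      have k0: "k \<in> carrier (Mdeg (Ext T \<phi>\<^sub>T (on_obj F X) Y) 0)" "k \<in> Hom T (on_obj F X) (\<sigma>o T 0 Y)"
        using k by simp_all
      have \<psi>k: "maps (\<psi> X) 0 k \<in> Hom S X (\<sigma>o S 0 G)"
        using bij_betwE[OF bij[OF that(1)]] k by simp
      \<comment> \<open>Both functors act on arrows by precomposition, so this naturality square,
        evaluated at k in degree 0, is the required compatibility with a.\<close>
      have "\<psi> X' \<cdot>\<^bsub>grMod R\<^esub> on_arr (Ext_functor T \<phi>\<^sub>T Y) (on_arr F a) =
          on_arr (Ext_functor S \<phi>\<^sub>S G) a \<cdot>\<^bsub>grMod R\<^esub> \<psi> X"
        using \<psi> that by (simp add: natural_isomorphism_def natural_transformation_def)
      then show ?thesis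
        using maps_Comp[OF h \<psi>_Hom(1)[OF that(2)] k0(1)] maps_Comp[OF \<psi>_Hom(1)[OF that(1)] e k0(1)]
        by (simp add: T.maps_Ext_functor[OF on_arr[OF a] k0(2)] S.maps_Ext_functor[OF a \<psi>k])
    qed
    then show "\<exists>G\<in>Obj S. \<exists>\<beta>. (\<forall>X\<in>Obj S. bij_betw (\<beta> X) (Hom T (on_obj F X) Y) (Hom S X G)) \<and>
        (\<forall>X\<in>Obj S. \<forall>X'\<in>Obj S. \<forall>a\<in>Hom S X' X. \<forall>k\<in>Hom T (on_obj F X) Y.
           \<beta> X' (k \<cdot>\<^bsub>T\<^esub> on_arr F a) = \<beta> X k \<cdot>\<^bsub>S\<^esub> a)"
      using G bij by (intro bexI[of _ G] exI[of _ "\<lambda>X. maps (\<psi> X) 0"]) blast+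
  qed
qed

end
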